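(* Let $R$ be a CF-ring. Then $\lambda\text{-}\dim(R)\le 2$, and $R$ is coherent if and only if $R_M$ is coherent for every maximal ideal $M$ of $R$.
   Context: All rings are commutative with identity. A canonical form for an $R$-module $E$ is an isomorphism $E\cong R/I_1\oplus\cdots\oplus R/I_n$ with ideals $I_1\subseteq I_2\subseteq\cdots\subseteq I_n\neq R$. $R$ is a CF-ring if every direct sum of finitely many cyclic $R$-modules has a canonical form. For an $R$-module $E$, $\lambda_R(E)$ is the supremum of the $n$ for which there is an exact sequence $F_n\to\cdots\to F_0\to E\to0$ with $F_i$ free of finite rank ($-1$ if $E$ is not finitely generated); $\lambda\text{-}\dim(R)$ is the least $n$ (or $\infty$) such that $\lambda_R(E)\ge n$ implies $\lambda_R(E)=\infty$ for all $R$-modules $E$. *)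

theory Defs
  imports "HOL-Algebra.Module" "HOL-Algebra.Ideal" "HOL-Library.Extended_Real"
begin

definition mod_hom :: "'a ring \<Rightarrow> ('a,'b) module \<Rightarrow> ('a,'c) module \<Rightarrow> ('b \<Rightarrow> 'c) set" where
  "mod_hom R M N = {f. (\<forall>x\<in>carrier M. f x \<in> carrier N)
     \<and> (\<forall>x\<in>carrier M. \<forall>y\<in>carrier M. f (x \<oplus>\<^bsub>M\<^esub> y) = f x \<oplus>\<^bsub>N\<^esub> f y)
     \<and> (\<forall>a\<in>carrier R. \<forall>x\<in>carrier M. f (a \<odot>\<^bsub>M\<^esub> x) = a \<odot>\<^bsub>N\<^esub> f x)}"

definition mod_iso :: "'a ring \<Rightarrow> ('a,'b) module \<Rightarrow> ('a,'c) module \<Rightarrow> ('b \<Rightarrow> 'c) set" where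
  "mod_iso R M N = {f \<in> mod_hom R M N. bij_betw f (carrier M) (carrier N)}"

definition fin_gen :: "'a ring \<Rightarrow> ('a,'b) module \<Rightarrow> bool" where
  "fin_gen R M \<longleftrightarrow> (\<exists>xs. set xs \<subseteq> carrier M \<and>
     (\<forall>x\<in>carrier M. \<exists>a. (\<forall>i<length xs. a i \<in> carrier R) \<and>
         x = finsum M (\<lambda>i. a i \<odot>\<^bsub>M\<^esub> xs ! i) {..<length xs}))"

definition freemod :: "'a ring \<Rightarrow> nat \<Rightarrow> ('a, nat \<Rightarrow> 'a) module" where
  "freemod R k = \<lparr> carrier = {v. (\<forall>i<k. v i \<in> carrier R) \<and> (\<forall>i\<ge>k. v i = \<zero>\<^bsub>R\<^esub>)},
     monoid.mult = (\<lambda>u v i. u i \<otimes>\<^bsub>R\<^esub> v i),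
     one = (\<lambda>i. if i < k then \<one>\<^bsub>R\<^esub> else \<zero>\<^bsub>R\<^esub>),
     zero = (\<lambda>i. \<zero>\<^bsub>R\<^esub>),
     add = (\<lambda>u v i. u i \<oplus>\<^bsub>R\<^esub> v i),
     smult = (\<lambda>a v i. a \<otimes>\<^bsub>R\<^esub> v i) \<rparr>"

definition ideal_module :: "'a ring \<Rightarrow> 'a set \<Rightarrow> ('a, 'a) module" where
  "ideal_module R I = \<lparr> carrier = I, monoid.mult = monoid.mult R, one = \<one>\<^bsub>R\<^esub>,
     zero = \<zero>\<^bsub>R\<^esub>, add = add R, smult = monoid.mult R \<rparr>"

text \<open>The direct sum R/J_0 (+) ... (+) R/J_(m-1), realised as the quotient of R^m by
  J_0 x ... x J_(m-1); elements are cosets.\<close>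
definition cyc_cls :: "'a ring \<Rightarrow> (nat \<Rightarrow> 'a set) \<Rightarrow> nat \<Rightarrow> (nat \<Rightarrow> 'a) \<Rightarrow> (nat \<Rightarrow> 'a) set" where
  "cyc_cls R Js m v = {u \<in> carrier (freemod R m). \<forall>i<m. u i \<ominus>\<^bsub>R\<^esub> v i \<in> Js i}"

definition cyc_sum :: "'a ring \<Rightarrow> (nat \<Rightarrow> 'a set) \<Rightarrow> nat \<Rightarrow> ('a, (nat \<Rightarrow> 'a) set) module" where
  "cyc_sum R Js m = \<lparr> carrier = cyc_cls R Js m ` carrier (freemod R m),
     monoid.mult = (\<lambda>A B. \<Union>{cyc_cls R Js m (\<lambda>i. u i \<otimes>\<^bsub>R\<^esub> v i) | u v. u \<in> A \<and> v \<in> B}),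
     one = cyc_cls R Js m (\<lambda>i. if i < m then \<one>\<^bsub>R\<^esub> else \<zero>\<^bsub>R\<^esub>),
     zero = cyc_cls R Js m (\<lambda>i. \<zero>\<^bsub>R\<^esub>),
     add = (\<lambda>A B. \<Union>{cyc_cls R Js m (\<lambda>i. u i \<oplus>\<^bsub>R\<^esub> v i) | u v. u \<in> A \<and> v \<in> B}),
     smult = (\<lambda>a A. \<Union>{cyc_cls R Js m (\<lambda>i. a \<otimes>\<^bsub>R\<^esub> v i) | v. v \<in> A}) \<rparr>"

definition has_canonical_form :: "'a ring \<Rightarrow> ('a,'b) module \<Rightarrow> bool" where
  "has_canonical_form R E \<longleftrightarrow> (\<exists>n Is. (\<forall>k<n. ideal (Is k) R)
      \<and> (\<forall>k. Suc k < n \<longrightarrow> Is k \<subseteq> Is (Suc k))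
      \<and> (0 < n \<longrightarrow> Is (n - 1) \<noteq> carrier R)
      \<and> mod_iso R E (cyc_sum R Is n) \<noteq> {})"

definition CF_ring :: "'a ring \<Rightarrow> bool" where
  "CF_ring R \<longleftrightarrow> (\<forall>m Js. (\<forall>i<m. ideal (Js i) R) \<longrightarrow> has_canonical_form R (cyc_sum R Js m))"

definition free_res :: "'a ring \<Rightarrow> ('a,'b) module \<Rightarrow> nat \<Rightarrow> bool" where
  "free_res R M n \<longleftrightarrow> (\<exists>(k::nat \<Rightarrow> nat) (d0::(nat \<Rightarrow> 'a) \<Rightarrow> 'b) (d::nat \<Rightarrow> (nat \<Rightarrow> 'a) \<Rightarrow> (nat \<Rightarrow> 'a)).
     d0 \<in> mod_hom R (freemod R (k 0)) M
     \<and> d0 ` carrier (freemod R (k 0)) = carrier M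
     \<and> (\<forall>i. 1 \<le> i \<and> i \<le> n \<longrightarrow> d i \<in> mod_hom R (freemod R (k i)) (freemod R (k (i - 1))))
     \<and> (1 \<le> n \<longrightarrow> d 1 ` carrier (freemod R (k 1))
            = {v \<in> carrier (freemod R (k 0)). d0 v = \<zero>\<^bsub>M\<^esub>})
     \<and> (\<forall>i. 1 \<le> i \<and> i < n \<longrightarrow> d (Suc i) ` carrier (freemod R (k (Suc i)))
            = {v \<in> carrier (freemod R (k i)). d i v = \<zero>\<^bsub>freemod R (k (i - 1))\<^esub>}))"

definition lambda_mod :: "'a ring \<Rightarrow> ('a,'b) module \<Rightarrow> ereal" where
  "lambda_mod R M = (if \<not> fin_gen R M then -1
                     else (SUP n \<in> {n. free_res R M n}. ereal (real n)))"

text \<open>lambda-dim, where "all R-modules E" ranges over modules with carrier type 'b.\<close>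
definition lambda_dim :: "'a ring \<Rightarrow> 'b itself \<Rightarrow> enat" where
  "lambda_dim R _ = (let P = (\<lambda>n::nat. \<forall>E :: ('a,'b) module. Module.module R E \<longrightarrow>
                          ereal (real n) \<le> lambda_mod R E \<longrightarrow> lambda_mod R E = \<infinity>)
                     in if \<exists>n. P n then enat (LEAST n. P n) else \<infinity>)"

definition fin_presented :: "'a ring \<Rightarrow> ('a,'b) module \<Rightarrow> bool" where
  "fin_presented R M \<longleftrightarrow> free_res R M 1"

definition coherent :: "'a ring \<Rightarrow> bool" where
  "coherent R \<longleftrightarrow> (\<forall>I. ideal I R \<and> (\<exists>S. finite S \<and> S \<subseteq> carrier R \<and> I = genideal R S)
                       \<longrightarrow> fin_presented R (ideal_module R I))"

definition loc_cls :: "'a ring \<Rightarrow> 'a set \<Rightarrow> 'a \<Rightarrow> 'a \<Rightarrow> ('a \<times> 'a) set" where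
  "loc_cls R P r s = {(r', s'). r' \<in> carrier R \<and> s' \<in> carrier R - P \<and>
      (\<exists>t \<in> carrier R - P. t \<otimes>\<^bsub>R\<^esub> (r \<otimes>\<^bsub>R\<^esub> s' \<ominus>\<^bsub>R\<^esub> r' \<otimes>\<^bsub>R\<^esub> s) = \<zero>\<^bsub>R\<^esub>)}"

definition localization :: "'a ring \<Rightarrow> 'a set \<Rightarrow> ('a \<times> 'a) set ring" where
  "localization R P = \<lparr> carrier = {loc_cls R P r s | r s. r \<in> carrier R \<and> s \<in> carrier R - P},
     monoid.mult = (\<lambda>A B. \<Union>{loc_cls R P (a \<otimes>\<^bsub>R\<^esub> c) (b \<otimes>\<^bsub>R\<^esub> d) | a b c d. (a, b) \<in> A \<and> (c, d) \<in> B}),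
     one = loc_cls R P \<one>\<^bsub>R\<^esub> \<one>\<^bsub>R\<^esub>,
     zero = loc_cls R P \<zero>\<^bsub>R\<^esub> \<one>\<^bsub>R\<^esub>,
     add = (\<lambda>A B. \<Union>{loc_cls R P (a \<otimes>\<^bsub>R\<^esub> d \<oplus>\<^bsub>R\<^esub> c \<otimes>\<^bsub>R\<^esub> b) (b \<otimes>\<^bsub>R\<^esub> d) | a b c d. (a, b) \<in> A \<and> (c, d) \<in> B}) \<rparr>"

end

theory Submission
  imports Defs "HOL-Algebra.QuotRing"
begin

text \<open>
  Writing out a canonical form of \<open>R/I \<oplus> R/J\<close> in coordinates gives \<open>(I : J) + (J : I) = R\<close> for
  \<^emph>\<open>all\<close> ideals \<open>I\<close>, \<open>J\<close>, and only this property of \<open>R\<close> is used afterwards. For principal ideals it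
  makes every \<open>R\<^sub>M\<close> a valuation ring. For infinitely generated ideals it has two further consequences.
  First, no \<open>R/L\<close> with \<open>L\<close> radical contains an infinite orthogonal family: the comparison would
  separate the branches of the binary tree lying in \<open>T\<close> from the others for every set \<open>T\<close> of branches,
  and there are more such sets than sets of nodes. Second, a prime contained in two maximal ideals
  vanishes in one of the two localisations. Together they show that if \<open>(0 : a)\<close> is generated by one
  element in \<open>R\<^sub>M\<close>, then it is so on a neighbourhood of \<open>M\<close>. In a valuation ring
  \<open>(0 : a) = (b)\<close> with \<open>b \<noteq> 0\<close> implies \<open>(0 : b) = (a)\<close>; diagonalising matrices near \<open>M\<close>, these two
  facts make the kernel of the second of two consecutive maps in a free resolution finitely
  generated near every \<open>M\<close>, hence finitely generated, so every resolution of length two extends;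
  and they turn local coherence into coherence.
\<close>

section \<open>Ideals in commutative rings\<close>

context cring
begin

text \<open>The difficulty is uniformity. Valuation arguments at \<open>M\<close> give each element
  of an annihilator its own multiplier outside \<open>M\<close>, and as annihilators may be
  infinitely generated, no finite product of multipliers serves all elements. The comparison of
  infinitely generated ideals supplies a single multiplier: for \<open>k\<close> in \<open>M\<close>
  it gives the least prime \<open>Q\<close> inside \<open>M\<close> containing \<open>k\<close>, and
  \<open>e\<close> outside \<open>M\<close>, such that every maximal ideal \<open>N\<close>
  containing \<open>k\<close> either makes \<open>e\<close> a local multiple of \<open>k\<close> or
  contains \<open>Q\<close>. If \<open>k\<close> is nonzero at \<open>M\<close>, then
  \<open>Q\<close> vanishes at each such \<open>N\<close> other than \<open>M\<close>. The bound is
  2 because two maps \<open>A\<close>, \<open>B\<close> with kernel of \<open>A\<close> equal to the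
  image of \<open>B\<close> are consumed. Exactness makes the kernel of \<open>A\<close> finitely
  generated, hence also the annihilators of its diagonal entries \<open>a l\<close>. Up to
  multipliers, \<open>B\<close> then factors through the diagonal matrix of their local generators
  \<open>b l\<close>, so the kernel of \<open>B\<close> is governed by the annihilators of the
  \<open>b l\<close>. A single map gives no control over the annihilators of the \<open>a l\<close>.
  Canonical forms of \<open>R/I \<oplus> R/J\<close> have at most two summands, since two generators
  cannot map onto three free ones over a nonzero quotient ring.\<close>

lemma ideal_cringI:
  assumes "I \<subseteq> carrier R" "\<zero> \<in> I"
    and add: "\<And>x y. \<lbrakk>x \<in> I; y \<in> I\<rbrakk> \<Longrightarrow> x \<oplus> y \<in> I"
    and mult: "\<And>a x. \<lbrakk>a \<in> carrier R; x \<in> I\<rbrakk> \<Longrightarrow> a \<otimes> x \<in> I"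
  shows "ideal I R"
proof (intro idealI subgroup.intro)
  show "ring R" by (rule ring_axioms)
  fix x assume x: "x \<in> I"
  have "\<ominus> \<one> \<otimes> x \<in> I" using x by (intro mult) auto
  moreover have "\<ominus> \<one> \<otimes> x = \<ominus> x" using x assms(1) by (auto simp: l_minus)
  ultimately show "inv\<^bsub>add_monoid R\<^esub> x \<in> I" by (simp add: a_inv_def)
next
  fix a x assume "a \<in> I" "x \<in> carrier R"
  then show "a \<otimes> x \<in> I" using mult[of x a] assms(1) m_comm by auto
qed (use assms in auto)

lemma ideal_minus_closed: "ideal I R \<Longrightarrow> x \<in> I \<Longrightarrow> y \<in> I \<Longrightarrow> x \<ominus> y \<in> I"
  by (metis additive_subgroup.a_closed additive_subgroup.a_inv_closed a_minus_def ideal.axioms(1))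

lemma ideal_add_closed: "ideal I R \<Longrightarrow> x \<in> I \<Longrightarrow> y \<in> I \<Longrightarrow> x \<oplus> y \<in> I"
  by (simp add: additive_subgroup.a_closed ideal.axioms(1))

lemma ideal_zero_mem: "ideal I R \<Longrightarrow> \<zero> \<in> I"
  by (simp add: additive_subgroup.zero_closed ideal.axioms(1))

lemma exists_maximalideal:
  assumes "ideal I R" "\<one> \<notin> I"
  obtains M where "maximalideal M R" "I \<subseteq> M"
proof -
  let ?S = "{J. ideal J R \<and> I \<subseteq> J \<and> \<one> \<notin> J}"
  have "\<exists>M\<in>?S. \<forall>X\<in>?S. M \<subseteq> X \<longrightarrow> X = M"
  proof (rule subset_Zorn_nonempty)
    show "?S \<noteq> {}" using assms by auto
  next
    fix C assume ne: "C \<noteq> {}" and ch: "subset.chain ?S C"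
    have CS: "C \<subseteq> ?S" and tot: "\<And>X Y. X \<in> C \<Longrightarrow> Y \<in> C \<Longrightarrow> X \<subseteq> Y \<or> Y \<subseteq> X"
      using ch by (auto simp: subset_chain_def)
    have "ideal (\<Union>C) R"
    proof (rule ideal_cringI)
      show "\<Union>C \<subseteq> carrier R" using CS ideal.Icarr by fastforce
      show "\<zero> \<in> \<Union>C" using CS ne ideal_zero_mem by blast
    next
      fix x y assume "x \<in> \<Union>C" "y \<in> \<Union>C"
      then obtain X Y where XY: "X \<in> C" "Y \<in> C" "x \<in> X" "y \<in> Y" by auto
      then obtain Z where "Z \<in> C" "x \<in> Z" "y \<in> Z" using tot by blast
      then show "x \<oplus> y \<in> \<Union>C" using CS ideal_add_closed by blast
    next
      fix a x assume a: "a \<in> carrier R" and "x \<in> \<Union>C"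
      then obtain X where X: "X \<in> C" "x \<in> X" by auto
      then have "ideal X R" using CS by auto
      then show "a \<otimes> x \<in> \<Union>C" using a X ideal.I_l_closed[of X R x a] by auto
    qed
    then show "\<Union>C \<in> ?S" using ne CS by auto
  qed
  then obtain M where M: "ideal M R" "I \<subseteq> M" "\<one> \<notin> M"
    and max: "\<And>X. \<lbrakk>ideal X R; I \<subseteq> X; \<one> \<notin> X; M \<subseteq> X\<rbrakk> \<Longrightarrow> X = M" by auto
  have "maximalideal M R"
  proof (rule maximalidealI)
    show "carrier R \<noteq> M" using M by auto
    show "J = M \<or> J = carrier R" if "ideal J R" "M \<subseteq> J" "J \<subseteq> carrier R" for J
      using that max[of J] M ideal.one_imp_carrier[of J R] by blast
  qed (use M in auto)
  then show thesis using that M by blast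
qed

text \<open>An ideal meeting the complement of every maximal ideal is contained in none of them.
  Local results are glued in this form: the multipliers for which a statement holds make up an
  ideal.\<close>

lemma ideal_eq_carrier_local:
  assumes "ideal I R" "\<And>M. maximalideal M R \<Longrightarrow> \<exists>s\<in>carrier R - M. s \<in> I"
  shows "\<one> \<in> I"
  using exists_maximalideal[OF assms(1)] assms(2) by (metis DiffD2 subsetD)

lemma primeideal_maximal: "maximalideal M R \<Longrightarrow> primeideal M R"
  by (rule maximalideal_prime)

lemma primeideal_one_notin: "primeideal P R \<Longrightarrow> \<one> \<notin> P"
  by (metis ideal.one_imp_carrier primeideal.I_notcarr primeideal_def)

lemma primeideal_mult_notin:
  "\<lbrakk>primeideal P R; x \<in> carrier R - P; y \<in> carrier R - P\<rbrakk> \<Longrightarrow> x \<otimes> y \<in> carrier R - P"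
  using primeideal.I_prime by fastforce

lemma primeideal_pow_notin:
  assumes "primeideal P R" "x \<in> carrier R - P"
  shows "x [^] (n::nat) \<in> carrier R - P"
proof (induct n)
  case 0
  then show ?case using assms by (simp add: primeideal_one_notin)
next
  case (Suc n)
  then show ?case using assms primeideal_mult_notin[of P "x [^] n" x] by simp
qed

lemma primeideal_ideal: "primeideal P R \<Longrightarrow> ideal P R"
  by (simp add: primeideal_def)

lemma maximalideal_not_subset:
  assumes "maximalideal M R" "maximalideal N R" "M \<noteq> N"
  obtains x where "x \<in> M" "x \<notin> N"
proof -
  have "ideal N R" using assms(2) by (simp add: maximalideal_def)
  then have "\<not> M \<subseteq> N"
    using assms(3) maximalideal.I_maximal[OF assms(1), of N] maximalideal.I_notcarr[OF assms(2)]
      ideal.Icarr[of N R] by blast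
  then show thesis using that by blast
qed

section \<open>Annihilators, radicals and principal ideals\<close>

definition annih :: "'a \<Rightarrow> 'a set" where
  "annih a = {x \<in> carrier R. a \<otimes> x = \<zero>}"

text \<open>The image of \<open>b\<close> in the localisation at \<open>M\<close> vanishes.\<close>
definition zeroat :: "'a set \<Rightarrow> 'a \<Rightarrow> bool" where
  "zeroat M b \<longleftrightarrow> (\<exists>s\<in>carrier R - M. s \<otimes> b = \<zero>)"

lemma annih_ideal: "a \<in> carrier R \<Longrightarrow> ideal (annih a) R"
  by (rule ideal_cringI) (auto simp: annih_def r_distr m_lcomm[of a])

definition radic :: "'a set \<Rightarrow> 'a set" where
  "radic K = {x \<in> carrier R. \<exists>n::nat. x [^] n \<in> K}"

text \<open>The factor \<open>z\<close> replaces the binomial formula: splitting off one factor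
  \<open>x \<oplus> y\<close> turns \<open>z\<close> into \<open>z \<otimes> x\<close> or
  \<open>z \<otimes> y\<close> and lowers one exponent. Once an exponent is zero, \<open>z\<close>
  itself is in \<open>K\<close>.\<close>

lemma sum_pow_mem_ideal:
  assumes K: "ideal K R" and xy: "x \<in> carrier R" "y \<in> carrier R"
  shows "z \<in> carrier R \<Longrightarrow> z \<otimes> x [^] (n::nat) \<in> K \<Longrightarrow> z \<otimes> y [^] (m::nat) \<in> K
    \<Longrightarrow> z \<otimes> (x \<oplus> y) [^] (n + m) \<in> K"
proof (induct "n + m" arbitrary: n m z)
  case 0
  then show ?case by simp
next
  case (Suc k)
  show ?case
  proof (cases "n = 0 \<or> m = 0")
    case True
    then have "z \<in> K" using Suc by auto
    then show ?thesis using K xy by (simp add: ideal.I_r_closed)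
  next
    case False
    then obtain n' m' where nm: "n = Suc n'" "m = Suc m'" by (meson not0_implies_Suc)
    note cl = xy Suc(3)
    have "z \<otimes> x \<otimes> x [^] n' = z \<otimes> x [^] n" "z \<otimes> y \<otimes> x [^] n = y \<otimes> (z \<otimes> x [^] n)"
      "z \<otimes> y \<otimes> y [^] m' = z \<otimes> y [^] m" "z \<otimes> x \<otimes> y [^] m = x \<otimes> (z \<otimes> y [^] m)"
      using cl nm by (auto simp: m_ac)
    then have "z \<otimes> x \<otimes> (x \<oplus> y) [^] (n' + m) \<in> K" "z \<otimes> y \<otimes> (x \<oplus> y) [^] (n + m') \<in> K"
      using Suc(1)[of n' m "z \<otimes> x"] Suc(1)[of n m' "z \<otimes> y"] Suc(2-) nm cl ideal.I_l_closed[OF K]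
      by simp_all
    moreover have "z \<otimes> (x \<oplus> y) [^] (n + m)
        = z \<otimes> x \<otimes> (x \<oplus> y) [^] (n' + m) \<oplus> z \<otimes> y \<otimes> (x \<oplus> y) [^] (n + m')"
    proof -
      have "z \<otimes> (w \<otimes> (x \<oplus> y)) = z \<otimes> x \<otimes> w \<oplus> z \<otimes> y \<otimes> w" if "w \<in> carrier R" for w
        using cl that by algebra
      from this[of "(x \<oplus> y) [^] (n' + m)"] show ?thesis using cl nm by simp
    qed
    ultimately show ?thesis using ideal_add_closed[OF K] by simp
  qed
qed

lemma radic_ideal:
  assumes "ideal K R" shows "ideal (radic K) R"
proof (rule ideal_cringI)
  show "\<zero> \<in> radic K"
    using ideal_zero_mem[OF assms] by (auto simp: radic_def intro!: exI[of _ "1::nat"])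
next
  fix x y assume "x \<in> radic K" "y \<in> radic K"
  then obtain n m :: nat where "x \<in> carrier R" "y \<in> carrier R" "x [^] n \<in> K" "y [^] m \<in> K"
    by (auto simp: radic_def)
  then show "x \<oplus> y \<in> radic K"
    using sum_pow_mem_ideal[OF assms, of x y \<one> n m] by (auto simp: radic_def)
next
  fix a x assume "a \<in> carrier R" "x \<in> radic K"
  then show "a \<otimes> x \<in> radic K"
    using ideal.I_l_closed[OF assms] by (auto simp: radic_def nat_pow_distrib) (meson nat_pow_closed)
qed (auto simp: radic_def)

lemma radic_square:
  assumes "x \<in> carrier R" "x \<otimes> x \<in> radic K" shows "x \<in> radic K"
proof -
  obtain n :: nat where "(x \<otimes> x) [^] n \<in> K" using assms by (auto simp: radic_def)
  then have "x [^] (n + n) \<in> K" using assms by (simp add: nat_pow_distrib nat_pow_mult)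
  then show ?thesis using assms by (auto simp: radic_def)
qed

lemma radic_subset: "ideal K R \<Longrightarrow> K \<subseteq> radic K"
  by (auto simp: radic_def ideal.Icarr intro!: exI[of _ "1::nat"])

lemma radic_subset_prime:
  assumes "primeideal P R" "K \<subseteq> P" shows "radic K \<subseteq> P"
  using primeideal_pow_notin[OF assms(1)] assms(2) by (auto simp: radic_def)

lemma mem_PIdl: "x \<in> PIdl b \<longleftrightarrow> (\<exists>r\<in>carrier R. x = r \<otimes> b)"
  by (auto simp: cgenideal_def)

lemma PIdl_mult_mem: "\<lbrakk>b \<in> carrier R; r \<in> carrier R\<rbrakk> \<Longrightarrow> r \<otimes> b \<in> PIdl b"
  by (auto simp: mem_PIdl)

lemma PIdl_subset: "\<lbrakk>ideal K R; b \<in> K\<rbrakk> \<Longrightarrow> PIdl b \<subseteq> K"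
  by (auto simp: mem_PIdl ideal.I_l_closed)

end

section \<open>Comparison of arbitrary ideals\<close>

locale ideal_comparison = cring +
  assumes comparison: "\<lbrakk>ideal I R; ideal J R\<rbrakk> \<Longrightarrow>
    \<exists>c\<in>carrier R. \<exists>d\<in>carrier R. c \<oplus> d = \<one> \<and> (\<forall>x\<in>J. c \<otimes> x \<in> I) \<and> (\<forall>x\<in>I. d \<otimes> x \<in> J)"

text \<open>Boolean lists are the nodes of the binary tree, and a branch consists of the initial
  segments of a sequence. This gives an almost disjoint family: uncountably many infinite subsets of
  a countable set, any two with finite intersection.\<close>

definition branch :: "(nat \<Rightarrow> bool) \<Rightarrow> bool list set" where
  "branch x = range (\<lambda>n. map x [0..<n])"

lemma infinite_branch: "infinite (branch x)"
  unfolding branch_def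
proof (rule range_inj_infinite, rule injI)
  fix n m assume "map x [0..<n] = map x [0..<m]"
  then show "n = m" by (metis length_map length_upt diff_zero)
qed

lemma finite_branch_Int:
  assumes "x \<noteq> y" shows "finite (branch x \<inter> branch y)"
proof -
  obtain k where k: "x k \<noteq> y k" using assms by auto
  have "branch x \<inter> branch y \<subseteq> (\<lambda>n. map x [0..<n]) ` {..k}"
  proof
    fix w assume "w \<in> branch x \<inter> branch y"
    then obtain n m where nm: "w = map x [0..<n]" "w = map y [0..<m]" unfolding branch_def by blast
    then have "n = m" by (metis length_map length_upt diff_zero)
    then have "\<not> k < n" using k nm by (metis add_0 length_map length_upt diff_zero nth_map nth_upt)
    then show "w \<in> (\<lambda>n. map x [0..<n]) ` {..k}" using nm by auto
  qed
  then show ?thesis by (meson finite_atMost finite_imageI finite_subset)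
qed

text \<open>Nodes are countable, so sets of nodes inject into sequences; composed with
  \<open>D\<close> this would embed the power set of the sequences into the sequences, against
  Cantor's theorem.\<close>

lemma no_inj_set_branching: "\<not> inj (D :: (nat \<Rightarrow> bool) set \<Rightarrow> bool list set)"
proof
  assume D: "inj D"
  define E :: "bool list set \<Rightarrow> nat \<Rightarrow> bool" where "E S = (\<lambda>n. n \<in> to_nat ` S)" for S
  have "inj E"
  proof (rule injI)
    fix S S' assume "E S = E S'"
    then have "to_nat ` S = to_nat ` S'" by (auto simp: E_def fun_eq_iff)
    then show "S = S'" by (simp add: inj_image_eq_iff)
  qed
  then have "inj (E \<circ> D)" using D by (simp add: inj_compose)
  then have "surj (inv_into UNIV (E \<circ> D))" by (rule inj_imp_surj_inv)
  then show False using Cantors_theorem[of "UNIV :: (nat \<Rightarrow> bool) set"] by (metis Pow_UNIV)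
qed

section \<open>Orthogonal families modulo a radical ideal\<close>

context ideal_comparison
begin

text \<open>Modulo \<open>L\<close> an orthogonal family behaves like bumps at distinct points, here
  the nodes of the tree, and \<open>supp r\<close> records the points at which \<open>r\<close> does
  not vanish. The comparison is used twice: on the ideals of elements supported in \<open>S\<close>
  and off \<open>S\<close>, which yields partitions of unity for arbitrary sets of nodes, and then
  on \<open>A T\<close> and \<open>A (- T)\<close>, whose comparison encodes the set of branches
  \<open>T\<close> in one set of nodes.\<close>

lemma no_infinite_orthogonal:
  fixes g :: "nat \<Rightarrow> 'a"
  assumes L: "ideal L R" and radical: "\<And>x. \<lbrakk>x \<in> carrier R; x \<otimes> x \<in> L\<rbrakk> \<Longrightarrow> x \<in> L"
    and g: "\<And>n. g n \<in> carrier R" "\<And>n. g n \<notin> L" "\<And>n m. n \<noteq> m \<Longrightarrow> g n \<otimes> g m \<in> L"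
  shows False
proof -
  define h :: "bool list \<Rightarrow> 'a" where "h w = g (to_nat w)" for w
  have h: "h w \<in> carrier R" "h w \<notin> L" "v \<noteq> w \<Longrightarrow> h v \<otimes> h w \<in> L" for v w
    using g by (auto simp: h_def)
  define supp where "supp r = {w. r \<otimes> h w \<notin> L}" for r
  have supp_zero: "supp \<zero> = {}" using h ideal_zero_mem[OF L] by (auto simp: supp_def)
  have supp_add: "supp (r \<oplus> s) \<subseteq> supp r \<union> supp s" if "r \<in> carrier R" "s \<in> carrier R" for r s
    using that h ideal_add_closed[OF L] by (auto simp: supp_def l_distr)
  have supp_mult: "supp (a \<otimes> r) \<subseteq> supp r" if "r \<in> carrier R" "a \<in> carrier R" for r a
    using that h ideal.I_l_closed[OF L] by (auto simp: supp_def m_assoc)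
  have supp_h: "supp (h w) \<subseteq> {w}" for w
  proof
    fix v assume "v \<in> supp (h w)"
    then have "h w \<otimes> h v \<notin> L" by (simp add: supp_def)
    then show "v \<in> {w}" using h(3)[of w v] by blast
  qed
  have ideal_supp: "ideal {r \<in> carrier R. supp r \<subseteq> S} R" for S
  proof (rule ideal_cringI, goal_cases)
    case (3 x y)
    then show ?case using supp_add[of x y] by auto
  next
    case (4 a x)
    then show ?case using supp_mult[of x a] by auto
  qed (auto simp: supp_zero)
  have supp_one: "supp c \<union> supp d = UNIV"
    if "c \<in> carrier R" "d \<in> carrier R" "c \<oplus> d = \<one>" for c d
  proof -
    have "supp \<one> = UNIV" using h by (auto simp: supp_def)
    then show ?thesis using supp_add[of c d] that by auto
  qed
  \<comment> \<open>For \<open>w\<close> off \<open>S\<close>, the element \<open>h w\<close> is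
    supported in \<open>- S\<close>, so \<open>c \<otimes> h w\<close> vanishes at \<open>w\<close>.
    Thus \<open>c\<close> kills the square of \<open>h w\<close> modulo \<open>L\<close>, and
    radicality removes the square.\<close>
  have half: "supp c \<subseteq> S"
    if c: "c \<in> carrier R" and cS: "\<And>x. x \<in> carrier R \<Longrightarrow> supp x \<subseteq> - S \<Longrightarrow> supp (c \<otimes> x) \<subseteq> S" for c S
  proof
    fix w assume w: "w \<in> supp c"
    show "w \<in> S"
    proof (rule ccontr)
      assume "w \<notin> S"
      then have "supp (h w) \<subseteq> - S" using supp_h[of w] by auto
      then have "w \<notin> supp (c \<otimes> h w)" using cS[of "h w"] h \<open>w \<notin> S\<close> by auto
      then have "c \<otimes> h w \<otimes> h w \<in> L" by (simp add: supp_def)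
      then have "c \<otimes> (c \<otimes> h w \<otimes> h w) \<in> L" using c L by (simp add: ideal.I_l_closed)
      moreover have "c \<otimes> (c \<otimes> h w \<otimes> h w) = (c \<otimes> h w) \<otimes> (c \<otimes> h w)" using c h by algebra
      ultimately have "c \<otimes> h w \<in> L" using radical[of "c \<otimes> h w"] c h by simp
      then show False using w by (simp add: supp_def)
    qed
  qed
  have split: "\<exists>c\<in>carrier R. \<exists>d\<in>carrier R. c \<oplus> d = \<one> \<and> supp c \<subseteq> S \<and> supp d \<subseteq> - S" for S
  proof -
    obtain c d where cd: "c \<in> carrier R" "d \<in> carrier R" "c \<oplus> d = \<one>"
      "\<And>x. x \<in> carrier R \<Longrightarrow> supp x \<subseteq> - S \<Longrightarrow> supp (c \<otimes> x) \<subseteq> S"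
      "\<And>x. x \<in> carrier R \<Longrightarrow> supp x \<subseteq> S \<Longrightarrow> supp (d \<otimes> x) \<subseteq> - S"
      using comparison[OF ideal_supp[of S] ideal_supp[of "- S"]] by auto
    then show ?thesis using half[of c S] half[of d "- S"] by auto
  qed
  \<comment> \<open>The finite error matches the almost disjointness of branches: an element of
    \<open>A (- T)\<close> can meet a branch from \<open>T\<close> in finitely many nodes
    only.\<close>
  define A where "A T = {r \<in> carrier R. \<exists>F. finite F \<and> F \<subseteq> T \<and> finite (supp r - \<Union>(branch ` F))}" for T
  have A_ideal: "ideal (A T) R" for T
  proof (rule ideal_cringI)
    show "\<zero> \<in> A T" by (auto simp: A_def supp_zero)
  next
    fix x y assume "x \<in> A T" "y \<in> A T"
    then obtain F G where FG: "x \<in> carrier R" "y \<in> carrier R" "finite F" "F \<subseteq> T" "finite G" "G \<subseteq> T"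
      "finite (supp x - \<Union>(branch ` F))" "finite (supp y - \<Union>(branch ` G))" by (auto simp: A_def)
    have "supp (x \<oplus> y) - \<Union>(branch ` (F \<union> G))
        \<subseteq> (supp x - \<Union>(branch ` F)) \<union> (supp y - \<Union>(branch ` G))"
      using supp_add[of x y] FG by auto
    then have "finite (supp (x \<oplus> y) - \<Union>(branch ` (F \<union> G)))"
      using FG by (meson finite_Un finite_subset)
    then show "x \<oplus> y \<in> A T" using FG by (auto simp: A_def intro!: exI[of _ "F \<union> G"])
  next
    fix a x assume a: "a \<in> carrier R" "x \<in> A T"
    then obtain F where F: "x \<in> carrier R" "finite F" "F \<subseteq> T" "finite (supp x - \<Union>(branch ` F))"
      by (auto simp: A_def)
    have "supp (a \<otimes> x) - \<Union>(branch ` F) \<subseteq> supp x - \<Union>(branch ` F)"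
      using supp_mult[of x a] F a by auto
    then show "a \<otimes> x \<in> A T" using F a by (auto simp: A_def dest: finite_subset)
  qed (auto simp: A_def)
  \<comment> \<open>By \<open>split\<close> some \<open>r\<close> in \<open>A T\<close> acts as one
    on the branch \<open>\<alpha>\<close>, so \<open>d\<close> and \<open>d \<otimes> r\<close> have
    the same support there. But \<open>d \<otimes> r\<close> is in \<open>A (- T)\<close>, so almost
    all of that support is covered by finitely many branches other than
    \<open>\<alpha>\<close>.\<close>
  have fin: "finite (supp d \<inter> branch \<alpha>)"
    if d: "d \<in> carrier R" "\<forall>x\<in>A T. d \<otimes> x \<in> A (- T)" and \<alpha>: "\<alpha> \<in> T" for d T \<alpha>
  proof -
    obtain r r' where r: "r \<in> carrier R" "r' \<in> carrier R" "r \<oplus> r' = \<one>"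
      "supp r \<subseteq> branch \<alpha>" "supp r' \<subseteq> - branch \<alpha>" using split by blast
    have "finite (supp r - branch \<alpha>)" using r by (metis Diff_eq_empty_iff finite.emptyI)
    then have "r \<in> A T" using r \<alpha> by (auto simp: A_def intro!: exI[of _ "{\<alpha>}"])
    then obtain F where F: "finite F" "F \<subseteq> - T" "finite (supp (d \<otimes> r) - \<Union>(branch ` F))"
      using d by (auto simp: A_def)
    have "supp d \<inter> branch \<alpha> \<subseteq> supp (d \<otimes> r)"
    proof
      fix w assume w: "w \<in> supp d \<inter> branch \<alpha>"
      then have "r' \<otimes> h w \<in> L" using r by (auto simp: supp_def)
      then have "d \<otimes> (r' \<otimes> h w) \<in> L" using d L by (simp add: ideal.I_l_closed)
      moreover have "d \<otimes> h w = d \<otimes> r \<otimes> h w \<oplus> d \<otimes> (r' \<otimes> h w)"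
      proof -
        have "d \<otimes> r \<otimes> h w \<oplus> d \<otimes> (r' \<otimes> h w) = d \<otimes> (r \<oplus> r') \<otimes> h w" using d r(1,2) h by algebra
        then show ?thesis using r d h by simp
      qed
      ultimately show "w \<in> supp (d \<otimes> r)" using w ideal_add_closed[OF L] by (auto simp: supp_def)
    qed
    then have "supp d \<inter> branch \<alpha> \<subseteq> (supp (d \<otimes> r) - \<Union>(branch ` F)) \<union> (\<Union>\<beta>\<in>F. branch \<alpha> \<inter> branch \<beta>)"
      by auto
    moreover have "finite (\<Union>\<beta>\<in>F. branch \<alpha> \<inter> branch \<beta>)"
      using F \<alpha> by (intro finite_UN_I finite_branch_Int) auto
    ultimately show ?thesis using F by (meson finite_Un finite_subset)
  qed
  \<comment> \<open>The set is \<open>supp d\<close>. For branches outside \<open>T\<close> the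
    support of \<open>c\<close> is finite, and as \<open>c \<oplus> d = \<one>\<close> the supports
    of \<open>c\<close> and \<open>d\<close> cover the infinite branch. Hence \<open>T\<close> can
    be read off from \<open>D\<close>.\<close>
  have "\<exists>D. \<forall>\<alpha>. \<alpha> \<in> T \<longleftrightarrow> finite (D \<inter> branch \<alpha>)" for T
  proof -
    obtain c d where cd: "c \<in> carrier R" "d \<in> carrier R" "c \<oplus> d = \<one>"
      "\<forall>x\<in>A (- T). c \<otimes> x \<in> A T" "\<forall>x\<in>A T. d \<otimes> x \<in> A (- T)"
      using comparison[OF A_ideal[of T] A_ideal[of "- T"]] by blast
    have "\<alpha> \<in> T \<longleftrightarrow> finite (supp d \<inter> branch \<alpha>)" for \<alpha>
    proof (cases "\<alpha> \<in> T")
      case True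
      then show ?thesis using fin[of d T \<alpha>] cd by auto
    next
      case False
      then have "finite (supp c \<inter> branch \<alpha>)" using fin[of c "- T" \<alpha>] cd by auto
      moreover have "branch \<alpha> \<subseteq> (supp c \<inter> branch \<alpha>) \<union> (supp d \<inter> branch \<alpha>)"
        using supp_one[of c d] cd by auto
      ultimately have "infinite (supp d \<inter> branch \<alpha>)"
        by (meson finite_Un finite_subset infinite_branch)
      then show ?thesis using False by simp
    qed
    then show ?thesis by blast
  qed
  then obtain D where D: "\<And>T \<alpha>. \<alpha> \<in> T \<longleftrightarrow> finite (D T \<inter> branch \<alpha>)" by metis
  have "inj D"
  proof (rule injI)
    fix T T' assume "D T = D T'"
    then show "T = T'" using D[of _ T] D[of _ T'] by auto
  qed
  then show False using no_inj_set_branching by blast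
qed

text \<open>The set \<open>Q\<close> in the proof is the kernel of localisation at \<open>M\<close>
  modulo \<open>L\<close>. If no single element outside \<open>M\<close> killed it, killing its
  elements one after another would build an infinite orthogonal family. The comparison then improves
  the killing element to some \<open>c\<close> that is idempotent modulo \<open>L\<close>, since
  \<open>c \<oplus> d = \<one>\<close> and \<open>c \<otimes> d \<in> L\<close>.\<close>

lemma radical_isolation:
  assumes L: "ideal L R" and radical: "\<And>x. \<lbrakk>x \<in> carrier R; x \<otimes> x \<in> L\<rbrakk> \<Longrightarrow> x \<in> L"
    and M: "primeideal M R" "L \<subseteq> M"
  shows "\<exists>c\<in>carrier R - M. \<exists>d\<in>carrier R. c \<oplus> d = \<one> \<and> c \<otimes> d \<in> L
    \<and> (\<forall>x\<in>carrier R. \<forall>u\<in>carrier R - M. u \<otimes> x \<in> L \<longrightarrow> c \<otimes> x \<in> L)"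
proof -
  define Q where "Q = {x \<in> carrier R. \<exists>u\<in>carrier R - M. u \<otimes> x \<in> L}"
  have "\<exists>e\<in>carrier R - M. \<forall>x\<in>Q. e \<otimes> x \<in> L"
  proof (rule ccontr)
    assume "\<not> (\<exists>e\<in>carrier R - M. \<forall>x\<in>Q. e \<otimes> x \<in> L)"
    then have "\<forall>e\<in>carrier R - M. \<exists>x u. x \<in> carrier R \<and> u \<in> carrier R - M \<and> u \<otimes> x \<in> L \<and> e \<otimes> x \<notin> L"
      unfolding Q_def by blast
    then obtain X U where XU: "\<And>e. e \<in> carrier R - M \<Longrightarrow>
      X e \<in> carrier R \<and> U e \<in> carrier R - M \<and> U e \<otimes> X e \<in> L \<and> e \<otimes> X e \<notin> L" by metis
    \<comment> \<open>Here \<open>X (e n)\<close> is an element of \<open>Q\<close> that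
      \<open>e n\<close> fails to kill, and \<open>U (e n)\<close> does kill it. Multiplying by
      \<open>U (e n)\<close> makes all later \<open>e m\<close>, and with them all later
      \<open>g m\<close>, orthogonal to \<open>g n\<close>.\<close>
    define e where "e = rec_nat \<one> (\<lambda>n e. e \<otimes> U e)"
    have e_Suc: "e (Suc n) = e n \<otimes> U (e n)" for n by (simp add: e_def)
    have e: "e n \<in> carrier R - M" for n
    proof (induct n)
      case 0
      then show ?case using primeideal_one_notin[OF M(1)] by (simp add: e_def)
    next
      case (Suc n)
      then show ?case using XU[OF Suc] primeideal_mult_notin[OF M(1)] by (simp add: e_Suc)
    qed
    define g where "g n = e n \<otimes> X (e n)" for n
    have g: "g n \<in> carrier R" "g n \<notin> L" for n using XU[OF e] e by (auto simp: g_def)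
    have eg: "e (Suc n + k) \<otimes> g n \<in> L" for n k
    proof (induct k)
      case 0
      have "e (Suc n) \<otimes> g n = (e n \<otimes> e n) \<otimes> (U (e n) \<otimes> X (e n))"
        using XU[OF e[of n]] e[of n] by (simp add: e_Suc g_def m_ac)
      then show ?case using XU[OF e[of n]] e[of n] ideal.I_l_closed[OF L] by simp
    next
      case (Suc k)
      have "e (Suc n + Suc k) \<otimes> g n = U (e (Suc n + k)) \<otimes> (e (Suc n + k) \<otimes> g n)"
        using XU[OF e[of "Suc n + k"]] e[of "Suc n + k"] g[of n] by (simp add: e_Suc m_ac)
      then show ?case using XU[OF e[of "Suc n + k"]] Suc ideal.I_l_closed[OF L] by simp
    qed
    have lt: "g m \<otimes> g n \<in> L" if "n < m" for n m
    proof -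
      obtain k where k: "m = Suc n + k" using \<open>n < m\<close> less_iff_Suc_add by auto
      have "g m \<otimes> g n = X (e m) \<otimes> (e m \<otimes> g n)"
        using XU[OF e[of m]] e[of m] g[of n] by (simp add: g_def[of m] m_ac)
      then show ?thesis using eg[of n k] k XU[OF e[of m]] ideal.I_l_closed[OF L] by simp
    qed
    then have "g m \<otimes> g n \<in> L" if "m \<noteq> n" for m n
      using that g m_comm by (metis linorder_neqE_nat)
    then show False using no_infinite_orthogonal[OF L radical] g by metis
  qed
  then obtain e where e: "e \<in> carrier R" "e \<notin> M" "\<And>x. x \<in> Q \<Longrightarrow> e \<otimes> x \<in> L" by blast
  \<comment> \<open>Modulo \<open>L\<close>, \<open>J\<close> is the annihilator of \<open>e\<close>
    and \<open>I\<close> the annihilator of \<open>J\<close>. They intersect in \<open>L\<close>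
    because \<open>L\<close> is radical, so comparing them splits one into complementary
    idempotents.\<close>
  define J where "J = {y \<in> carrier R. e \<otimes> y \<in> L}"
  define I where "I = {x \<in> carrier R. \<forall>y\<in>J. x \<otimes> y \<in> L}"
  have J: "ideal J R"
  proof (rule ideal_cringI, goal_cases)
    case (4 a x)
    then show ?case using e ideal.I_l_closed[OF L, of "e \<otimes> x" a] by (auto simp: J_def m_lcomm)
  qed (use e L in \<open>auto simp: J_def r_distr ideal_zero_mem ideal_add_closed\<close>)
  have Jc: "J \<subseteq> carrier R" by (auto simp: J_def)
  have I: "ideal I R"
  proof (rule ideal_cringI, goal_cases)
    case (4 a x)
    then show ?case using Jc ideal.I_l_closed[OF L] by (auto simp: I_def m_assoc subset_iff)
  qed (use L Jc in \<open>auto simp: I_def l_distr ideal_zero_mem ideal_add_closed subset_iff\<close>)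
  obtain c d where cd: "c \<in> carrier R" "d \<in> carrier R" "c \<oplus> d = \<one>"
    "\<forall>x\<in>J. c \<otimes> x \<in> I" "\<forall>x\<in>I. d \<otimes> x \<in> J" using comparison[OF I J] by blast
  have cJ: "c \<otimes> x \<in> L" if "x \<in> J" for x
  proof -
    have "c \<otimes> x \<in> J" using that J cd by (simp add: ideal.I_l_closed)
    then have "(c \<otimes> x) \<otimes> (c \<otimes> x) \<in> L" using cd that by (auto simp: I_def)
    then show ?thesis using radical[of "c \<otimes> x"] cd that Jc by blast
  qed
  have "e \<in> I" using e by (auto simp: I_def J_def)
  then have "e \<otimes> (d \<otimes> e) \<in> L" using cd by (auto simp: J_def)
  then have "d \<otimes> (e \<otimes> (d \<otimes> e)) \<in> L" using cd L by (simp add: ideal.I_l_closed)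
  then have de: "d \<otimes> e \<in> L" using radical[of "d \<otimes> e"] cd e by (simp add: m_ac)
  then have "d \<in> J" using cd e by (simp add: J_def m_comm)
  then have "c \<otimes> d \<in> L" using cJ by blast
  moreover have "d \<in> M" using de M cd e primeideal.I_prime[OF M(1), of d e] by auto
  then have "c \<notin> M"
    using cd primeideal_one_notin[OF M(1)] ideal_add_closed[OF primeideal_ideal[OF M(1)], of c d] by auto
  moreover have "c \<otimes> x \<in> L" if "x \<in> carrier R" "u \<in> carrier R - M" "u \<otimes> x \<in> L" for x u
    using that e cJ[of x] by (auto simp: J_def Q_def)
  ultimately show ?thesis using cd by blast
qed

text \<open>Of two elements with sum one, at least one is outside \<open>P\<close>, so comparing the
  two principal ideals gives divisibility in one direction at \<open>P\<close>. This is the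
  valuation property of the localisation with denominators cleared.\<close>

lemma prime_divisibility:
  assumes P: "primeideal P R" and "x \<in> carrier R" "y \<in> carrier R"
  obtains s r where "s \<in> carrier R - P" "r \<in> carrier R" "s \<otimes> y = r \<otimes> x \<or> s \<otimes> x = r \<otimes> y"
proof -
  obtain c d where cd: "c \<in> carrier R" "d \<in> carrier R" "c \<oplus> d = \<one>"
    "\<forall>z\<in>PIdl y. c \<otimes> z \<in> PIdl x" "\<forall>z\<in>PIdl x. d \<otimes> z \<in> PIdl y"
    using comparison[OF cgenideal_ideal[OF assms(2)] cgenideal_ideal[OF assms(3)]] by blast
  have "c \<otimes> y \<in> PIdl x" "d \<otimes> x \<in> PIdl y"
    using cd(4,5) cgenideal_self[OF assms(2)] cgenideal_self[OF assms(3)] by blast+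
  moreover have "c \<notin> P \<or> d \<notin> P"
    using cd primeideal_one_notin[OF P] ideal_add_closed[OF primeideal_ideal[OF P], of c d] by auto
  ultimately show thesis using that cd unfolding mem_PIdl by blast
qed

end

section \<open>Annihilators near a maximal ideal\<close>

context cring
begin

lemma zeroat_minus:
  assumes P: "primeideal P R" and xy: "x \<in> carrier R" "y \<in> carrier R" "zeroat P x" "zeroat P y"
  shows "zeroat P (x \<ominus> y)"
proof -
  obtain s t where st: "s \<in> carrier R - P" "t \<in> carrier R - P" "s \<otimes> x = \<zero>" "t \<otimes> y = \<zero>"
    using xy by (auto simp: zeroat_def)
  have "s \<otimes> t \<otimes> (x \<ominus> y) = t \<otimes> (s \<otimes> x) \<ominus> s \<otimes> (t \<otimes> y)" using st(1,2)[THEN DiffD1] xy(1,2) by algebra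
  then have "s \<otimes> t \<otimes> (x \<ominus> y) = \<zero>" using st by (simp add: a_minus_def)
  then show ?thesis using primeideal_mult_notin[OF P st(1,2)] by (auto simp: zeroat_def)
qed

lemma primeideal_minus_notin:
  assumes P: "primeideal P R" and "x \<in> carrier R - P" "y \<in> P"
  shows "x \<ominus> y \<in> carrier R - P"
proof -
  have y: "y \<in> carrier R" using assms ideal.Icarr[OF primeideal_ideal[OF P]] by blast
  have "x = (x \<ominus> y) \<oplus> y" using assms(2)[THEN DiffD1] y by algebra
  then show ?thesis
    using assms y ideal_add_closed[OF primeideal_ideal[OF P], of "x \<ominus> y" y] by auto
qed

lemma one_sum_notin:
  assumes P: "primeideal P R" and "c \<oplus> d = \<one>" shows "c \<notin> P \<or> d \<notin> P"
proof (rule ccontr)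
  assume "\<not> (c \<notin> P \<or> d \<notin> P)"
  then have "c \<oplus> d \<in> P" using ideal_add_closed[OF primeideal_ideal[OF P], of c d] by blast
  then show False using assms(2) primeideal_one_notin[OF P] by simp
qed

text \<open>The contraction to \<open>R\<close> of the ideal generated by \<open>b\<close> in the
  localisation at \<open>P\<close>.\<close>

definition saturation :: "'a set \<Rightarrow> 'a \<Rightarrow> 'a set" where
  "saturation P b = {r \<in> carrier R. \<exists>s\<in>carrier R - P. s \<otimes> r \<in> PIdl b}"

lemma saturation_ideal:
  assumes P: "primeideal P R" and b: "b \<in> carrier R"
  shows "ideal (saturation P b) R"
proof (rule ideal_cringI)
  note K = cgenideal_ideal[OF b]
  show "\<zero> \<in> saturation P b"
    using ideal_zero_mem[OF K] primeideal_one_notin[OF P] by (force simp: saturation_def)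
  fix x assume x: "x \<in> saturation P b"
  then obtain s where s: "x \<in> carrier R" "s \<in> carrier R - P" "s \<otimes> x \<in> PIdl b"
    by (auto simp: saturation_def)
  {
    fix y assume "y \<in> saturation P b"
    then obtain t where t: "y \<in> carrier R" "t \<in> carrier R - P" "t \<otimes> y \<in> PIdl b"
      by (auto simp: saturation_def)
    have "s \<otimes> t \<otimes> (x \<oplus> y) = t \<otimes> (s \<otimes> x) \<oplus> s \<otimes> (t \<otimes> y)"
      using s(1) t(1) s(2)[THEN DiffD1] t(2)[THEN DiffD1] by algebra
    also have "\<dots> \<in> PIdl b"
      using s t ideal.I_l_closed[OF K, of "s \<otimes> x" t] ideal.I_l_closed[OF K, of "t \<otimes> y" s]
        ideal_add_closed[OF K] by blast
    finally show "x \<oplus> y \<in> saturation P b"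
      using s t primeideal_mult_notin[OF P s(2) t(2)] by (auto simp: saturation_def)
  next
    fix a assume a: "a \<in> carrier R"
    have "s \<otimes> (a \<otimes> x) \<in> PIdl b"
      using s a ideal.I_l_closed[OF K, of "s \<otimes> x" a] by (simp add: m_lcomm)
    then show "a \<otimes> x \<in> saturation P b" using s a by (auto simp: saturation_def)
  }
qed (auto simp: saturation_def)

end

section \<open>Primes inside two maximal ideals, and spreading of generators\<close>

context ideal_comparison
begin

text \<open>An element outside \<open>Q\<close> divides \<open>b\<close> at \<open>M\<close> and at
  \<open>N\<close>. Dividing by an element that is a unit at one of the two and not at the other
  gives a quotient \<open>b'\<close> that is a multiple of \<open>b\<close> on the unit side. The
  comparison of the two saturations carries this to the other side, and a Nakayama argument kills
  \<open>b\<close> there.\<close>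

lemma zeroat_one_of_two:
  assumes Q: "primeideal Q R" "Q \<subseteq> M" "Q \<subseteq> N" and M: "maximalideal M R" and N: "maximalideal N R"
    and "M \<noteq> N" and b: "b \<in> Q"
  shows "zeroat M b \<or> zeroat N b"
proof -
  note PM = primeideal_maximal[OF M] and PN = primeideal_maximal[OF N]
  have bc: "b \<in> carrier R" using b ideal.Icarr[OF primeideal_ideal[OF Q(1)]] by blast
  have div: "\<exists>s\<in>carrier R - P. \<exists>b'\<in>carrier R. s \<otimes> b = q \<otimes> b'"
    if P: "primeideal P R" "Q \<subseteq> P" and q: "q \<in> carrier R" "q \<notin> Q" for P q
  proof -
    obtain s r where sr: "s \<in> carrier R - P" "r \<in> carrier R" "s \<otimes> b = r \<otimes> q \<or> s \<otimes> q = r \<otimes> b"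
      using prime_divisibility[OF P(1) q(1) bc] by metis
    have "s \<otimes> q \<noteq> r \<otimes> b"
    proof
      assume "s \<otimes> q = r \<otimes> b"
      then have "s \<otimes> q \<in> Q" using sr b ideal.I_l_closed[OF primeideal_ideal[OF Q(1)]] by simp
      then show False using sr q P(2) primeideal.I_prime[OF Q(1), of s q] by auto
    qed
    then show ?thesis using sr q by (metis m_comm)
  qed
  obtain c d where cd: "c \<in> carrier R" "d \<in> carrier R" "c \<oplus> d = \<one>"
    "\<And>x. x \<in> saturation M b \<Longrightarrow> c \<otimes> x \<in> saturation N b"
    "\<And>x. x \<in> saturation N b \<Longrightarrow> d \<otimes> x \<in> saturation M b"
    using comparison[OF saturation_ideal[OF PN bc] saturation_ideal[OF PM bc]] by blast
  consider "d \<notin> M" | "c \<notin> M" using one_sum_notin[OF PM cd(3)] by blast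
  then show ?thesis
  proof cases
    case 1
    \<comment> \<open>At \<open>M\<close> the element \<open>b\<close> equals \<open>p\<close> times
      \<open>b'\<close> up to a unit, and after multiplication by the unit \<open>d\<close> also
      \<open>b'\<close> is a multiple of \<open>b\<close>. So \<open>b\<close> is a multiple of
      \<open>p \<otimes> b\<close> with \<open>p\<close> in \<open>M\<close>.\<close>
    obtain p where p: "p \<in> M" "p \<notin> N" using maximalideal_not_subset[OF M N \<open>M \<noteq> N\<close>] .
    have pc: "p \<in> carrier R" using p ideal.Icarr[OF primeideal_ideal[OF PM]] by blast
    obtain s b' where sb: "s \<in> carrier R - M" "b' \<in> carrier R" "s \<otimes> b = p \<otimes> b'"
      using div[OF PM Q(2) pc] p Q(3) by blast
    have "p \<otimes> b' \<in> PIdl b" using sb PIdl_mult_mem[OF bc, of s] by auto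
    then have "b' \<in> saturation N b" using p pc sb by (auto simp: saturation_def)
    then have "d \<otimes> b' \<in> saturation M b" by (rule cd(5))
    then obtain s' t where st: "s' \<in> carrier R - M" "t \<in> carrier R" "s' \<otimes> (d \<otimes> b') = t \<otimes> b"
      by (auto simp: saturation_def mem_PIdl)
    define w where "w = s' \<otimes> d"
    have w: "w \<in> carrier R - M" using primeideal_mult_notin[OF PM] st 1 cd by (auto simp: w_def)
    have wb: "w \<otimes> b' = t \<otimes> b" using st sb cd by (simp add: w_def m_assoc)
    have "(w \<otimes> s \<ominus> p \<otimes> t) \<otimes> b = w \<otimes> (s \<otimes> b) \<ominus> p \<otimes> (t \<otimes> b)"
      using w[THEN DiffD1] st(2) sb(1)[THEN DiffD1] pc bc by algebra
    also have "\<dots> = w \<otimes> (p \<otimes> b') \<ominus> p \<otimes> (w \<otimes> b')" by (simp add: sb wb)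
    also have "\<dots> = \<zero>" using w[THEN DiffD1] pc sb(2) by algebra
    finally have "(w \<otimes> s \<ominus> p \<otimes> t) \<otimes> b = \<zero>" .
    moreover have "w \<otimes> s \<ominus> p \<otimes> t \<in> carrier R - M"
      using p st by (intro primeideal_minus_notin[OF PM] primeideal_mult_notin[OF PM w sb(1)]
          ideal.I_r_closed[OF primeideal_ideal[OF PM]]) auto
    ultimately show ?thesis by (auto simp: zeroat_def)
  next
    case 2
    obtain m where m: "m \<in> N" "m \<notin> M" using maximalideal_not_subset[OF N M] \<open>M \<noteq> N\<close> by metis
    have mc: "m \<in> carrier R" using m ideal.Icarr[OF primeideal_ideal[OF PN]] by blast
    \<comment> \<open>Possibly \<open>c\<close> lies in \<open>N\<close>, so that only
      \<open>c \<otimes> b'\<close> is known to be a multiple of \<open>b\<close> at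
      \<open>N\<close>. Dividing \<open>b\<close> by the square of \<open>q\<close> leaves a spare
      factor \<open>q\<close>, which contains this \<open>c\<close>.\<close>
    define q where "q = c \<otimes> m"
    have q: "q \<in> carrier R - M" using primeideal_mult_notin[OF PM] 2 m mc cd by (auto simp: q_def)
    have qN: "q \<in> N" using m cd ideal.I_l_closed[OF primeideal_ideal[OF PN]] by (simp add: q_def)
    have qq: "q \<otimes> q \<in> carrier R - M" using primeideal_mult_notin[OF PM q q] .
    obtain s b' where sb: "s \<in> carrier R - N" "b' \<in> carrier R" "s \<otimes> b = q \<otimes> q \<otimes> b'"
      using div[OF PN Q(3), of "q \<otimes> q"] qq Q(2) by blast
    have "q \<otimes> q \<otimes> b' \<in> PIdl b" using sb PIdl_mult_mem[OF bc, of s] by auto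
    then have "b' \<in> saturation M b" using qq sb by (auto simp: saturation_def)
    then have "c \<otimes> b' \<in> saturation N b" by (rule cd(4))
    then obtain u t where ut: "u \<in> carrier R - N" "t \<in> carrier R" "u \<otimes> (c \<otimes> b') = t \<otimes> b"
      by (auto simp: saturation_def mem_PIdl)
    define v where "v = s \<otimes> u \<ominus> m \<otimes> t \<otimes> q"
    have v: "v \<in> carrier R - N"
      unfolding v_def using qN ut mc
      by (intro primeideal_minus_notin[OF PN] primeideal_mult_notin[OF PN sb(1) ut(1)]
          ideal.I_l_closed[OF primeideal_ideal[OF PN]]) auto
    have "v \<otimes> (q \<otimes> b') = s \<otimes> m \<otimes> (u \<otimes> (c \<otimes> b')) \<ominus> m \<otimes> t \<otimes> (q \<otimes> q \<otimes> b')"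
      unfolding v_def q_def using ut(1)[THEN DiffD1] ut(2) sb(1)[THEN DiffD1] sb(2) mc cd(1) by algebra
    also have "\<dots> = s \<otimes> m \<otimes> (t \<otimes> b) \<ominus> m \<otimes> t \<otimes> (s \<otimes> b)" by (simp only: ut sb)
    also have "\<dots> = \<zero>" using sb(1)[THEN DiffD1] mc ut(2) bc by algebra
    finally have vq: "v \<otimes> (q \<otimes> b') = \<zero>" .
    have "v \<otimes> (s \<otimes> b) = q \<otimes> (v \<otimes> (q \<otimes> b'))" unfolding sb(3) using v[THEN DiffD1] q[THEN DiffD1] sb(2) by algebra
    then have "v \<otimes> s \<otimes> b = \<zero>" using vq q v sb bc by (simp add: m_assoc)
    then show ?thesis using primeideal_mult_notin[OF PN v sb(1)] by (auto simp: zeroat_def)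
  qed
qed

text \<open>The elements of \<open>Q\<close> vanishing at \<open>M\<close> and those vanishing at
  \<open>N\<close> are closed under differences, and a group is not the union of two proper
  subgroups: if \<open>x\<close> fails at \<open>M\<close> and \<open>y\<close> at \<open>N\<close>,
  then \<open>x \<oplus> y\<close> fails at both.\<close>

lemma zeroat_prime_of_two:
  assumes Q: "primeideal Q R" "Q \<subseteq> M" "Q \<subseteq> N" and M: "maximalideal M R" and N: "maximalideal N R"
    and "M \<noteq> N"
  shows "(\<forall>b\<in>Q. zeroat M b) \<or> (\<forall>b\<in>Q. zeroat N b)"
proof (rule ccontr)
  assume "\<not> ?thesis"
  then obtain x y where xy: "x \<in> Q" "y \<in> Q" "\<not> zeroat M x" "\<not> zeroat N y" by blast
  note two = zeroat_one_of_two[OF assms]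
  note PM = primeideal_maximal[OF M] and PN = primeideal_maximal[OF N]
  have c: "x \<in> carrier R" "y \<in> carrier R"
    using xy ideal.Icarr[OF primeideal_ideal[OF Q(1)]] by blast+
  have z: "zeroat N x" "zeroat M y" using two xy by blast+
  have e: "x = (x \<oplus> y) \<ominus> y" "y = (x \<oplus> y) \<ominus> x" using c by algebra+
  have "x \<oplus> y \<in> Q" using xy ideal_add_closed[OF primeideal_ideal[OF Q(1)]] by blast
  then show False
    using two[of "x \<oplus> y"] zeroat_minus[OF PM, of "x \<oplus> y" y] zeroat_minus[OF PN, of "x \<oplus> y" x] c e xy z
    by auto
qed

text \<open>In the localisation at \<open>P\<close>, a valuation ring, \<open>(0 : a) = (b)\<close> with \<open>b\<close> nonzero
  forces \<open>(0 : b) = (a)\<close>.\<close>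
lemma annih_at_prime_swap:
  assumes P: "primeideal P R" and ab: "a \<in> carrier R" "b \<in> carrier R" "a \<otimes> b = \<zero>"
    and ann: "\<And>x. x \<in> annih a \<Longrightarrow> \<exists>t\<in>carrier R - P. t \<otimes> x \<in> PIdl b"
    and nz: "\<not> zeroat P b" and c: "c \<in> annih b"
  shows "\<exists>t\<in>carrier R - P. t \<otimes> c \<in> PIdl a"
proof -
  have cc: "c \<in> carrier R" "b \<otimes> c = \<zero>" using c by (auto simp: annih_def)
  obtain s d where sd: "s \<in> carrier R - P" "d \<in> carrier R" "s \<otimes> c = d \<otimes> a \<or> s \<otimes> a = d \<otimes> c"
    using prime_divisibility[OF P ab(1) cc(1)] by metis
  then consider "s \<otimes> c \<in> PIdl a" | "s \<otimes> a = d \<otimes> c" "d \<notin> P" | "s \<otimes> a = d \<otimes> c" "d \<in> P"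
    by (auto simp: mem_PIdl)
  then show ?thesis
  proof cases
    case 1
    then show ?thesis using sd by blast
  next
    case 2
    then have "d \<otimes> c \<in> PIdl a" using sd ab by (metis DiffD1 PIdl_mult_mem)
    then show ?thesis using 2 sd by blast
  next
    \<comment> \<open>Locally \<open>a\<close> is now a nonunit multiple \<open>d\<close> of
      \<open>c\<close>. If \<open>b\<close> divides \<open>d\<close>, then a unit at
      \<open>P\<close> kills \<open>a\<close>, so \<open>b\<close> is a unit there and may itself
      serve as the multiplier. If \<open>d\<close> divides \<open>b\<close> with quotient
      \<open>e\<close>, then \<open>e\<close> is in the annihilator of \<open>a\<close>, hence a
      multiple of \<open>b\<close>, and Nakayama makes \<open>b\<close> vanish at
      \<open>P\<close>.\<close>
    case 3
    obtain s' e where se: "s' \<in> carrier R - P" "e \<in> carrier R" "s' \<otimes> d = e \<otimes> b \<or> s' \<otimes> b = e \<otimes> d"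
      using prime_divisibility[OF P ab(2) sd(2)] by metis
    then consider "s' \<otimes> d = e \<otimes> b" | "s' \<otimes> b = e \<otimes> d" by blast
    then show ?thesis
    proof cases
      case 1
      have "a \<otimes> (s' \<otimes> s) = s' \<otimes> (s \<otimes> a)" using ab(1) sd(1)[THEN DiffD1] se(1)[THEN DiffD1] by algebra
      also have "\<dots> = (s' \<otimes> d) \<otimes> c" using 3 se sd cc by (simp add: m_assoc)
      also have "\<dots> = e \<otimes> (b \<otimes> c)" using 1 se ab cc by (simp add: m_assoc)
      finally have "a \<otimes> (s' \<otimes> s) = \<zero>" using cc se by simp
      then have "s' \<otimes> s \<in> annih a" using se sd by (auto simp: annih_def)
      then obtain t r where t: "t \<in> carrier R - P" "r \<in> carrier R" "t \<otimes> (s' \<otimes> s) = r \<otimes> b"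
        using ann[of "s' \<otimes> s"] unfolding mem_PIdl by blast
      have "t \<otimes> (s' \<otimes> s) \<in> carrier R - P"
        using t se sd by (intro primeideal_mult_notin[OF P]) auto
      then have "b \<notin> P" using t ideal.I_l_closed[OF primeideal_ideal[OF P], of b r] by auto
      moreover have "b \<otimes> c \<in> PIdl a"
        using cc ideal_zero_mem[OF cgenideal_ideal[OF ab(1)]] by simp
      ultimately show ?thesis using ab by blast
    next
      case 2
      have "a \<otimes> (e \<otimes> s) = e \<otimes> (s \<otimes> a)" using ab(1) sd(1)[THEN DiffD1] se(2) by algebra
      also have "\<dots> = (e \<otimes> d) \<otimes> c" using 3 se sd cc by (simp add: m_assoc)
      also have "\<dots> = s' \<otimes> (b \<otimes> c)" using 2[symmetric] se ab cc by (simp add: m_assoc)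
      finally have "a \<otimes> (e \<otimes> s) = \<zero>" using cc se by simp
      then have "e \<otimes> s \<in> annih a" using se sd by (auto simp: annih_def)
      then obtain t g where t: "t \<in> carrier R - P" "g \<in> carrier R" "t \<otimes> (e \<otimes> s) = g \<otimes> b"
        using ann[of "e \<otimes> s"] unfolding mem_PIdl by blast
      have "(t \<otimes> s \<otimes> s' \<ominus> d \<otimes> g) \<otimes> b = t \<otimes> s \<otimes> (s' \<otimes> b) \<ominus> d \<otimes> (g \<otimes> b)"
        using t(1)[THEN DiffD1] t(2) sd(1)[THEN DiffD1] sd(2) se(1)[THEN DiffD1] ab(2) by algebra
      also have "\<dots> = t \<otimes> s \<otimes> (e \<otimes> d) \<ominus> d \<otimes> (t \<otimes> (e \<otimes> s))" by (simp add: 2 t)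
      also have "\<dots> = \<zero>" using t(1)[THEN DiffD1] sd(1)[THEN DiffD1] sd(2) se(2) by algebra
      finally have "(t \<otimes> s \<otimes> s' \<ominus> d \<otimes> g) \<otimes> b = \<zero>" .
      moreover have "t \<otimes> s \<otimes> s' \<ominus> d \<otimes> g \<in> carrier R - P"
        using t sd se 3 by (intro primeideal_minus_notin[OF P] primeideal_mult_notin[OF P]
            ideal.I_r_closed[OF primeideal_ideal[OF P]]) auto
      ultimately have "zeroat P b" by (auto simp: zeroat_def)
      then show ?thesis using nz by simp
    qed
  qed
qed

text \<open>Primes inside \<open>M\<close> form a chain, and \<open>Q\<close> is the least of them
  containing \<open>k\<close>. The element \<open>c\<close>, idempotent modulo the radical of
  \<open>k\<close>, separates the maximal ideals above \<open>k\<close>: those without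
  \<open>c\<close> contain \<open>Q\<close>, and at the others \<open>d\<close> is a unit, so a
  power of \<open>c\<close> becomes a multiple of \<open>k\<close>.\<close>

lemma isolating_prime:
  assumes M: "maximalideal M R" and k: "k \<in> M"
  obtains e Q where "e \<in> carrier R - M" "primeideal Q R" "k \<in> Q" "Q \<subseteq> M"
    "\<And>N. maximalideal N R \<Longrightarrow> k \<in> N \<Longrightarrow> Q \<subseteq> N \<or> (\<exists>f\<in>carrier R - N. f \<otimes> e \<in> PIdl k)"
proof -
  note PM = primeideal_maximal[OF M]
  have kc: "k \<in> carrier R" using k ideal.Icarr[OF primeideal_ideal[OF PM]] by blast
  define L where "L = radic (PIdl k)"
  have L: "ideal L R" unfolding L_def by (intro radic_ideal cgenideal_ideal kc)
  have Lrad: "x \<in> L" if "x \<in> carrier R" "x \<otimes> x \<in> L" for x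
    using that radic_square[of x "PIdl k"] by (simp add: L_def)
  have Lsub: "L \<subseteq> P" if "primeideal P R" "k \<in> P" for P
    using that radic_subset_prime PIdl_subset[OF primeideal_ideal] by (simp add: L_def)
  obtain c d where cd: "c \<in> carrier R - M" "d \<in> carrier R" "c \<oplus> d = \<one>" "c \<otimes> d \<in> L"
    and cQ: "\<And>x u. \<lbrakk>x \<in> carrier R; u \<in> carrier R - M; u \<otimes> x \<in> L\<rbrakk> \<Longrightarrow> c \<otimes> x \<in> L"
    using radical_isolation[OF L Lrad PM Lsub[OF PM k]] by blast
  define Q where "Q = {x \<in> carrier R. c \<otimes> x \<in> L}"
  have Qsub: "Q \<subseteq> P" if "primeideal P R" "k \<in> P" "c \<notin> P" for P
    using that cd Lsub[of P] primeideal.I_prime[of P R c] by (auto simp: Q_def)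
  have "primeideal Q R"
  proof (rule primeidealI)
    show "ideal Q R"
    proof (rule ideal_cringI, goal_cases)
      case (4 a x)
      then show ?case using cd ideal.I_l_closed[OF L, of "c \<otimes> x" a] by (auto simp: Q_def m_lcomm)
    qed (use cd L in \<open>auto simp: Q_def r_distr ideal_zero_mem ideal_add_closed\<close>)
    show "carrier R \<noteq> Q" using Qsub[OF PM k] cd primeideal_one_notin[OF PM] by auto
    fix x y assume xy: "x \<in> carrier R" "y \<in> carrier R" "x \<otimes> y \<in> Q"
    \<comment> \<open>If \<open>u\<close> divides \<open>v\<close> at \<open>M\<close>, then
      \<open>u \<otimes> v\<close> divides the square of \<open>v\<close> there; radicality of
      \<open>L\<close> removes the square, and \<open>cQ\<close> removes the multiplier
      \<open>s\<close>.\<close>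
    have *: "v \<in> Q" if v: "u \<in> carrier R" "v \<in> carrier R" "u \<otimes> v \<in> Q"
      "s \<in> carrier R - M" "r \<in> carrier R" "s \<otimes> v = r \<otimes> u" for u v s r
    proof -
      have "(s \<otimes> c \<otimes> v) \<otimes> (s \<otimes> c \<otimes> v) = s \<otimes> c \<otimes> c \<otimes> v \<otimes> (s \<otimes> v)"
        using v(2) v(4)[THEN DiffD1] cd(1)[THEN DiffD1] by algebra
      also have "\<dots> = s \<otimes> c \<otimes> c \<otimes> v \<otimes> (r \<otimes> u)" by (simp only: v(6))
      also have "\<dots> = s \<otimes> c \<otimes> r \<otimes> (c \<otimes> (u \<otimes> v))"
        using v(1,2,5) v(4)[THEN DiffD1] cd(1)[THEN DiffD1] by algebra
      also have "\<dots> \<in> L"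
        using v cd ideal.I_l_closed[OF L, of "c \<otimes> (u \<otimes> v)" "s \<otimes> c \<otimes> r"] by (auto simp: Q_def)
      finally have "s \<otimes> c \<otimes> v \<in> L" using Lrad[of "s \<otimes> c \<otimes> v"] v cd by blast
      then show ?thesis using cQ[of v "s \<otimes> c"] primeideal_mult_notin[OF PM] v cd by (auto simp: Q_def)
    qed
    obtain s r where "s \<in> carrier R - M" "r \<in> carrier R" "s \<otimes> y = r \<otimes> x \<or> s \<otimes> x = r \<otimes> y"
      using prime_divisibility[OF PM xy(1,2)] by metis
    then show "x \<in> Q \<or> y \<in> Q" using *[of x y s r] *[of y x s r] xy by (auto simp: m_comm)
  qed (rule is_cring)
  moreover obtain n :: nat where n: "(c \<otimes> d) [^] n \<in> PIdl k" using cd by (auto simp: L_def radic_def)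
  have "Q \<subseteq> N \<or> (\<exists>f\<in>carrier R - N. f \<otimes> c [^] n \<in> PIdl k)" if N: "maximalideal N R" "k \<in> N" for N
  proof (cases "c \<in> N")
    case True
    note PN = primeideal_maximal[OF N(1)]
    have "d \<notin> N" using one_sum_notin[OF PN cd(3)] True by blast
    then have "d [^] n \<in> carrier R - N" using primeideal_pow_notin[OF PN] cd by auto
    moreover have "d [^] n \<otimes> c [^] n \<in> PIdl k" using n cd by (simp add: nat_pow_distrib m_comm)
    ultimately show ?thesis by blast
  next
    case False
    then show ?thesis using Qsub[OF primeideal_maximal[OF N(1)] N(2)] by blast
  qed
  moreover have "k \<in> L" using radic_subset[OF cgenideal_ideal[OF kc]] cgenideal_self[OF kc] by (auto simp: L_def)
  then have "k \<in> Q" using kc cd ideal.I_l_closed[OF L] by (simp add: Q_def)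
  moreover have "c [^] n \<in> carrier R - M" using primeideal_pow_notin[OF PM] cd by blast
  ultimately show thesis using that Qsub[OF PM k] cd by blast
qed

text \<open>The multiplier \<open>e\<close> does not depend on \<open>x\<close>; this distinguishes
  generation on a neighbourhood of \<open>M\<close> from generation at the point
  \<open>M\<close>.\<close>

definition annih_principal_near :: "'a set \<Rightarrow> 'a \<Rightarrow> 'a \<Rightarrow> bool" where
  "annih_principal_near M a b \<longleftrightarrow> b \<in> annih a \<and> (\<exists>e\<in>carrier R - M. \<forall>x\<in>annih a. e \<otimes> x \<in> PIdl b)"

text \<open>Pointwise generation of \<open>(0 : a)\<close> at \<open>M\<close> spreads out to a neighbourhood of \<open>M\<close>, because
  \<open>M\<close> is the only maximal ideal nearby at which the isolating prime does not vanish.\<close>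
lemma annih_principal_spread:
  assumes M: "maximalideal M R" and a: "a \<in> carrier R" and b: "b \<in> annih a"
    and ann: "\<And>x. x \<in> annih a \<Longrightarrow> \<exists>t\<in>carrier R - M. t \<otimes> x \<in> PIdl b"
  shows "\<exists>b'. annih_principal_near M a b'"
proof -
  note PM = primeideal_maximal[OF M]
  have bc: "b \<in> carrier R" "a \<otimes> b = \<zero>" using b by (auto simp: annih_def)
  have annc: "x \<in> carrier R" "a \<otimes> x = \<zero>" if "x \<in> annih a" for x using that by (auto simp: annih_def)
  have I0: "\<zero> \<in> PIdl y" if "y \<in> carrier R" for y
    using that ideal_zero_mem[OF cgenideal_ideal] by simp
  consider "zeroat M a" | "a \<notin> M" | "\<not> zeroat M a" "a \<in> M" "zeroat M b" | "\<not> zeroat M a" "\<not> zeroat M b"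
    by blast
  then show ?thesis
  proof cases
    \<comment> \<open>An element outside \<open>M\<close> that kills \<open>a\<close> belongs to the
      annihilator and is a unit at \<open>M\<close>, so it serves both as generator and as
      multiplier.\<close>
    case 1
    then obtain s where s: "s \<in> carrier R - M" "s \<otimes> a = \<zero>" by (auto simp: zeroat_def)
    then have "s \<in> annih a" using a by (auto simp: annih_def m_comm)
    moreover have "s \<otimes> x \<in> PIdl s" if "x \<in> annih a" for x
      using s annc[OF that] PIdl_mult_mem[of s x] by (simp add: m_comm)
    ultimately show ?thesis using s by (auto simp: annih_principal_near_def)
  next
    case 2
    then show ?thesis using a I0[of \<zero>]
      by (auto simp: annih_principal_near_def annih_def intro!: exI[of _ \<zero>] bexI[of _ a])
  next
    \<comment> \<open>The annihilator vanishes at \<open>M\<close>, so zero is the intended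
      generator. The multiplier isolating \<open>a\<close> kills the whole annihilator, as is
      checked at each maximal ideal.\<close>
    case 3
    obtain e Q where eQ: "e \<in> carrier R - M" "primeideal Q R" "a \<in> Q" "Q \<subseteq> M"
      and iso: "\<And>N. maximalideal N R \<Longrightarrow> a \<in> N \<Longrightarrow> Q \<subseteq> N \<or> (\<exists>f\<in>carrier R - N. f \<otimes> e \<in> PIdl a)"
      using isolating_prime[OF M \<open>a \<in> M\<close>] by blast
    obtain sb where sb: "sb \<in> carrier R - M" "sb \<otimes> b = \<zero>" using 3 by (auto simp: zeroat_def)
    have zM: "zeroat M x" if x: "x \<in> annih a" for x
    proof -
      obtain t r where t: "t \<in> carrier R - M" "r \<in> carrier R" "t \<otimes> x = r \<otimes> b"
        using ann[OF x] by (auto simp: mem_PIdl)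
      have "sb \<otimes> t \<otimes> x = sb \<otimes> (t \<otimes> x)" using t sb annc[OF x] by (simp add: m_assoc)
      also have "\<dots> = r \<otimes> (sb \<otimes> b)" unfolding t(3) using t(2) sb(1)[THEN DiffD1] bc(1) by algebra
      finally show ?thesis using primeideal_mult_notin[OF PM sb(1) t(1)] sb t by (auto simp: zeroat_def)
    qed
    have "e \<otimes> x = \<zero>" if x: "x \<in> annih a" for x
    proof -
      note xc = annc[OF x]
      have ex: "e \<otimes> x \<in> carrier R" using eQ xc by auto
      have "\<one> \<in> annih (e \<otimes> x)"
      proof (rule ideal_eq_carrier_local[OF annih_ideal[OF ex]])
        fix N assume N: "maximalideal N R"
        note PN = primeideal_maximal[OF N]
        consider "N = M" | "a \<notin> N" | f where "f \<in> carrier R - N" "f \<otimes> e \<in> PIdl a" | "N \<noteq> M" "Q \<subseteq> N"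
          using iso[OF N] by blast
        then show "\<exists>s\<in>carrier R - N. s \<in> annih (e \<otimes> x)"
        proof cases
          case 1
          obtain s where s: "s \<in> carrier R - M" "s \<otimes> x = \<zero>" using zM[OF x] by (auto simp: zeroat_def)
          have "e \<otimes> x \<otimes> s = e \<otimes> (s \<otimes> x)" using s(1)[THEN DiffD1] eQ(1)[THEN DiffD1] xc(1) by algebra
          then show ?thesis using 1 s eQ by (auto simp: annih_def)
        next
          case 2
          have "e \<otimes> x \<otimes> a = e \<otimes> (a \<otimes> x)" using a eQ(1)[THEN DiffD1] xc(1) by algebra
          then show ?thesis using 2 xc a eQ by (auto simp: annih_def)
        next
          case (3 f)
          then obtain r where r: "r \<in> carrier R" "f \<otimes> e = r \<otimes> a" by (auto simp: mem_PIdl)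
          have "e \<otimes> x \<otimes> f = (f \<otimes> e) \<otimes> x" using 3(1)[THEN DiffD1] eQ(1)[THEN DiffD1] xc(1) by algebra
          also have "\<dots> = r \<otimes> (a \<otimes> x)" using r a xc by (simp add: m_assoc)
          finally show ?thesis using 3 r xc by (auto simp: annih_def)
        next
          \<comment> \<open>As \<open>a\<close> does not vanish at \<open>M\<close>, all of
            \<open>Q\<close> vanishes at \<open>N\<close>. So some \<open>u\<close> outside
            \<open>N\<close> kills \<open>a\<close>; like the whole annihilator it vanishes at
            \<open>M\<close>, and a product of elements outside the prime \<open>Q\<close> is
            zero.\<close>
          case 4
          have "zeroat N a" using zeroat_prime_of_two[OF eQ(2,4) 4(2) M N] 4(1) eQ(3) 3(1) by auto
          then obtain u where u: "u \<in> carrier R - N" "u \<otimes> a = \<zero>" by (auto simp: zeroat_def)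
          then have "u \<in> annih a" using a by (auto simp: annih_def m_comm)
          then obtain v where v: "v \<in> carrier R - M" "v \<otimes> u = \<zero>" using zM by (auto simp: zeroat_def)
          have "v \<otimes> u \<in> Q" using v ideal_zero_mem[OF primeideal_ideal[OF eQ(2)]] by simp
          then have False using v u eQ 4 primeideal.I_prime[OF eQ(2), of v u] by auto
          then show ?thesis ..
        qed
      qed
      then show ?thesis using ex by (simp add: annih_def)
    qed
    then show ?thesis using eQ I0[of \<zero>] a
      by (auto simp: annih_principal_near_def annih_def intro!: exI[of _ \<zero>] bexI[of _ e])
  next
    \<comment> \<open>The isolated element is now \<open>b\<close>; it is in \<open>M\<close>, since
      a \<open>b\<close> outside \<open>M\<close> would kill \<open>a\<close> at
      \<open>M\<close>.\<close>
    case 4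
    have "b \<in> M"
      using 4 bc a m_comm[of a b] by (auto simp: zeroat_def)
    then obtain e Q where eQ: "e \<in> carrier R - M" "primeideal Q R" "b \<in> Q" "Q \<subseteq> M"
      and iso: "\<And>N. maximalideal N R \<Longrightarrow> b \<in> N \<Longrightarrow> Q \<subseteq> N \<or> (\<exists>f\<in>carrier R - N. f \<otimes> e \<in> PIdl b)"
      using isolating_prime[OF M] by blast
    have "e \<otimes> x \<in> PIdl b" if x: "x \<in> annih a" for x
    proof -
      note xc = annc[OF x]
      note K = cgenideal_ideal[OF bc(1)]
      have ex: "e \<otimes> x \<in> carrier R" using eQ xc by auto
      define J where "J = {y \<in> carrier R. y \<otimes> (e \<otimes> x) \<in> PIdl b}"
      have "ideal J R"
      proof (rule ideal_cringI, goal_cases)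
        case (4 c y)
        then show ?case using ex ideal.I_l_closed[OF K, of "y \<otimes> (e \<otimes> x)" c] by (simp add: J_def m_assoc)
      qed (use ex K in \<open>auto simp: J_def l_distr ideal_zero_mem ideal_add_closed\<close>)
      then have "\<one> \<in> J"
      proof (rule ideal_eq_carrier_local)
        fix N assume N: "maximalideal N R"
        note PN = primeideal_maximal[OF N]
        consider "N = M" | "b \<notin> N" | f where "f \<in> carrier R - N" "f \<otimes> e \<in> PIdl b" | "N \<noteq> M" "Q \<subseteq> N"
          using iso[OF N] by blast
        then show "\<exists>s\<in>carrier R - N. s \<in> J"
        proof cases
          case 1
          obtain t where t: "t \<in> carrier R - M" "t \<otimes> x \<in> PIdl b" using ann[OF x] by blast
          have "t \<otimes> (e \<otimes> x) = e \<otimes> (t \<otimes> x)" using t(1)[THEN DiffD1] eQ(1)[THEN DiffD1] xc(1) by algebra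
          then have "t \<otimes> (e \<otimes> x) \<in> PIdl b" using eQ ideal.I_l_closed[OF K t(2), of e] by simp
          then show ?thesis using 1 t(1) unfolding J_def by blast
        next
          case 2
          then show ?thesis using ex bc PIdl_mult_mem[of b "e \<otimes> x"] by (auto simp: J_def m_comm)
        next
          case (3 f)
          have "f \<otimes> (e \<otimes> x) = (f \<otimes> e) \<otimes> x" using 3(1)[THEN DiffD1] eQ(1)[THEN DiffD1] xc(1) by algebra
          then have "f \<otimes> (e \<otimes> x) \<in> PIdl b" using xc ideal.I_r_closed[OF K 3(2), of x] by simp
          then show ?thesis using 3(1) unfolding J_def by blast
        next
          case N4: 4
          have zN: "zeroat N y" if "y \<in> Q" for y
            using zeroat_prime_of_two[OF eQ(2,4) N4(2) M N] N4(1) eQ(3) 4(2) that by auto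
          \<comment> \<open>Since \<open>b\<close> is nonzero at \<open>M\<close>, the prime
            \<open>Q\<close> vanishes at \<open>N\<close>. Once \<open>a\<close> is known to be
            outside \<open>Q\<close>, the equation \<open>a \<otimes> x = \<zero>\<close> puts every
            annihilating \<open>x\<close> into \<open>Q\<close>, so \<open>x\<close> vanishes at
            \<open>N\<close>.\<close>
          have "a \<notin> Q"
          proof
            assume "a \<in> Q"
            then obtain u where u: "u \<in> carrier R - N" "u \<otimes> a = \<zero>" using zN by (auto simp: zeroat_def)
            then have "u \<in> annih a" using a by (auto simp: annih_def m_comm)
            then obtain t where t: "t \<in> carrier R - M" "t \<otimes> u \<in> PIdl b" using ann by blast
            then have "t \<otimes> u \<in> Q" using PIdl_subset[OF primeideal_ideal[OF eQ(2)] eQ(3)] by blast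
            then show False using t u eQ N4 primeideal.I_prime[OF eQ(2), of t u] by auto
          qed
          moreover have "a \<otimes> x \<in> Q" using xc ideal_zero_mem[OF primeideal_ideal[OF eQ(2)]] by simp
          ultimately have "x \<in> Q" using a xc primeideal.I_prime[OF eQ(2), of a x] by auto
          then obtain y where y: "y \<in> carrier R - N" "y \<otimes> x = \<zero>" using zN by (auto simp: zeroat_def)
          have "y \<otimes> (e \<otimes> x) = e \<otimes> (y \<otimes> x)" using y(1)[THEN DiffD1] eQ(1)[THEN DiffD1] xc(1) by algebra
          then have "y \<otimes> (e \<otimes> x) \<in> PIdl b" using y eQ I0[OF bc(1)] by simp
          then show ?thesis using y(1) unfolding J_def by blast
        qed
      qed
      then show ?thesis using ex by (simp add: J_def)
    qed
    then show ?thesis using eQ b by (auto simp: annih_principal_near_def)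
  qed
qed

text \<open>The swap shows that \<open>a\<close> generates the annihilator of \<open>b\<close> at
  \<open>M\<close>, and spreading makes this uniform; if \<open>b\<close> vanishes at
  \<open>M\<close>, a unit there generates instead. This allows passing from the first of two
  consecutive maps to the second.\<close>

lemma annih_principal_near_generator:
  assumes M: "maximalideal M R" and a: "a \<in> carrier R" and ab: "annih_principal_near M a b"
  shows "\<exists>b'. annih_principal_near M b b'"
proof -
  note PM = primeideal_maximal[OF M]
  have b: "b \<in> annih a" and ann: "\<And>x. x \<in> annih a \<Longrightarrow> \<exists>t\<in>carrier R - M. t \<otimes> x \<in> PIdl b"
    using ab by (auto simp: annih_principal_near_def)
  have bc: "b \<in> carrier R" "a \<otimes> b = \<zero>" using b by (auto simp: annih_def)
  have a_ann: "a \<in> annih b" using a bc by (simp add: annih_def m_comm)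
  show ?thesis
  proof (cases "zeroat M b")
    case True
    then obtain s where s: "s \<in> carrier R - M" "s \<otimes> b = \<zero>" by (auto simp: zeroat_def)
    then have s': "s \<in> annih b" using bc by (auto simp: annih_def m_comm)
    have "s \<otimes> x \<in> PIdl s" if "x \<in> annih b" for x
      using that s PIdl_mult_mem[of s x] by (auto simp: annih_def m_comm)
    then show ?thesis using annih_principal_spread[OF M bc(1) s'] s by blast
  next
    case False
    show ?thesis
      by (rule annih_principal_spread[OF M bc(1) a_ann])
        (rule annih_at_prime_swap[OF PM a bc ann False])
  qed
qed

end

section \<open>Finitely generated free modules\<close>

lemma mod_homD:
  assumes "f \<in> mod_hom R M N"
  shows "x \<in> carrier M \<Longrightarrow> f x \<in> carrier N"
    and "\<lbrakk>x \<in> carrier M; y \<in> carrier M\<rbrakk> \<Longrightarrow> f (x \<oplus>\<^bsub>M\<^esub> y) = f x \<oplus>\<^bsub>N\<^esub> f y"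
    and "\<lbrakk>a \<in> carrier R; x \<in> carrier M\<rbrakk> \<Longrightarrow> f (a \<odot>\<^bsub>M\<^esub> x) = a \<odot>\<^bsub>N\<^esub> f x"
  using assms by (auto simp: mod_hom_def)

lemma mod_homI:
  assumes "\<And>x. x \<in> carrier M \<Longrightarrow> f x \<in> carrier N"
    and "\<And>x y. \<lbrakk>x \<in> carrier M; y \<in> carrier M\<rbrakk> \<Longrightarrow> f (x \<oplus>\<^bsub>M\<^esub> y) = f x \<oplus>\<^bsub>N\<^esub> f y"
    and "\<And>a x. \<lbrakk>a \<in> carrier R; x \<in> carrier M\<rbrakk> \<Longrightarrow> f (a \<odot>\<^bsub>M\<^esub> x) = a \<odot>\<^bsub>N\<^esub> f x"
  shows "f \<in> mod_hom R M N"
  using assms by (auto simp: mod_hom_def)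

lemma mod_hom_comp:
  "\<lbrakk>f \<in> mod_hom R L M; g \<in> mod_hom R M N\<rbrakk> \<Longrightarrow> (\<lambda>x. g (f x)) \<in> mod_hom R L N"
  by (auto simp: mod_hom_def)

inductive_set mspan :: "'a ring \<Rightarrow> ('a, 'b) module \<Rightarrow> 'b set \<Rightarrow> 'b set"
  for R :: "'a ring" and N :: "('a, 'b) module" and G :: "'b set"
  where
    zero: "\<zero>\<^bsub>N\<^esub> \<in> mspan R N G"
  | gen: "g \<in> G \<Longrightarrow> g \<in> mspan R N G"
  | add: "x \<in> mspan R N G \<Longrightarrow> y \<in> mspan R N G \<Longrightarrow> x \<oplus>\<^bsub>N\<^esub> y \<in> mspan R N G"
  | smult: "a \<in> carrier R \<Longrightarrow> x \<in> mspan R N G \<Longrightarrow> a \<odot>\<^bsub>N\<^esub> x \<in> mspan R N G"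

lemma mspan_mono: "G \<subseteq> H \<Longrightarrow> x \<in> mspan R N G \<Longrightarrow> x \<in> mspan R N H"
  by (rotate_tac, induct rule: mspan.induct) (blast intro: mspan.intros)+

lemma mspan_carrier:
  assumes "Module.module R N" "G \<subseteq> carrier N" "x \<in> mspan R N G" shows "x \<in> carrier N"
proof -
  interpret N: Module.module R N by fact
  show ?thesis using assms(3) by induct (use assms(2) in auto)
qed

lemma finsum_mspan:
  assumes N: "Module.module R N" and G: "G \<subseteq> carrier N"
    and "finite A" "\<And>i. i \<in> A \<Longrightarrow> f i \<in> mspan R N G"
  shows "finsum N f A \<in> mspan R N G"
proof -
  interpret N: Module.module R N by fact
  show ?thesis using assms(3,4)
  proof (induct A)
    case (insert a A)
    then have "f \<in> A \<rightarrow> carrier N" "f a \<in> carrier N" using mspan_carrier[OF N G] by auto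
    then show ?case using insert by (auto intro: mspan.add)
  qed (auto intro: mspan.zero)
qed

lemma mod_hom_zero:
  assumes "Module.module R M" "Module.module R N" "f \<in> mod_hom R M N" shows "f \<zero>\<^bsub>M\<^esub> = \<zero>\<^bsub>N\<^esub>"
proof -
  interpret M: Module.module R M by fact
  interpret N: Module.module R N by fact
  have "f (\<zero>\<^bsub>R\<^esub> \<odot>\<^bsub>M\<^esub> \<zero>\<^bsub>M\<^esub>) = \<zero>\<^bsub>R\<^esub> \<odot>\<^bsub>N\<^esub> f \<zero>\<^bsub>M\<^esub>"
    using mod_homD(3)[OF assms(3)] by blast
  then show ?thesis using mod_homD(1)[OF assms(3)] by simp
qed

lemma mod_hom_finsum:
  assumes "Module.module R M" "Module.module R N" "f \<in> mod_hom R M N" "finite A" "\<And>i. i \<in> A \<Longrightarrow> g i \<in> carrier M"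
  shows "f (finsum M g A) = finsum N (\<lambda>i. f (g i)) A"
  using assms(4,5)
proof (induct A)
  case empty
  interpret M: Module.module R M by fact
  interpret N: Module.module R N by fact
  show ?case using mod_hom_zero[OF assms(1-3)] by simp
next
  case (insert a A)
  interpret M: Module.module R M by fact
  interpret N: Module.module R N by fact
  have g: "g \<in> A \<rightarrow> carrier M" "g a \<in> carrier M" using insert by auto
  moreover have "(\<lambda>i. f (g i)) \<in> A \<rightarrow> carrier N" "f (g a) \<in> carrier N"
    using g mod_homD(1)[OF assms(3)] by auto
  ultimately show ?case using insert mod_homD(2)[OF assms(3)] M.finsum_closed by simp
qed

text \<open>\<^term>\<open>freemod\<close> takes a ring record without extension fields.\<close>
locale plain_cring = cring R for R :: "'a ring" (structure)
begin

abbreviation "V \<equiv> freemod R"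

lemma freemod_carrier:
  "v \<in> carrier (V k) \<longleftrightarrow> (\<forall>i. v i \<in> carrier R) \<and> (\<forall>i\<ge>k. v i = \<zero>)"
proof -
  have "v i \<in> carrier R" if "\<forall>i<k. v i \<in> carrier R" "\<forall>i\<ge>k. v i = \<zero>" for i
    using that by (cases "i < k") auto
  then show ?thesis by (auto simp: freemod_def)
qed

lemma freemod_simps [simp]:
  "\<zero>\<^bsub>V k\<^esub> = (\<lambda>i. \<zero>)" "u \<oplus>\<^bsub>V k\<^esub> v = (\<lambda>i. u i \<oplus> v i)" "a \<odot>\<^bsub>V k\<^esub> v = (\<lambda>i. a \<otimes> v i)"
  by (auto simp: freemod_def)

lemma freemod_coord [simp, intro]: "v \<in> carrier (V k) \<Longrightarrow> v i \<in> carrier R"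
  by (simp add: freemod_carrier)

lemma freemod_module: "Module.module R (V k)"
proof (rule moduleI)
  show "abelian_group (V k)"
  proof (rule abelian_groupI)
    fix x assume x: "x \<in> carrier (V k)"
    then show "\<exists>y\<in>carrier (V k). y \<oplus>\<^bsub>V k\<^esub> x = \<zero>\<^bsub>V k\<^esub>"
      by (intro bexI[of _ "\<lambda>i. \<ominus> x i"]) (auto simp: freemod_carrier l_neg)
  qed (auto simp: freemod_carrier a_ac)
qed (auto simp: freemod_carrier is_cring l_distr r_distr m_assoc)

lemma freemod_finsum:
  assumes "finite A" "\<And>j. j \<in> A \<Longrightarrow> f j \<in> carrier (V k)"
  shows "finsum (V k) f A = (\<lambda>i. finsum R (\<lambda>j. f j i) A)"
  using assms
proof (induct A)
  case empty
  interpret W: Module.module R "V k" by (rule freemod_module)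
  show ?case by (simp add: W.finsum_empty[unfolded freemod_simps])
next
  case (insert a A)
  interpret W: Module.module R "V k" by (rule freemod_module)
  have "f \<in> A \<rightarrow> carrier (V k)" "f a \<in> carrier (V k)"
    and "\<And>i. (\<lambda>j. f j i) \<in> A \<rightarrow> carrier R" "\<And>i. f a i \<in> carrier R" using insert by auto
  then show ?case using insert by (simp add: W.finsum_insert[unfolded freemod_simps])
qed

section \<open>Homomorphisms from free modules in coordinates\<close>

definition unit_vec :: "nat \<Rightarrow> nat \<Rightarrow> 'a" where
  "unit_vec j = (\<lambda>i. if i = j then \<one> else \<zero>)"

lemma unit_vec_carrier [simp]: "j < k \<Longrightarrow> unit_vec j \<in> carrier (V k)"
  by (auto simp: unit_vec_def freemod_carrier)

lemma freemod_expand: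
  assumes v: "v \<in> carrier (V k)"
  shows "v = finsum (V k) (\<lambda>j. v j \<odot>\<^bsub>V k\<^esub> unit_vec j) {..<k}"
proof
  fix i
  have "finsum (V k) (\<lambda>j. v j \<odot>\<^bsub>V k\<^esub> unit_vec j) {..<k} i = finsum R (\<lambda>j. v j \<otimes> unit_vec j i) {..<k}"
    by (subst freemod_finsum) (use v in \<open>auto simp: freemod_carrier unit_vec_def\<close>)
  also have "\<dots> = finsum R (\<lambda>j. if i = j then v j else \<zero>) {..<k}"
    using v by (intro finsum_cong') (auto simp: unit_vec_def)
  also have "\<dots> = v i"
  proof (cases "i < k")
    case True
    then show ?thesis using v finsum_singleton[of i "{..<k}" v] by (simp add: Pi_def)
  next
    case False
    then have "finsum R (\<lambda>j. if i = j then v j else \<zero>) {..<k} = finsum R (\<lambda>j. \<zero>) {..<k}"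
      by (intro finsum_cong') auto
    then show ?thesis using v False by (simp add: freemod_carrier)
  qed
  finally show "v i = finsum (V k) (\<lambda>j. v j \<odot>\<^bsub>V k\<^esub> unit_vec j) {..<k} i" by simp
qed

definition lincomb :: "('a, 'b) module \<Rightarrow> nat \<Rightarrow> (nat \<Rightarrow> 'b) \<Rightarrow> (nat \<Rightarrow> 'a) \<Rightarrow> 'b" where
  "lincomb N k g v = finsum N (\<lambda>j. v j \<odot>\<^bsub>N\<^esub> g j) {..<k}"

lemma lincomb_hom:
  assumes N: "Module.module R N" and g: "\<And>j. j < k \<Longrightarrow> g j \<in> carrier N"
  shows "lincomb N k g \<in> mod_hom R (V k) N"
proof -
  interpret N: Module.module R N by fact
  show ?thesis
  proof (rule mod_homI)
    fix x y a assume x: "x \<in> carrier (V k)"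
    have Px: "(\<lambda>j. x j \<odot>\<^bsub>N\<^esub> g j) \<in> {..<k} \<rightarrow> carrier N" using x g by auto
    then show "lincomb N k g x \<in> carrier N" by (simp add: lincomb_def)
    show "lincomb N k g (x \<oplus>\<^bsub>V k\<^esub> y) = lincomb N k g x \<oplus>\<^bsub>N\<^esub> lincomb N k g y"
      if y: "y \<in> carrier (V k)"
    proof -
      have "(\<lambda>j. y j \<odot>\<^bsub>N\<^esub> g j) \<in> {..<k} \<rightarrow> carrier N" using y g by auto
      then have "lincomb N k g x \<oplus>\<^bsub>N\<^esub> lincomb N k g y
          = finsum N (\<lambda>j. x j \<odot>\<^bsub>N\<^esub> g j \<oplus>\<^bsub>N\<^esub> y j \<odot>\<^bsub>N\<^esub> g j) {..<k}"
        using Px by (simp add: lincomb_def N.finsum_addf)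
      also have "\<dots> = lincomb N k g (x \<oplus>\<^bsub>V k\<^esub> y)"
        unfolding lincomb_def using x y g by (intro N.finsum_cong') (auto simp: N.smult_l_distr)
      finally show ?thesis by simp
    qed
    show "lincomb N k g (a \<odot>\<^bsub>V k\<^esub> x) = a \<odot>\<^bsub>N\<^esub> lincomb N k g x" if a: "a \<in> carrier R"
    proof -
      have "a \<odot>\<^bsub>N\<^esub> lincomb N k g x = finsum N (\<lambda>j. a \<odot>\<^bsub>N\<^esub> (x j \<odot>\<^bsub>N\<^esub> g j)) {..<k}"
        using a Px by (simp add: lincomb_def N.finsum_smult_ldistr)
      also have "\<dots> = lincomb N k g (a \<odot>\<^bsub>V k\<^esub> x)"
        unfolding lincomb_def using x a g by (intro N.finsum_cong') (auto simp: N.smult_assoc1)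
      finally show ?thesis by simp
    qed
  qed
qed

lemma lincomb_unit_vec:
  assumes N: "Module.module R N" and g: "\<And>j. j < k \<Longrightarrow> g j \<in> carrier N" and j: "j < k"
  shows "lincomb N k g (unit_vec j) = g j"
proof -
  interpret N: Module.module R N by fact
  have "lincomb N k g (unit_vec j) = finsum N (\<lambda>i. if j = i then g i else \<zero>\<^bsub>N\<^esub>) {..<k}"
    unfolding lincomb_def using g by (intro N.finsum_cong') (auto simp: unit_vec_def)
  also have "\<dots> = g j" using N.finsum_singleton[of j "{..<k}" g] g j by (simp add: Pi_def)
  finally show ?thesis .
qed

lemma hom_lincomb:
  assumes N: "Module.module R N" and h: "h \<in> mod_hom R (V k) N" and v: "v \<in> carrier (V k)"
  shows "h v = lincomb N k (\<lambda>j. h (unit_vec j)) v"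
proof -
  interpret W: Module.module R "V k" by (rule freemod_module)
  interpret N: Module.module R N by fact
  have "h v = h (finsum (V k) (\<lambda>j. v j \<odot>\<^bsub>V k\<^esub> unit_vec j) {..<k})"
    using freemod_expand[OF v] by simp
  also have "\<dots> = finsum N (\<lambda>j. h (v j \<odot>\<^bsub>V k\<^esub> unit_vec j)) {..<k}"
    using v by (intro mod_hom_finsum[OF freemod_module N h]) (auto simp del: freemod_simps)
  also have "\<dots> = lincomb N k (\<lambda>j. h (unit_vec j)) v"
    unfolding lincomb_def using v mod_homD[OF h]
    by (intro N.finsum_cong') (auto simp del: freemod_simps)
  finally show ?thesis .
qed

lemma hom_eqI:
  assumes N: "Module.module R N" and h: "h \<in> mod_hom R (V k) N" "h' \<in> mod_hom R (V k) N"
    and eq: "\<And>j. j < k \<Longrightarrow> h (unit_vec j) = h' (unit_vec j)" and v: "v \<in> carrier (V k)"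
  shows "h v = h' v"
proof -
  interpret N: Module.module R N by fact
  show ?thesis
    unfolding hom_lincomb[OF N h(1) v] hom_lincomb[OF N h(2) v] lincomb_def
    using eq v mod_homD(1)[OF h(2)] by (intro N.finsum_cong') auto
qed

lemma hom_in_mspan:
  assumes N: "Module.module R N" and h: "h \<in> mod_hom R (V k) N" and v: "v \<in> carrier (V k)"
  shows "h v \<in> mspan R N ((\<lambda>j. h (unit_vec j)) ` {..<k})"
proof -
  interpret N: Module.module R N by fact
  show ?thesis
    unfolding hom_lincomb[OF N h v] lincomb_def
  proof (rule finsum_mspan[OF N])
    show "v j \<odot>\<^bsub>N\<^esub> h (unit_vec j) \<in> mspan R N ((\<lambda>j. h (unit_vec j)) ` {..<k})" if "j \<in> {..<k}" for j
      using that v by (intro mspan.smult mspan.gen) auto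
  qed (use mod_homD(1)[OF h] in auto)
qed

lemma hom_image_submodule:
  assumes N: "Module.module R N" and h: "h \<in> mod_hom R (V k) N" and "G \<subseteq> h ` carrier (V k)"
  shows "mspan R N G \<subseteq> h ` carrier (V k)"
proof
  interpret W: Module.module R "V k" by (rule freemod_module)
  fix x assume "x \<in> mspan R N G"
  then show "x \<in> h ` carrier (V k)"
  proof induct
    case zero
    then show ?case using mod_hom_zero[OF freemod_module N h] W.zero_closed by (metis image_eqI)
  next
    case (gen g)
    then show ?case using assms by auto
  next
    case (add x y)
    then obtain u v where uv: "u \<in> carrier (V k)" "v \<in> carrier (V k)" "x = h u" "y = h v" by auto
    then show ?case using mod_homD(2)[OF h uv(1,2)] W.add.m_closed[OF uv(1,2)] by (metis image_eqI)
  next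
    case (smult a x)
    then obtain u where u: "u \<in> carrier (V k)" "x = h u" by auto
    then show ?case using smult mod_homD(3)[OF h _ u(1), of a] W.smult_closed[of a u] by (metis image_eqI)
  qed
qed

lemma mspan_hom_image:
  assumes N: "Module.module R N" and "finite G" "G \<subseteq> carrier N"
  obtains q h where "h \<in> mod_hom R (V q) N" "h ` carrier (V q) = mspan R N G"
proof -
  obtain xs where xs: "set xs = G" using finite_list[OF assms(2)] by blast
  define q where "q = length xs"
  have g: "xs ! j \<in> carrier N" if "j < q" for j using that xs assms(3) by (auto simp: q_def)
  define h where "h = lincomb N q ((!) xs)"
  have h: "h \<in> mod_hom R (V q) N" unfolding h_def using g by (rule lincomb_hom[OF N])
  have unit: "h (unit_vec j) = xs ! j" if "j < q" for j
    unfolding h_def using lincomb_unit_vec[OF N g that] .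
  have im: "(\<lambda>j. h (unit_vec j)) ` {..<q} = G"
    using unit xs by (auto simp: q_def image_iff in_set_conv_nth)
  have "h ` carrier (V q) \<subseteq> mspan R N G"
    using hom_in_mspan[OF N h] im by auto
  moreover have "G \<subseteq> h ` carrier (V q)" using im by (force simp del: freemod_simps)
  then have "mspan R N G \<subseteq> h ` carrier (V q)" by (rule hom_image_submodule[OF N h])
  ultimately show thesis using that h by blast
qed

text \<open>The index set is arbitrary because the elimination removes pivot columns in an
  unpredictable order.\<close>

definition dot :: "nat set \<Rightarrow> (nat \<Rightarrow> 'a) \<Rightarrow> (nat \<Rightarrow> 'a) \<Rightarrow> 'a" where
  "dot C t x = finsum R (\<lambda>l. t l \<otimes> x l) C"

lemma dot_closed [simp, intro]:
  "\<lbrakk>\<And>l. l \<in> C \<Longrightarrow> t l \<in> carrier R; \<And>l. l \<in> C \<Longrightarrow> x l \<in> carrier R\<rbrakk> \<Longrightarrow> dot C t x \<in> carrier R"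
  unfolding dot_def by (rule finsum_closed) blast

lemma dot_cong:
  "\<lbrakk>\<And>l. l \<in> C \<Longrightarrow> t' l \<otimes> y l = t l \<otimes> x l; \<And>l. l \<in> C \<Longrightarrow> t l \<in> carrier R;
    \<And>l. l \<in> C \<Longrightarrow> x l \<in> carrier R\<rbrakk> \<Longrightarrow> dot C t' y = dot C t x"
  unfolding dot_def by (rule finsum_cong') (simp_all add: Pi_def)

lemma dot_add:
  assumes "\<And>l. l \<in> C \<Longrightarrow> t l \<in> carrier R" "\<And>l. l \<in> C \<Longrightarrow> x l \<in> carrier R" "\<And>l. l \<in> C \<Longrightarrow> y l \<in> carrier R"
  shows "dot C t (\<lambda>l. x l \<oplus> y l) = dot C t x \<oplus> dot C t y"
proof -
  have "dot C t x \<oplus> dot C t y = finsum R (\<lambda>l. t l \<otimes> x l \<oplus> t l \<otimes> y l) C"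
    unfolding dot_def using assms by (subst finsum_addf) auto
  also have "\<dots> = dot C t (\<lambda>l. x l \<oplus> y l)"
    unfolding dot_def using assms by (intro finsum_cong') (auto simp: r_distr)
  finally show ?thesis by simp
qed

lemma dot_scale:
  assumes "finite C" "a \<in> carrier R" "\<And>l. l \<in> C \<Longrightarrow> t l \<in> carrier R" "\<And>l. l \<in> C \<Longrightarrow> x l \<in> carrier R"
  shows "dot C t (\<lambda>l. a \<otimes> x l) = a \<otimes> dot C t x"
proof -
  have "a \<otimes> dot C t x = finsum R (\<lambda>l. a \<otimes> (t l \<otimes> x l)) C"
    unfolding dot_def using assms by (intro finsum_rdistr) auto
  also have "\<dots> = dot C t (\<lambda>l. a \<otimes> x l)"
    unfolding dot_def using assms by (intro finsum_cong') (auto simp: m_lcomm)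
  finally show ?thesis by simp
qed

lemma dot_insert:
  assumes "finite C" "j \<notin> C" "\<And>l. l \<in> insert j C \<Longrightarrow> t l \<in> carrier R" "\<And>l. l \<in> insert j C \<Longrightarrow> x l \<in> carrier R"
  shows "dot (insert j C) t x = t j \<otimes> x j \<oplus> dot C t x"
  unfolding dot_def using assms by (intro finsum_insert) auto

lemma dot_diff_left:
  assumes "finite C" "a \<in> carrier R" "b \<in> carrier R" "\<And>l. l \<in> C \<Longrightarrow> t l \<in> carrier R"
    "\<And>l. l \<in> C \<Longrightarrow> u l \<in> carrier R" "\<And>l. l \<in> C \<Longrightarrow> x l \<in> carrier R"
  shows "dot C (\<lambda>l. a \<otimes> t l \<ominus> b \<otimes> u l) x = a \<otimes> dot C t x \<ominus> b \<otimes> dot C u x"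
proof -
  have "dot C (\<lambda>l. a \<otimes> t l \<ominus> b \<otimes> u l) x = dot C x (\<lambda>l. a \<otimes> t l \<oplus> \<ominus> b \<otimes> u l)"
    using assms by (intro dot_cong) (auto simp: a_minus_def l_minus intro!: m_comm)
  also have "\<dots> = dot C x (\<lambda>l. a \<otimes> t l) \<oplus> dot C x (\<lambda>l. \<ominus> b \<otimes> u l)"
    using assms by (intro dot_add) auto
  also have "\<dots> = a \<otimes> dot C x t \<oplus> \<ominus> b \<otimes> dot C x u"
    using assms by (simp add: dot_scale)
  also have "dot C x t = dot C t x" using assms by (intro dot_cong) (auto simp: m_comm)
  also have "dot C x u = dot C u x" using assms by (intro dot_cong) (auto simp: m_comm)
  finally show ?thesis using assms by (simp add: a_minus_def l_minus)
qed

lemma hom_coord: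
  assumes h: "h \<in> mod_hom R (V m) (V k)" and x: "x \<in> carrier (V m)"
  shows "h x i = dot {..<m} (\<lambda>l. h (unit_vec l) i) x"
proof -
  interpret W: Module.module R "V k" by (rule freemod_module)
  have g: "h (unit_vec j) \<in> carrier (V k)" if "j < m" for j using mod_homD(1)[OF h] that by simp
  have "h x = finsum (V k) (\<lambda>j. x j \<odot>\<^bsub>V k\<^esub> h (unit_vec j)) {..<m}"
    using hom_lincomb[OF freemod_module h x] by (simp only: lincomb_def)
  also have "\<dots> = (\<lambda>i. finsum R (\<lambda>j. (x j \<odot>\<^bsub>V k\<^esub> h (unit_vec j)) i) {..<m})"
    using x g by (intro freemod_finsum W.smult_closed) auto
  finally have "h x i = finsum R (\<lambda>j. x j \<otimes> h (unit_vec j) i) {..<m}" by simp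
  also have "\<dots> = dot {..<m} (\<lambda>l. h (unit_vec l) i) x"
    unfolding dot_def using x g[THEN freemod_coord]
    by (intro finsum_cong') (auto intro!: m_comm)
  finally show ?thesis .
qed

end

section \<open>Diagonalisation near a prime ideal\<close>

context plain_cring
begin

lemma dot_uminus:
  assumes "finite C" "\<And>l. l \<in> C \<Longrightarrow> t l \<in> carrier R" "\<And>l. l \<in> C \<Longrightarrow> x l \<in> carrier R"
  shows "dot C (\<lambda>l. \<ominus> t l) x = \<ominus> dot C t x"
proof -
  have "dot C (\<lambda>l. \<ominus> t l) x = dot C t (\<lambda>l. \<ominus> \<one> \<otimes> x l)"
    using assms by (intro dot_cong) (auto simp: l_minus r_minus)
  also have "\<dots> = \<ominus> \<one> \<otimes> dot C t x" using assms by (intro dot_scale) auto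
  finally show ?thesis using assms by (simp add: l_minus)
qed

text \<open>An elementary coordinate change over the localisation, multiplied by \<open>s\<close>:
  the quotients \<open>t l\<close> over \<open>s\<close> would be the coefficients of the row added
  to coordinate \<open>j\<close>.\<close>

definition shear :: "'a \<Rightarrow> nat \<Rightarrow> nat set \<Rightarrow> (nat \<Rightarrow> 'a) \<Rightarrow> (nat \<Rightarrow> 'a) \<Rightarrow> nat \<Rightarrow> 'a" where
  "shear s j C t x = (\<lambda>l. if l = j then s \<otimes> x j \<oplus> dot C t x else s \<otimes> x l)"

lemma shear_hom:
  assumes "j < m" "s \<in> carrier R" "finite C" "\<And>l. l \<in> C \<Longrightarrow> t l \<in> carrier R"
  shows "shear s j C t \<in> mod_hom R (V m) (V m)"
proof (rule mod_homI)
  fix x y a assume x: "x \<in> carrier (V m)"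
  then have xc: "\<And>l. x l \<in> carrier R" by simp
  have dx: "dot C t x \<in> carrier R" using xc assms by blast
  show "shear s j C t x \<in> carrier (V m)"
    using x dx assms by (auto simp: freemod_carrier shear_def)
  show "shear s j C t (x \<oplus>\<^bsub>V m\<^esub> y) = shear s j C t x \<oplus>\<^bsub>V m\<^esub> shear s j C t y"
    if y: "y \<in> carrier (V m)"
  proof -
    have yc: "\<And>l. y l \<in> carrier R" using y by simp
    have dy: "dot C t y \<in> carrier R" using yc assms by blast
    have "dot C t (\<lambda>l. x l \<oplus> y l) = dot C t x \<oplus> dot C t y" using xc yc assms by (intro dot_add) auto
    moreover have "s \<otimes> (x j \<oplus> y j) \<oplus> (dot C t x \<oplus> dot C t y)
        = s \<otimes> x j \<oplus> dot C t x \<oplus> (s \<otimes> y j \<oplus> dot C t y)"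
      using xc[of j] yc[of j] dx dy assms(2) by algebra
    ultimately show ?thesis using xc yc assms(2) by (auto simp: shear_def r_distr)
  qed
  show "shear s j C t (a \<odot>\<^bsub>V m\<^esub> x) = a \<odot>\<^bsub>V m\<^esub> shear s j C t x" if a: "a \<in> carrier R"
  proof -
    have "dot C t (\<lambda>l. a \<otimes> x l) = a \<otimes> dot C t x" using xc a assms by (intro dot_scale) auto
    then show ?thesis using xc a dx assms(2) by (auto simp: shear_def r_distr m_lcomm)
  qed
qed

lemma dot_shear:
  assumes "j \<notin> C" "finite C" "s \<in> carrier R" "\<And>l. l \<in> C \<Longrightarrow> u l \<in> carrier R" "\<And>l. x l \<in> carrier R"
  shows "dot C u (shear s j C' t x) = s \<otimes> dot C u x"
proof -
  have "dot C u (shear s j C' t x) = dot C u (\<lambda>l. s \<otimes> x l)"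
    using assms by (intro dot_cong) (auto simp: shear_def)
  then show ?thesis using assms by (simp add: dot_scale)
qed

text \<open>Off \<open>j\<close> a shear only scales, so the two added terms cancel. Asking for
  opposite rows only through their products with \<open>x\<close> lets the lemma cover both orders
  of composition.\<close>

lemma shear_shear:
  assumes "j \<notin> C" "finite C" "s \<in> carrier R" "\<And>l. l \<in> C \<Longrightarrow> t l \<in> carrier R"
    "\<And>l. l \<in> C \<Longrightarrow> u l \<in> carrier R" "\<And>l. x l \<in> carrier R" "dot C u x = \<ominus> dot C t x"
  shows "shear s j C t (shear s j C u x) = (\<lambda>l. s \<otimes> s \<otimes> x l)"
proof -
  have dc: "dot C t x \<in> carrier R" using assms by blast
  have "s \<otimes> (s \<otimes> x j \<oplus> \<ominus> dot C t x) \<oplus> s \<otimes> dot C t x = s \<otimes> s \<otimes> x j"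
    using dc assms(3) assms(6)[of j] by algebra
  then show ?thesis
    using assms dot_shear[of j C s t x C u] by (auto simp: shear_def[of s j C t] fun_eq_iff shear_def[of s j C u] m_assoc)
qed

end

locale plain_comparison = ideal_comparison R + plain_cring R for R :: "'a ring" (structure)
begin

text \<open>Divisibility in a valuation ring is total, so a finite set has an element dividing all
  the others; the product of the finitely many denominators is \<open>s\<close>.\<close>

lemma pivot:
  assumes P: "primeideal P R" and "finite X" "X \<noteq> {}" "X \<subseteq> carrier R"
  shows "\<exists>a\<in>X. \<exists>s\<in>carrier R - P. \<forall>x\<in>X. s \<otimes> x \<in> PIdl a"
  using assms(2-4)
proof (induct X rule: finite_ne_induct)
  case (singleton x)
  then show ?case using primeideal_one_notin[OF P] cgenideal_self[of x] by (auto intro!: bexI[of _ \<one>])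
next
  case (insert y X)
  then obtain a s where a: "a \<in> X" "s \<in> carrier R - P" "\<And>x. x \<in> X \<Longrightarrow> s \<otimes> x \<in> PIdl a" by auto
  have c: "a \<in> carrier R" "y \<in> carrier R" using a insert by auto
  obtain s' r where sr: "s' \<in> carrier R - P" "r \<in> carrier R" "s' \<otimes> y = r \<otimes> a \<or> s' \<otimes> a = r \<otimes> y"
    using prime_divisibility[OF P c(1,2)] by metis
  have ss: "s' \<otimes> s \<in> carrier R - P" using primeideal_mult_notin[OF P] sr a by blast
  from sr(3) show ?case
  proof
    assume y: "s' \<otimes> y = r \<otimes> a"
    have "s' \<otimes> s \<otimes> x \<in> PIdl a" if x: "x \<in> insert y X" for x
    proof (cases "x = y")
      case True
      have "s' \<otimes> s \<otimes> x = s \<otimes> (s' \<otimes> y)" using True sr(1)[THEN DiffD1] a(2)[THEN DiffD1] c by algebra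
      then show ?thesis
        using y sr c a(2) ideal.I_l_closed[OF cgenideal_ideal[OF c(1)] PIdl_mult_mem[OF c(1) sr(2)], of s] by simp
    next
      case False
      then have xX: "x \<in> X" using x by simp
      have "s' \<otimes> (s \<otimes> x) \<in> PIdl a"
        using sr ideal.I_l_closed[OF cgenideal_ideal[OF c(1)] a(3)[OF xX]] by blast
      then show ?thesis using sr a xX insert by (simp add: m_assoc subset_iff)
    qed
    then show ?thesis using a ss by blast
  next
    assume y: "s' \<otimes> a = r \<otimes> y"
    have "s' \<otimes> s \<otimes> x \<in> PIdl y" if x: "x \<in> insert y X" for x
    proof (cases "x = y")
      case True
      then show ?thesis using PIdl_mult_mem[OF c(2)] ss by blast
    next
      case False
      then have xX: "x \<in> X" using x by simp
      then obtain q where q: "q \<in> carrier R" "s \<otimes> x = q \<otimes> a" using a(3) by (auto simp: mem_PIdl)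
      have xc: "x \<in> carrier R" using xX insert by auto
      have "s' \<otimes> s \<otimes> x = s' \<otimes> (s \<otimes> x)" using sr a xc by (simp add: m_assoc)
      also have "\<dots> = q \<otimes> (s' \<otimes> a)" unfolding q(2) using q(1) sr(1)[THEN DiffD1] c by algebra
      also have "\<dots> = q \<otimes> r \<otimes> y" using y q sr c by (simp add: m_assoc)
      finally show ?thesis using PIdl_mult_mem[OF c(2), of "q \<otimes> r"] q sr by simp
    qed
    then show ?thesis using ss by blast
  qed
qed

lemma common_multiplier:
  assumes P: "primeideal P R" and "finite L"
    and "\<And>l. l \<in> L \<Longrightarrow> \<exists>t\<in>carrier R - P. Pr l t"
    and mono: "\<And>l t u. \<lbrakk>l \<in> L; t \<in> carrier R; u \<in> carrier R; Pr l t\<rbrakk> \<Longrightarrow> Pr l (u \<otimes> t)"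
  shows "\<exists>t\<in>carrier R - P. \<forall>l\<in>L. Pr l t"
  using assms(2-)
proof (induct L)
  case empty
  then show ?case using primeideal_one_notin[OF P] by blast
next
  case (insert l L)
  obtain t where t: "t \<in> carrier R - P" "\<forall>l\<in>L. Pr l t" using insert by blast
  obtain u where u: "u \<in> carrier R - P" "Pr l u" using insert by blast
  have "Pr k (t \<otimes> u)" if "k \<in> insert l L" for k
  proof (cases "k = l")
    case True
    then show ?thesis using insert(5)[of l u t] t u by blast
  next
    case False
    then have "Pr k (u \<otimes> t)" using insert(5)[of k t u] that t u by blast
    then show ?thesis using t u by (simp add: m_comm)
  qed
  then show ?case using primeideal_mult_notin[OF P t(1) u(1)] by blast
qed

text \<open>Gaussian elimination over the valuation ring \<open>R\<^sub>P\<close> with denominators cleared: after the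
  coordinate change \<open>\<phi>\<close>, with inverse \<open>\<psi>\<close> up to the factor \<open>s\<close>, the kernel of the matrix becomes a
  product of annihilators. The multiples in the coordinates outside \<open>C\<close> serve the induction on \<open>C\<close>.\<close>
definition kernel_diag ::
  "nat \<Rightarrow> nat set \<Rightarrow> nat set \<Rightarrow> (nat \<Rightarrow> nat \<Rightarrow> 'a) \<Rightarrow> 'a \<Rightarrow> ((nat \<Rightarrow> 'a) \<Rightarrow> nat \<Rightarrow> 'a) \<Rightarrow>
    ((nat \<Rightarrow> 'a) \<Rightarrow> nat \<Rightarrow> 'a) \<Rightarrow> (nat \<Rightarrow> 'a) \<Rightarrow> bool" where
  "kernel_diag m I C A s \<phi> \<psi> a \<longleftrightarrow>
    \<phi> \<in> mod_hom R (V m) (V m) \<and> \<psi> \<in> mod_hom R (V m) (V m) \<and> (\<forall>l. a l \<in> carrier R)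
    \<and> (\<forall>x\<in>carrier (V m). \<phi> (\<psi> x) = (\<lambda>l. s \<otimes> x l)) \<and> (\<forall>x\<in>carrier (V m). \<psi> (\<phi> x) = (\<lambda>l. s \<otimes> x l))
    \<and> (\<forall>x\<in>carrier (V m). \<forall>j. j \<notin> C \<longrightarrow> (\<exists>r\<in>carrier R. \<phi> x j = r \<otimes> x j))
    \<and> (\<forall>x\<in>carrier (V m). \<forall>j. j \<notin> C \<longrightarrow> (\<exists>r\<in>carrier R. \<psi> x j = r \<otimes> x j))
    \<and> (\<forall>x\<in>carrier (V m). (\<forall>i\<in>I. dot C (A i) x = \<zero>) \<longrightarrow> (\<forall>l\<in>C. a l \<otimes> \<phi> x l = \<zero>))
    \<and> (\<forall>x\<in>carrier (V m). (\<forall>l\<in>C. a l \<otimes> x l = \<zero>) \<longrightarrow> (\<forall>i\<in>I. dot C (A i) (\<psi> x) = \<zero>))"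

lemma kernel_diagD:
  assumes "kernel_diag m I C A s \<phi> \<psi> a"
  shows "\<phi> \<in> mod_hom R (V m) (V m)" "\<psi> \<in> mod_hom R (V m) (V m)" "a l \<in> carrier R"
    "x \<in> carrier (V m) \<Longrightarrow> \<phi> (\<psi> x) = (\<lambda>l. s \<otimes> x l)"
    "x \<in> carrier (V m) \<Longrightarrow> \<psi> (\<phi> x) = (\<lambda>l. s \<otimes> x l)"
    "x \<in> carrier (V m) \<Longrightarrow> j \<notin> C \<Longrightarrow> \<exists>r\<in>carrier R. \<phi> x j = r \<otimes> x j"
    "x \<in> carrier (V m) \<Longrightarrow> j \<notin> C \<Longrightarrow> \<exists>r\<in>carrier R. \<psi> x j = r \<otimes> x j"
    "x \<in> carrier (V m) \<Longrightarrow> \<forall>i\<in>I. dot C (A i) x = \<zero> \<Longrightarrow> l \<in> C \<Longrightarrow> a l \<otimes> \<phi> x l = \<zero>"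
    "x \<in> carrier (V m) \<Longrightarrow> \<forall>l\<in>C. a l \<otimes> x l = \<zero> \<Longrightarrow> i \<in> I \<Longrightarrow> dot C (A i) (\<psi> x) = \<zero>"
  using assms unfolding kernel_diag_def by simp_all

text \<open>The pivot divides every entry up to \<open>s\<close>, so it clears both its row and its
  column. Row operations leave the kernel alone and need no bookkeeping; only the change of
  coordinates \<open>\<tau>\<close> is recorded. It turns the pivot equation into
  \<open>a \<otimes> \<tau> x j = \<zero>\<close>, and the other equations into the smaller matrix
  \<open>B\<close> on the remaining columns.\<close>

lemma near_diagonal:
  assumes P: "primeideal P R" and I: "finite I" and C: "C \<subseteq> {..<m}"
    and A: "\<And>i l. \<lbrakk>i \<in> I; l \<in> C\<rbrakk> \<Longrightarrow> A i l \<in> carrier R"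
  shows "\<exists>s\<in>carrier R - P. \<exists>\<phi> \<psi> a. kernel_diag m I C A s \<phi> \<psi> a"
  using C A
proof (induct "card C" arbitrary: C A)
  case 0
  then have "C = {}" using finite_subset[OF 0(2)] by auto
  then have "kernel_diag m I C A \<one> (\<lambda>x. x) (\<lambda>x. x) (\<lambda>_. \<zero>)"
    by (auto simp: kernel_diag_def dot_def mod_hom_def fun_eq_iff intro!: bexI[of _ \<one>])
  then show ?case using primeideal_one_notin[OF P] by blast
next
  case (Suc n)
  have finC: "finite C" using Suc(3) finite_subset by auto
  have neC: "C \<noteq> {}" using Suc(2) by auto
  show ?case
  proof (cases "I = {}")
    \<comment> \<open>Without rows the kernel is the whole module, which the zero diagonal
      describes.\<close>
    case True
    then have "kernel_diag m I C A \<one> (\<lambda>x. x) (\<lambda>x. x) (\<lambda>_. \<zero>)"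
      by (auto simp: kernel_diag_def mod_hom_def fun_eq_iff intro!: bexI[of _ \<one>])
    then show ?thesis using primeideal_one_notin[OF P] by blast
  next
    case False
    define X where "X = (\<lambda>(i, l). A i l) ` (I \<times> C)"
    have "finite X" "X \<noteq> {}" "X \<subseteq> carrier R"
      using I finC False neC Suc(4) by (auto simp: X_def)
    from pivot[OF P this] obtain i j s where ij: "i \<in> I" "j \<in> C" and s: "s \<in> carrier R - P"
      and piv: "\<And>i' l. \<lbrakk>i' \<in> I; l \<in> C\<rbrakk> \<Longrightarrow> s \<otimes> A i' l \<in> PIdl (A i j)"
      by (auto simp: X_def)
    have "\<exists>T. \<forall>i'\<in>I. \<forall>l\<in>C. T i' l \<in> carrier R \<and> s \<otimes> A i' l = T i' l \<otimes> A i j"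
      using piv unfolding mem_PIdl by metis
    then obtain T where T: "\<And>i' l. \<lbrakk>i' \<in> I; l \<in> C\<rbrakk> \<Longrightarrow> T i' l \<in> carrier R"
      "\<And>i' l. \<lbrakk>i' \<in> I; l \<in> C\<rbrakk> \<Longrightarrow> s \<otimes> A i' l = T i' l \<otimes> A i j" by blast
    define D where "D = C - {j}"
    have D: "D \<subseteq> {..<m}" "j \<notin> D" "finite D" "C = insert j D" "D \<subseteq> C" "j < m" "n = card D"
      using Suc(2,3) finC ij by (auto simp: D_def)
    define a where "a = A i j"
    have ac: "a \<in> carrier R" using ij Suc(4) by (simp add: a_def)
    have sc: "s \<in> carrier R" using s by simp
    define t where "t = T i"
    have tc: "\<And>l. l \<in> D \<Longrightarrow> t l \<in> carrier R" using T ij D by (auto simp: t_def)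
    have Ac: "\<And>i' l. \<lbrakk>i' \<in> I; l \<in> D\<rbrakk> \<Longrightarrow> A i' l \<in> carrier R" "\<And>i'. i' \<in> I \<Longrightarrow> A i' j \<in> carrier R"
      using Suc(4) D ij by auto
    \<comment> \<open>The pivot row of \<open>B\<close> is zero but is kept, so that the rows remain
      indexed by \<open>I\<close> and only \<open>C\<close> shrinks.\<close>
    define B where "B i' l = s \<otimes> A i' l \<ominus> A i' j \<otimes> t l" for i' l
    have Bc: "\<And>i' l. \<lbrakk>i' \<in> I; l \<in> D\<rbrakk> \<Longrightarrow> B i' l \<in> carrier R" using Ac tc sc by (auto simp: B_def)
    define \<tau> where "\<tau> = shear s j D t"
    define \<sigma> where "\<sigma> = shear s j D (\<lambda>l. \<ominus> t l)"
    have \<tau>: "\<tau> \<in> mod_hom R (V m) (V m)" and \<sigma>: "\<sigma> \<in> mod_hom R (V m) (V m)"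
      unfolding \<tau>_def \<sigma>_def using D sc tc by (auto intro!: shear_hom)
    have dotB: "dot D (B i') x = s \<otimes> dot D (A i') x \<ominus> A i' j \<otimes> dot D t x"
      if "i' \<in> I" "\<And>l. x l \<in> carrier R" for i' x
      unfolding B_def using that D sc Ac tc by (intro dot_diff_left) auto
    have dotC: "dot C (A i') x = A i' j \<otimes> x j \<oplus> dot D (A i') x"
      if "i' \<in> I" "\<And>l. x l \<in> carrier R" for i' x
      unfolding D(4) using that D Ac by (intro dot_insert) auto
    have \<tau>\<sigma>: "\<tau> (\<sigma> x) = (\<lambda>l. s \<otimes> s \<otimes> x l)" "\<sigma> (\<tau> x) = (\<lambda>l. s \<otimes> s \<otimes> x l)" if x: "x \<in> carrier (V m)" for x
    proof -
      have xc: "\<And>l. x l \<in> carrier R" using x by simp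
      have u: "dot D (\<lambda>l. \<ominus> t l) x = \<ominus> dot D t x" using D tc xc by (intro dot_uminus) auto
      have dc: "dot D t x \<in> carrier R" using tc xc by blast
      show "\<tau> (\<sigma> x) = (\<lambda>l. s \<otimes> s \<otimes> x l)"
        unfolding \<tau>_def \<sigma>_def using D sc tc xc u by (intro shear_shear) auto
      show "\<sigma> (\<tau> x) = (\<lambda>l. s \<otimes> s \<otimes> x l)"
        unfolding \<tau>_def \<sigma>_def using D sc tc xc u dc by (intro shear_shear) auto
    qed
    have "\<exists>s'\<in>carrier R - P. \<exists>\<phi> \<psi> a'. kernel_diag m I D B s' \<phi> \<psi> a'"
      by (rule Suc(1)) (fact D(7) D(1) Bc)+
    then obtain s' \<phi> \<psi> a' where s': "s' \<in> carrier R - P" and IH: "kernel_diag m I D B s' \<phi> \<psi> a'"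
      by blast
    note IH = s' kernel_diagD[OF IH]
    have sc': "s' \<in> carrier R" using IH(1) by simp
    note cl = mod_homD(1)[OF \<tau>] mod_homD(1)[OF \<sigma>] mod_homD(1)[OF IH(2)] mod_homD(1)[OF IH(3)]
    have scale: "f (\<lambda>l. r \<otimes> x l) = (\<lambda>l. r \<otimes> f x l)"
      if "f \<in> mod_hom R (V m) (V m)" "r \<in> carrier R" "x \<in> carrier (V m)" for f r x
      using mod_homD(3)[OF that(1,2,3)] by simp
    define S where "S = s' \<otimes> (s \<otimes> s)"
    have S: "S \<in> carrier R - P"
      unfolding S_def by (intro primeideal_mult_notin[OF P] IH(1) s)
    define a'' where "a'' = a'(j := a)"
    have hom1: "(\<lambda>x. \<phi> (\<tau> x)) \<in> mod_hom R (V m) (V m)" and hom2: "(\<lambda>x. \<sigma> (\<psi> x)) \<in> mod_hom R (V m) (V m)"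
      using mod_hom_comp[OF \<tau> IH(2)] mod_hom_comp[OF IH(3) \<sigma>] .
    have inv1: "\<phi> (\<tau> (\<sigma> (\<psi> x))) = (\<lambda>l. S \<otimes> x l)" if x: "x \<in> carrier (V m)" for x
    proof -
      have "\<phi> (\<tau> (\<sigma> (\<psi> x))) = \<phi> (\<lambda>l. s \<otimes> s \<otimes> \<psi> x l)" using \<tau>\<sigma>(1) cl(4)[OF x] by simp
      also have "\<dots> = (\<lambda>l. s \<otimes> s \<otimes> \<phi> (\<psi> x) l)" using sc cl(4)[OF x] by (intro scale IH(2)) auto
      also have "\<dots> = (\<lambda>l. S \<otimes> x l)" using IH(5)[OF x] sc sc' freemod_coord[OF x] by (auto simp: S_def m_ac)
      finally show ?thesis .
    qed
    have inv2: "\<sigma> (\<psi> (\<phi> (\<tau> x))) = (\<lambda>l. S \<otimes> x l)" if x: "x \<in> carrier (V m)" for x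
    proof -
      have "\<sigma> (\<psi> (\<phi> (\<tau> x))) = \<sigma> (\<lambda>l. s' \<otimes> \<tau> x l)" using IH(6) cl(1)[OF x] by simp
      also have "\<dots> = (\<lambda>l. s' \<otimes> \<sigma> (\<tau> x) l)" using sc' cl(1)[OF x] by (intro scale \<sigma>) auto
      also have "\<dots> = (\<lambda>l. S \<otimes> x l)" using \<tau>\<sigma>(2)[OF x] sc sc' freemod_coord[OF x] by (auto simp: S_def m_ac)
      finally show ?thesis .
    qed
    have fix1: "\<exists>r\<in>carrier R. \<phi> (\<tau> x) k = r \<otimes> x k" if x: "x \<in> carrier (V m)" "k \<notin> C" for x k
    proof -
      have "\<tau> x k = s \<otimes> x k" using x ij by (auto simp: \<tau>_def shear_def)
      moreover obtain r where "r \<in> carrier R" "\<phi> (\<tau> x) k = r \<otimes> \<tau> x k"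
        using IH(7)[OF cl(1)[OF x(1)]] x(2) D by blast
      ultimately show ?thesis using x(1) sc by (intro bexI[of _ "r \<otimes> s"]) (auto simp: m_assoc)
    qed
    have fix2: "\<exists>r\<in>carrier R. \<sigma> (\<psi> x) k = r \<otimes> x k" if x: "x \<in> carrier (V m)" "k \<notin> C" for x k
    proof -
      have "\<sigma> (\<psi> x) k = s \<otimes> \<psi> x k" using x ij by (auto simp: \<sigma>_def shear_def)
      moreover obtain r where "r \<in> carrier R" "\<psi> x k = r \<otimes> x k"
        using IH(8)[OF x(1)] x(2) D by blast
      ultimately show ?thesis using x(1) sc by (intro bexI[of _ "s \<otimes> r"]) (auto simp: m_assoc)
    qed
    have ker1: "\<forall>l\<in>C. a'' l \<otimes> \<phi> (\<tau> x) l = \<zero>"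
      if x: "x \<in> carrier (V m)" and k: "\<forall>i\<in>I. dot C (A i) x = \<zero>" for x
    proof -
      have xc: "\<And>l. x l \<in> carrier R" using x by simp
      have dc: "dot D t x \<in> carrier R" "\<And>i'. i' \<in> I \<Longrightarrow> dot D (A i') x \<in> carrier R"
        using tc xc Ac by blast+
      have \<tau>j: "\<tau> x j = s \<otimes> x j \<oplus> dot D t x" by (simp add: \<tau>_def shear_def)
      have "dot D (B i) x = \<zero>"
      proof -
        have "dot D (B i) x = dot D (\<lambda>_. \<zero>) x"
        proof (rule dot_cong)
          fix l assume l: "l \<in> D"
          have "s \<otimes> A i l = t l \<otimes> a" using T(2)[OF ij(1), of l] l D(5) by (auto simp: a_def t_def)
          then have "s \<otimes> A i l = A i j \<otimes> t l" using ac tc[OF l] by (simp add: a_def m_comm)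
          then have "B i l = \<zero>" using ac tc[OF l] by (simp add: B_def a_def a_minus_def r_neg)
          then show "B i l \<otimes> x l = \<zero> \<otimes> x l" by simp
        qed (use xc in auto)
        then show ?thesis unfolding dot_def using xc by (simp add: finsum_zero)
      qed
      then have Bi: "s \<otimes> dot D (A i) x \<ominus> a \<otimes> dot D t x = \<zero>" using dotB[OF ij(1)] xc by (simp add: a_def)
      have "dot C (A i) x = \<zero>" using k ij by blast
      then have Ci: "a \<otimes> x j \<oplus> dot D (A i) x = \<zero>" using dotC[OF ij(1), of x] xc by (simp add: a_def)
      \<comment> \<open>The first bracket is the pivot equation, the second the zero row of
        \<open>B\<close> applied to \<open>x\<close>.\<close>
      have "a \<otimes> \<tau> x j = s \<otimes> (a \<otimes> x j \<oplus> dot D (A i) x) \<ominus> (s \<otimes> dot D (A i) x \<ominus> a \<otimes> dot D t x)"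
        unfolding \<tau>j using ac sc xc[of j] dc(1) dc(2)[OF ij(1)] by algebra
      then have a\<tau>: "a \<otimes> \<tau> x j = \<zero>" using Bi Ci sc by (simp add: a_minus_def)
      have "dot D (B i') (\<tau> x) = \<zero>" if i': "i' \<in> I" for i'
      proof -
        have "dot C (A i') x = \<zero>" using k i' by blast
        then have Ci': "A i' j \<otimes> x j \<oplus> dot D (A i') x = \<zero>" using dotC[OF i', of x] xc by simp
        have "dot D (B i') (\<tau> x) = s \<otimes> dot D (B i') x"
          unfolding \<tau>_def using D sc Bc[OF i'] xc by (intro dot_shear) auto
        also have "\<dots> = s \<otimes> (s \<otimes> dot D (A i') x \<ominus> A i' j \<otimes> dot D t x)" using dotB[OF i'] xc by simp
        also have "\<dots> = s \<otimes> s \<otimes> (A i' j \<otimes> x j \<oplus> dot D (A i') x) \<ominus> (s \<otimes> A i' j) \<otimes> \<tau> x j"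
          unfolding \<tau>j using sc xc[of j] dc(1) dc(2)[OF i'] Ac(2)[OF i'] by algebra
        also have "\<dots> = s \<otimes> s \<otimes> \<zero> \<ominus> T i' j \<otimes> (a \<otimes> \<tau> x j)"
          using Ci' T[OF i' ij(2)] ac freemod_coord[OF cl(1)[OF x]] by (simp add: a_def m_assoc)
        also have "\<dots> = \<zero>" using a\<tau> sc T[OF i' ij(2)] by (simp add: a_minus_def)
        finally show ?thesis .
      qed
      then have "\<forall>l\<in>D. a' l \<otimes> \<phi> (\<tau> x) l = \<zero>" using IH(9)[OF cl(1)[OF x]] by blast
      \<comment> \<open>The index \<open>j\<close> has left the column set, so the inductive
        transformation only multiplies this coordinate and preserves its annihilation by
        \<open>a\<close>.\<close>
      moreover obtain r where r: "r \<in> carrier R" "\<phi> (\<tau> x) j = r \<otimes> \<tau> x j"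
        using IH(7)[OF cl(1)[OF x] D(2)] by blast
      have "a \<otimes> \<phi> (\<tau> x) j = r \<otimes> (a \<otimes> \<tau> x j)"
        using r ac freemod_coord[OF cl(1)[OF x]] by (simp add: m_lcomm)
      then have "a \<otimes> \<phi> (\<tau> x) j = \<zero>" using a\<tau> r by simp
      ultimately show ?thesis using D by (auto simp: a''_def)
    qed
    have ker2: "\<forall>i\<in>I. dot C (A i) (\<sigma> (\<psi> x)) = \<zero>"
      if x: "x \<in> carrier (V m)" and k: "\<forall>l\<in>C. a'' l \<otimes> x l = \<zero>" for x
    proof
      fix i' assume i': "i' \<in> I"
      define z where "z = \<psi> x"
      have z: "z \<in> carrier (V m)" using cl(4)[OF x] by (simp add: z_def)
      have zc: "\<And>l. z l \<in> carrier R" using z by simp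
      have "a' l \<otimes> x l = \<zero>" if "l \<in> D" for l using k that D by (auto simp: a''_def split: if_splits)
      then have "\<forall>i\<in>I. dot D (B i) z = \<zero>" using IH(10)[OF x] by (simp add: z_def)
      then have Bz: "s \<otimes> dot D (A i') z \<ominus> A i' j \<otimes> dot D t z = \<zero>" using i' dotB[OF i', of z] zc by simp
      obtain r where r: "r \<in> carrier R" "z j = r \<otimes> x j" using IH(8)[OF x D(2)] by (auto simp: z_def)
      have "a \<otimes> x j = \<zero>" using k D by (auto simp: a''_def)
      moreover have "a \<otimes> z j = r \<otimes> (a \<otimes> x j)" using r ac freemod_coord[OF x] by (simp add: m_lcomm)
      ultimately have az: "a \<otimes> z j = \<zero>" using r by simp
      have dc: "dot D t z \<in> carrier R" "dot D (A i') z \<in> carrier R" using tc zc Ac i' by blast+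
      have u: "dot D (\<lambda>l. \<ominus> t l) z = \<ominus> dot D t z" using D tc zc by (intro dot_uminus) auto
      have "dot C (A i') (\<sigma> z) = A i' j \<otimes> \<sigma> z j \<oplus> dot D (A i') (\<sigma> z)"
        using freemod_coord[OF cl(2)[OF z]] by (intro dotC i')
      also have "dot D (A i') (\<sigma> z) = s \<otimes> dot D (A i') z"
        unfolding \<sigma>_def using D sc Ac i' zc by (intro dot_shear) auto
      also have "A i' j \<otimes> \<sigma> z j = A i' j \<otimes> (s \<otimes> z j \<oplus> \<ominus> dot D t z)" by (simp add: \<sigma>_def shear_def u)
      also have "A i' j \<otimes> (s \<otimes> z j \<oplus> \<ominus> dot D t z) \<oplus> s \<otimes> dot D (A i') z
          = (s \<otimes> A i' j) \<otimes> z j \<oplus> (s \<otimes> dot D (A i') z \<ominus> A i' j \<otimes> dot D t z)"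
        using sc zc[of j] dc Ac(2)[OF i'] by algebra
      also have "\<dots> = T i' j \<otimes> (a \<otimes> z j) \<oplus> \<zero>"
        using Bz T[OF i' ij(2)] ac zc by (simp add: a_def m_assoc)
      also have "\<dots> = \<zero>" using az T[OF i' ij(2)] by simp
      finally show "dot C (A i') (\<sigma> (\<psi> x)) = \<zero>" by (simp add: z_def)
    qed
    have "kernel_diag m I C A S (\<lambda>x. \<phi> (\<tau> x)) (\<lambda>x. \<sigma> (\<psi> x)) a''"
      unfolding kernel_diag_def
    proof (intro conjI hom1 hom2)
      show "\<forall>l. a'' l \<in> carrier R" using IH(4) ac by (simp add: a''_def)
    qed (use inv1 inv2 fix1 fix2 ker1 ker2 in blast)+
    then show ?thesis using S by blast
  qed
qed

end

section \<open>Second syzygies\<close>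

context plain_cring
begin

lemma scale_hom: "a \<in> carrier R \<Longrightarrow> (\<lambda>x l. a \<otimes> x l) \<in> mod_hom R (V m) (V m)"
  by (rule mod_homI) (auto simp: freemod_carrier r_distr m_lcomm)

lemma diag_hom:
  "(\<And>l. l < m \<Longrightarrow> b l \<in> carrier R) \<Longrightarrow> (\<lambda>x l. if l < m then b l \<otimes> x l else \<zero>) \<in> mod_hom R (V m) (V m)"
  by (rule mod_homI) (auto simp: freemod_carrier r_distr m_lcomm fun_eq_iff)

lemma diff_hom:
  assumes f: "f \<in> mod_hom R (V p) (V q)" and g: "g \<in> mod_hom R (V p) (V q)"
  shows "(\<lambda>x l. f x l \<ominus> g x l) \<in> mod_hom R (V p) (V q)"
proof (rule mod_homI)
  fix x y a assume x: "x \<in> carrier (V p)"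
  note fx = mod_homD(1)[OF f x] and gx = mod_homD(1)[OF g x]
  then show "(\<lambda>l. f x l \<ominus> g x l) \<in> carrier (V q)" by (auto simp: freemod_carrier a_minus_def)
  have mm1: "(r \<oplus> s) \<ominus> (t \<oplus> u) = (r \<ominus> t) \<oplus> (s \<ominus> u)"
    if "r \<in> carrier R" "s \<in> carrier R" "t \<in> carrier R" "u \<in> carrier R" for r s t u
    using that by algebra
  have mm2: "c \<otimes> r \<ominus> c \<otimes> s = c \<otimes> (r \<ominus> s)"
    if "r \<in> carrier R" "s \<in> carrier R" "c \<in> carrier R" for r s c
    using that by algebra
  show "(\<lambda>l. f (x \<oplus>\<^bsub>V p\<^esub> y) l \<ominus> g (x \<oplus>\<^bsub>V p\<^esub> y) l)
      = (\<lambda>l. f x l \<ominus> g x l) \<oplus>\<^bsub>V q\<^esub> (\<lambda>l. f y l \<ominus> g y l)" if y: "y \<in> carrier (V p)"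
    using mod_homD(2)[OF f x y] mod_homD(2)[OF g x y] mm1 freemod_coord[OF fx] freemod_coord[OF gx]
      freemod_coord[OF mod_homD(1)[OF f y]] freemod_coord[OF mod_homD(1)[OF g y]] by simp
  show "(\<lambda>l. f (a \<odot>\<^bsub>V p\<^esub> x) l \<ominus> g (a \<odot>\<^bsub>V p\<^esub> x) l) = a \<odot>\<^bsub>V q\<^esub> (\<lambda>l. f x l \<ominus> g x l)" if a: "a \<in> carrier R"
    using mod_homD(3)[OF f a x] mod_homD(3)[OF g a x] mm2 a freemod_coord[OF fx] freemod_coord[OF gx]
    by simp
qed

lemma dot_hom:
  assumes c: "\<And>l. l < p \<Longrightarrow> c l \<in> carrier R"
  shows "(\<lambda>x i. if i = 0 then dot {..<p} c x else \<zero>) \<in> mod_hom R (V p) (V 1)"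
proof (rule mod_homI)
  fix x y a assume x: "x \<in> carrier (V p)"
  then have xc: "\<And>l. x l \<in> carrier R" by simp
  show "(\<lambda>i. if i = 0 then dot {..<p} c x else \<zero>) \<in> carrier (V 1)"
    using xc c by (auto simp: freemod_carrier)
  show "(\<lambda>i. if i = 0 then dot {..<p} c (x \<oplus>\<^bsub>V p\<^esub> y) else \<zero>) =
      (\<lambda>i::nat. if i = 0 then dot {..<p} c x else \<zero>) \<oplus>\<^bsub>V 1\<^esub> (\<lambda>i. if i = 0 then dot {..<p} c y else \<zero>)"
    if y: "y \<in> carrier (V p)"
    using dot_add[of "{..<p}" c x y] xc c freemod_coord[OF y] by (auto simp: fun_eq_iff)
  show "(\<lambda>i. if i = 0 then dot {..<p} c (a \<odot>\<^bsub>V p\<^esub> x) else \<zero>) =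
      a \<odot>\<^bsub>V 1\<^esub> (\<lambda>i::nat. if i = 0 then dot {..<p} c x else \<zero>)" if a: "a \<in> carrier R"
    using dot_scale[of "{..<p}" a c x] xc c a by (auto simp: fun_eq_iff)
qed

lemma dot_in_ideal:
  assumes "ideal J R" "\<And>l. l < p \<Longrightarrow> c l \<in> J" "\<And>l. l < p \<Longrightarrow> x l \<in> carrier R" shows "dot {..<p} c x \<in> J"
proof -
  have "finsum R (\<lambda>l. c l \<otimes> x l) A \<in> J" if "finite A" "A \<subseteq> {..<p}" for A
    using that
  proof (induct A)
    case (insert l A)
    have t: "c i \<otimes> x i \<in> J" "c i \<otimes> x i \<in> carrier R" if "i \<in> insert l A" for i
    proof -
      show "c i \<otimes> x i \<in> J" using assms that insert by (auto intro!: ideal.I_r_closed)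
      then show "c i \<otimes> x i \<in> carrier R" using ideal.Icarr[OF assms(1)] by blast
    qed
    then have "finsum R (\<lambda>l. c l \<otimes> x l) (insert l A) = c l \<otimes> x l \<oplus> finsum R (\<lambda>l. c l \<otimes> x l) A"
      using insert by (intro finsum_insert) auto
    then show ?case using insert t ideal_add_closed[OF assms(1)] by auto
  qed (use assms in \<open>auto simp: ideal_zero_mem\<close>)
  then show ?thesis by (simp add: dot_def)
qed

lemma hom_apply_scaled:
  assumes "f \<in> mod_hom R (V p) (V q)" "a \<in> carrier R" "x \<in> carrier (V p)"
  shows "f (\<lambda>l. a \<otimes> x l) = (\<lambda>l. a \<otimes> f x l)"
  using mod_homD(3)[OF assms] by simp

lemma hom_apply_zero: "f \<in> mod_hom R (V p) (V q) \<Longrightarrow> f (\<lambda>l. \<zero>) = (\<lambda>l. \<zero>)"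
  using mod_hom_zero[OF freemod_module freemod_module] by simp

text \<open>The admissible multipliers \<open>s\<close> form an ideal.\<close>
lemma finitely_generated_local:
  assumes N: "Module.module R N" and K: "K \<subseteq> carrier N"
    and loc: "\<And>M. maximalideal M R \<Longrightarrow>
      \<exists>s\<in>carrier R - M. \<exists>G. finite G \<and> G \<subseteq> K \<and> (\<forall>z\<in>K. s \<odot>\<^bsub>N\<^esub> z \<in> mspan R N G)"
  shows "\<exists>G. finite G \<and> G \<subseteq> K \<and> K \<subseteq> mspan R N G"
proof -
  interpret N: Module.module R N by fact
  define J where "J = {s \<in> carrier R. \<exists>G. finite G \<and> G \<subseteq> K \<and> (\<forall>z\<in>K. s \<odot>\<^bsub>N\<^esub> z \<in> mspan R N G)}"
  have "ideal J R"
  proof (rule ideal_cringI)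
    show "\<zero> \<in> J" using K by (auto simp: J_def subset_iff intro!: exI[of _ "{}"] mspan.zero)
  next
    fix s t assume "s \<in> J" "t \<in> J"
    then obtain G H where GH: "s \<in> carrier R" "t \<in> carrier R" "finite G" "G \<subseteq> K" "finite H" "H \<subseteq> K"
      "\<forall>z\<in>K. s \<odot>\<^bsub>N\<^esub> z \<in> mspan R N G" "\<forall>z\<in>K. t \<odot>\<^bsub>N\<^esub> z \<in> mspan R N H" by (auto simp: J_def)
    have "(s \<oplus> t) \<odot>\<^bsub>N\<^esub> z \<in> mspan R N (G \<union> H)" if "z \<in> K" for z
    proof -
      have "s \<odot>\<^bsub>N\<^esub> z \<in> mspan R N (G \<union> H)" using GH(7) that mspan_mono[of G "G \<union> H"] by blast
      moreover have "t \<odot>\<^bsub>N\<^esub> z \<in> mspan R N (G \<union> H)" using GH(8) that mspan_mono[of H "G \<union> H"] by blast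
      ultimately have "s \<odot>\<^bsub>N\<^esub> z \<oplus>\<^bsub>N\<^esub> t \<odot>\<^bsub>N\<^esub> z \<in> mspan R N (G \<union> H)" by (rule mspan.add)
      then show ?thesis using N.smult_l_distr[of s t z] GH K that by auto
    qed
    then show "s \<oplus> t \<in> J" using GH by (auto simp: J_def intro!: exI[of _ "G \<union> H"])
  next
    fix a s assume a: "a \<in> carrier R" "s \<in> J"
    then obtain G where G: "s \<in> carrier R" "finite G" "G \<subseteq> K" "\<forall>z\<in>K. s \<odot>\<^bsub>N\<^esub> z \<in> mspan R N G"
      by (auto simp: J_def)
    have "(a \<otimes> s) \<odot>\<^bsub>N\<^esub> z \<in> mspan R N G" if z: "z \<in> K" for z
    proof -
      have "(a \<otimes> s) \<odot>\<^bsub>N\<^esub> z = a \<odot>\<^bsub>N\<^esub> (s \<odot>\<^bsub>N\<^esub> z)" using N.smult_assoc1 a G z K by auto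
      then show ?thesis using mspan.smult[OF a(1) bspec[OF G(4) z]] by simp
    qed
    then show "a \<otimes> s \<in> J" using a G by (auto simp: J_def intro!: exI[of _ G])
  qed (auto simp: J_def)
  then have "\<one> \<in> J"
  proof (rule ideal_eq_carrier_local)
    fix M assume "maximalideal M R"
    from loc[OF this] show "\<exists>s\<in>carrier R - M. s \<in> J" unfolding J_def by blast
  qed
  then obtain G where G: "finite G" "G \<subseteq> K" "\<forall>z\<in>K. \<one> \<odot>\<^bsub>N\<^esub> z \<in> mspan R N G" by (auto simp: J_def)
  then have "K \<subseteq> mspan R N G" using K N.smult_one by (metis subset_iff)
  then show ?thesis using G by blast
qed

end

section \<open>The kernel of the second of two consecutive maps\<close>

context plain_comparison
begin

text \<open>One of finitely many generators divides the others at \<open>M\<close>, so the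
  annihilator is principal at the point \<open>M\<close>, and spreading applies.\<close>

lemma annih_principal_near_gens:
  assumes M: "maximalideal M R" and a: "a \<in> carrier R" and X: "finite X" "X \<subseteq> annih a"
    and gen: "\<And>x. x \<in> annih a \<Longrightarrow> \<exists>s\<in>carrier R - M. s \<otimes> x \<in> Idl X"
  shows "\<exists>b. annih_principal_near M a b"
proof -
  note PM = primeideal_maximal[OF M]
  have Xc: "X \<subseteq> carrier R" using X by (auto simp: annih_def)
  have "\<exists>b\<in>annih a. \<exists>t\<in>carrier R - M. \<forall>x\<in>X. t \<otimes> x \<in> PIdl b"
  proof (cases "X = {}")
    case True
    then show ?thesis using primeideal_one_notin[OF PM] ideal_zero_mem[OF annih_ideal[OF a]] by blast
  next
    case False
    then show ?thesis using pivot[OF PM X(1) False Xc] X by blast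
  qed
  then obtain b t where bt: "b \<in> annih a" "t \<in> carrier R - M" "\<And>x. x \<in> X \<Longrightarrow> t \<otimes> x \<in> PIdl b" by blast
  have bc: "b \<in> carrier R" using bt by (simp add: annih_def)
  note K = cgenideal_ideal[OF bc]
  define J where "J = {y \<in> carrier R. t \<otimes> y \<in> PIdl b}"
  have "ideal J R"
  proof (rule ideal_cringI, goal_cases)
    case (4 a x)
    then show ?case using bt ideal.I_l_closed[OF K, of "t \<otimes> x" a] by (auto simp: J_def m_lcomm)
  qed (use bt K in \<open>auto simp: J_def r_distr ideal_zero_mem ideal_add_closed\<close>)
  then have J: "Idl X \<subseteq> J" using bt Xc by (intro genideal_minimal) (auto simp: J_def)
  show ?thesis
  proof (rule annih_principal_spread[OF M a bt(1)])
    fix x assume x: "x \<in> annih a"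
    then obtain s where s: "s \<in> carrier R - M" "s \<otimes> x \<in> Idl X" using gen by blast
    have "t \<otimes> (s \<otimes> x) \<in> PIdl b" using s J by (auto simp: J_def)
    then have "t \<otimes> s \<otimes> x \<in> PIdl b" using bt s x by (simp add: m_assoc annih_def)
    then show "\<exists>t\<in>carrier R - M. t \<otimes> x \<in> PIdl b" using primeideal_mult_notin[OF PM bt(2) s(1)] by blast
  qed
qed

lemma annih_common_multiplier:
  fixes m :: nat
  assumes M: "maximalideal M R" and a: "\<And>l. l < m \<Longrightarrow> a l \<in> carrier R"
    and ab: "\<And>l. l < m \<Longrightarrow> annih_principal_near M (a l) (b l)"
  shows "\<exists>t\<in>carrier R - M. \<forall>l<m. \<forall>x\<in>annih (a l). t \<otimes> x \<in> PIdl (b l)"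
proof -
  have "\<exists>t\<in>carrier R - M. \<forall>l\<in>{..<m}. \<forall>x\<in>annih (a l). t \<otimes> x \<in> PIdl (b l)"
  proof (rule common_multiplier[OF primeideal_maximal[OF M]])
    show "\<exists>t\<in>carrier R - M. \<forall>x\<in>annih (a l). t \<otimes> x \<in> PIdl (b l)" if "l \<in> {..<m}" for l
      using ab[of l] that by (auto simp: annih_principal_near_def)
    fix l t u assume h: "l \<in> {..<m}" "t \<in> carrier R" "u \<in> carrier R" "\<forall>x\<in>annih (a l). t \<otimes> x \<in> PIdl (b l)"
    have b: "b l \<in> carrier R" using ab[of l] h by (auto simp: annih_principal_near_def annih_def)
    show "\<forall>x\<in>annih (a l). u \<otimes> t \<otimes> x \<in> PIdl (b l)"
    proof
      fix x assume x: "x \<in> annih (a l)"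
      have "u \<otimes> (t \<otimes> x) \<in> PIdl (b l)" using ideal.I_l_closed[OF cgenideal_ideal[OF b]] h x by blast
      then show "u \<otimes> t \<otimes> x \<in> PIdl (b l)" using h x by (simp add: m_assoc annih_def)
    qed
  qed simp
  then show ?thesis by blast
qed

text \<open>In the coordinates \<open>\<phi>\<close> the kernel of \<open>A\<close> is the product
  of the annihilators of the \<open>a l\<close>, each generated near \<open>M\<close> by some
  \<open>b l\<close>. Hence \<open>B\<close> factors, up to multipliers, as the map
  \<open>\<Gamma>\<close> followed by the diagonal matrix of the \<open>b l\<close>. The generators
  of its kernel are of two kinds: corrections coming from a lift \<open>\<Delta>\<close> of that
  diagonal map through \<open>B\<close>, and lifts of the annihilators of the
  \<open>b l\<close>.\<close>

lemma syzygy_finitely_generated_near: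
  assumes M: "maximalideal M R" and A: "A \<in> mod_hom R (V m) (V k)" and B: "B \<in> mod_hom R (V p) (V m)"
    and exact: "B ` carrier (V p) = {x \<in> carrier (V m). A x = (\<lambda>i. \<zero>)}"
  shows "\<exists>s\<in>carrier R - M. \<exists>G. finite G \<and> G \<subseteq> {z \<in> carrier (V p). B z = (\<lambda>i. \<zero>)}
    \<and> (\<forall>z\<in>{z \<in> carrier (V p). B z = (\<lambda>i. \<zero>)}. s \<odot>\<^bsub>V p\<^esub> z \<in> mspan R (V p) G)"
proof -
  note PM = primeideal_maximal[OF M]
  define AA where "AA = (\<lambda>i l. A (unit_vec l) i)"
  have AAc: "AA i l \<in> carrier R" if "l \<in> {..<m}" for i l
    using freemod_coord[OF mod_homD(1)[OF A, of "unit_vec l"]] that by (simp add: AA_def)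
  have Aker: "A x = (\<lambda>i. \<zero>) \<longleftrightarrow> (\<forall>i\<in>{..<k}. dot {..<m} (AA i) x = \<zero>)" if x: "x \<in> carrier (V m)" for x
  proof -
    have "A x i = dot {..<m} (AA i) x" for i unfolding AA_def by (rule hom_coord[OF A x])
    moreover have "A x i = \<zero>" if "i \<ge> k" for i
      using mod_homD(1)[OF A x] that by (simp add: freemod_carrier)
    ultimately show ?thesis by (metis lessThan_iff linorder_not_le)
  qed
  obtain s \<phi> \<psi> a where s: "s \<in> carrier R - M" and kd: "kernel_diag m {..<k} {..<m} AA s \<phi> \<psi> a"
    using near_diagonal[OF PM, of "{..<k}" "{..<m}" m AA] AAc by blast
  note kd = kernel_diagD[OF kd]
  note \<phi> = kd(1) and \<psi> = kd(2)
  have sc: "s \<in> carrier R" using s by simp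
  have k1: "a l \<otimes> \<phi> (B z) l = \<zero>" if "z \<in> carrier (V p)" "l < m" for z l
    using kd(8)[of "B z" l] Aker[of "B z"] exact mod_homD(1)[OF B that(1)] that by blast
  have k2: "\<exists>w\<in>carrier (V p). B w = \<psi> y" if "y \<in> carrier (V m)" "\<And>l. l < m \<Longrightarrow> a l \<otimes> y l = \<zero>" for y
  proof -
    have "\<psi> y \<in> {x \<in> carrier (V m). A x = (\<lambda>i. \<zero>)}"
      using kd(9)[OF that(1)] that mod_homD(1)[OF \<psi> that(1)] Aker by auto
    then show ?thesis using exact by (metis (no_types, lifting) imageE)
  qed
  define spike where "spike x l = (\<lambda>i. x \<otimes> unit_vec l i)" for x :: 'a and l :: nat
  have spike: "spike x l \<in> carrier (V m)" if "x \<in> carrier R" "l < m" for x l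
    using that unit_vec_carrier[of l m] by (auto simp: spike_def freemod_carrier)
  have spike_ann: "\<exists>w\<in>carrier (V p). B w = \<psi> (spike x l)" if "x \<in> annih (a l)" "l < m" for x l
    using that kd(3) by (intro k2 spike) (auto simp: annih_def spike_def unit_vec_def)
  have \<phi>B: "(\<lambda>z. \<phi> (B z)) \<in> mod_hom R (V p) (V m)" by (rule mod_hom_comp[OF B \<phi>])
  \<comment> \<open>Exactness enters here: the kernel of \<open>A\<close> is the image of
    \<open>B\<close>, so the \<open>l\<close>-th coordinates of the images of the unit vectors
    generate the annihilator of \<open>a l\<close> up to \<open>s\<close>.\<close>
  have near1: "\<exists>b. annih_principal_near M (a l) b" if l: "l < m" for l
  proof -
    define X where "X = (\<lambda>j. \<phi> (B (unit_vec j)) l) ` {..<p}"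
    have Xc: "\<phi> (B (unit_vec j)) l \<in> carrier R" if "j < p" for j
      using freemod_coord[OF mod_homD(1)[OF \<phi>B]] that by simp
    have X: "X \<subseteq> annih (a l)" using k1[OF _ l] Xc by (auto simp: X_def annih_def)
    have XI: "ideal (Idl X) R" "X \<subseteq> Idl X" using Xc by (auto simp: X_def intro!: genideal_ideal genideal_self)
    show ?thesis
    proof (rule annih_principal_near_gens[OF M kd(3) _ X])
      fix x assume x: "x \<in> annih (a l)"
      obtain w where w: "w \<in> carrier (V p)" "B w = \<psi> (spike x l)" using spike_ann[OF x l] by blast
      have xc: "x \<in> carrier R" using x by (simp add: annih_def)
      have "s \<otimes> x = \<phi> (B w) l" using kd(4)[OF spike[OF xc l]] w xc by (simp add: spike_def unit_vec_def)
      also have "\<dots> = dot {..<p} (\<lambda>j. \<phi> (B (unit_vec j)) l) w" by (rule hom_coord[OF \<phi>B w(1)])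
      also have "\<dots> \<in> Idl X" using XI w by (intro dot_in_ideal) (auto simp: X_def)
      finally show "\<exists>s\<in>carrier R - M. s \<otimes> x \<in> Idl X" using s by blast
    qed (simp add: X_def)
  qed
  then have near2: "\<exists>b b'. annih_principal_near M (a l) b \<and> annih_principal_near M b b'" if "l < m" for l
    using annih_principal_near_generator[OF M kd(3)] that by blast
  then obtain b b' where bb: "\<And>l. l < m \<Longrightarrow> annih_principal_near M (a l) (b l)"
    "\<And>l. l < m \<Longrightarrow> annih_principal_near M (b l) (b' l)" by metis
  have b: "b l \<in> carrier R" "a l \<otimes> b l = \<zero>" "b l \<in> annih (a l)" if "l < m" for l
    using bb(1)[OF that] by (auto simp: annih_principal_near_def annih_def)
  have b': "b' l \<in> carrier R" "b l \<otimes> b' l = \<zero>" if "l < m" for l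
    using bb(2)[OF that] by (auto simp: annih_principal_near_def annih_def)
  obtain t where t: "t \<in> carrier R - M" "\<And>l x. l < m \<Longrightarrow> x \<in> annih (a l) \<Longrightarrow> t \<otimes> x \<in> PIdl (b l)"
    using annih_common_multiplier[of M m a b, OF M kd(3) bb(1)] by blast
  obtain e where e: "e \<in> carrier R - M" "\<And>l x. l < m \<Longrightarrow> x \<in> annih (b l) \<Longrightarrow> e \<otimes> x \<in> PIdl (b' l)"
    using annih_common_multiplier[of M m b b', OF M b(1) bb(2)] by blast
  have tc: "t \<in> carrier R" and ec: "e \<in> carrier R" using t e by auto
  have "\<exists>c\<in>carrier R. t \<otimes> \<phi> (B (unit_vec j)) l = c \<otimes> b l" if "j < p" "l < m" for j l
  proof -
    have "\<phi> (B (unit_vec j)) l \<in> annih (a l)"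
      using k1[of "unit_vec j" l] freemod_coord[OF mod_homD(1)[OF \<phi>B]] that by (simp add: annih_def)
    then show ?thesis using t(2)[OF that(2)] by (auto simp: mem_PIdl)
  qed
  then obtain c where c: "\<And>j l. j < p \<Longrightarrow> l < m \<Longrightarrow> c j l \<in> carrier R"
    "\<And>j l. j < p \<Longrightarrow> l < m \<Longrightarrow> t \<otimes> \<phi> (B (unit_vec j)) l = c j l \<otimes> b l" by metis
  define cc where "cc j = (\<lambda>l. if l < m then c j l else \<zero>)" for j
  have cc: "cc j \<in> carrier (V m)" if "j < p" for j using c(1)[OF that] by (auto simp: cc_def freemod_carrier)
  \<comment> \<open>Dividing \<open>\<phi> \<circ> B\<close> coordinatewise by \<open>b l\<close>,
    after multiplication by \<open>t\<close>; the quotients are chosen on unit vectors only, which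
    makes the result linear.\<close>
  define \<Gamma> where "\<Gamma> = lincomb (V m) p cc"
  have \<Gamma>: "\<Gamma> \<in> mod_hom R (V p) (V m)" unfolding \<Gamma>_def by (rule lincomb_hom[OF freemod_module cc])
  have \<Gamma>e: "\<Gamma> (unit_vec j) = cc j" if "j < p" for j
    unfolding \<Gamma>_def using lincomb_unit_vec[OF freemod_module cc that] .
  define \<mu> where "\<mu> = (\<lambda>x l. if l < m then b l \<otimes> x l else \<zero>)"
  have \<mu>: "\<mu> \<in> mod_hom R (V m) (V m)" unfolding \<mu>_def using b by (intro diag_hom)
  have claim1: "\<mu> (\<Gamma> z) = (\<lambda>l. t \<otimes> \<phi> (B z) l)" if z: "z \<in> carrier (V p)" for z
  proof (rule hom_eqI[OF freemod_module mod_hom_comp[OF \<Gamma> \<mu>] mod_hom_comp[OF \<phi>B scale_hom[OF tc]] _ z])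
    fix j assume j: "j < p"
    have "\<phi> (B (unit_vec j)) \<in> carrier (V m)" using mod_homD(1)[OF \<phi>B] j by simp
    then have "\<phi> (B (unit_vec j)) l = \<zero>" if "\<not> l < m" for l using that by (simp add: freemod_carrier)
    then show "\<mu> (\<Gamma> (unit_vec j)) = (\<lambda>l. t \<otimes> \<phi> (B (unit_vec j)) l)"
      using \<Gamma>e[OF j] c[OF j] b tc by (auto simp: \<mu>_def cc_def fun_eq_iff m_comm)
  qed
  \<comment> \<open>The vector with single entry \<open>b l\<close> satisfies the diagonal
    equations, so its image under \<open>\<psi>\<close> lies in the kernel of \<open>A\<close> and
    has a preimage under \<open>B\<close>.\<close>
  have "\<forall>l\<in>{..<m}. \<exists>w\<in>carrier (V p). B w = \<psi> (spike (b l) l)" using spike_ann b(3) by blast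
  then obtain d where d: "\<And>l. l < m \<Longrightarrow> d l \<in> carrier (V p)" "\<And>l. l < m \<Longrightarrow> B (d l) = \<psi> (spike (b l) l)"
    by (metis lessThan_iff)
  define \<Delta> where "\<Delta> = lincomb (V p) m d"
  have \<Delta>: "\<Delta> \<in> mod_hom R (V m) (V p)" unfolding \<Delta>_def by (rule lincomb_hom[OF freemod_module d(1)])
  have \<Delta>e: "\<Delta> (unit_vec l) = d l" if "l < m" for l
    unfolding \<Delta>_def using lincomb_unit_vec[OF freemod_module d(1) that] .
  have claim2: "B (\<Delta> y) = \<psi> (\<mu> y)" if y: "y \<in> carrier (V m)" for y
  proof (rule hom_eqI[OF freemod_module mod_hom_comp[OF \<Delta> B] mod_hom_comp[OF \<mu> \<psi>] _ y])
    fix l assume l: "l < m"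
    have "\<mu> (unit_vec l) = spike (b l) l" using l b by (auto simp: \<mu>_def spike_def unit_vec_def fun_eq_iff)
    then show "B (\<Delta> (unit_vec l)) = \<psi> (\<mu> (unit_vec l))" using \<Delta>e[OF l] d(2)[OF l] by simp
  qed
  \<comment> \<open>Applying \<open>B\<close> to \<open>\<Delta> (\<Gamma> z)\<close> gives
    \<open>s \<otimes> t\<close> times \<open>B z\<close>: the factor \<open>t\<close> comes from
    the division defining \<open>\<Gamma>\<close>, the factor \<open>s\<close> from composing
    \<open>\<psi>\<close> with \<open>\<phi>\<close>. So \<open>h\<close> maps into the kernel of
    \<open>B\<close>.\<close>
  define h where "h = (\<lambda>z l. s \<otimes> t \<otimes> z l \<ominus> \<Delta> (\<Gamma> z) l)"
  have stc: "s \<otimes> t \<in> carrier R" using sc tc by simp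
  have h: "h \<in> mod_hom R (V p) (V p)"
    unfolding h_def by (rule diff_hom[OF scale_hom[OF stc] mod_hom_comp[OF \<Gamma> \<Delta>]])
  have split: "(\<lambda>l. s \<otimes> t \<otimes> z l) = h z \<oplus>\<^bsub>V p\<^esub> \<Delta> (\<Gamma> z)" if z: "z \<in> carrier (V p)" for z
  proof -
    have "u = (u \<ominus> v) \<oplus> v" if "u \<in> carrier R" "v \<in> carrier R" for u v using that by algebra
    then show ?thesis
      using freemod_coord[OF z] freemod_coord[OF mod_homD(1)[OF mod_hom_comp[OF \<Gamma> \<Delta>] z]] stc
      by (auto simp: h_def fun_eq_iff simp del: m_assoc)
  qed
  have claim3: "B (h z) = (\<lambda>i. \<zero>)" if z: "z \<in> carrier (V p)" for z
  proof -
    note Bz = mod_homD(1)[OF B z]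
    have "B (\<Delta> (\<Gamma> z)) = \<psi> (\<lambda>l. t \<otimes> \<phi> (B z) l)" using claim1[OF z] claim2[OF mod_homD(1)[OF \<Gamma> z]] by simp
    also have "\<dots> = (\<lambda>l. t \<otimes> \<psi> (\<phi> (B z)) l)" by (rule hom_apply_scaled[OF \<psi> tc mod_homD(1)[OF \<phi>B z]])
    also have "\<dots> = (\<lambda>l. s \<otimes> t \<otimes> B z l)" using kd(5)[OF Bz] sc tc freemod_coord[OF Bz] by (simp add: m_ac)
    also have "\<dots> = B (\<lambda>l. s \<otimes> t \<otimes> z l)" by (rule hom_apply_scaled[OF B stc z, symmetric])
    also have "\<dots> = B (h z) \<oplus>\<^bsub>V m\<^esub> B (\<Delta> (\<Gamma> z))"
      unfolding split[OF z]
      by (rule mod_homD(2)[OF B mod_homD(1)[OF h z] mod_homD(1)[OF mod_hom_comp[OF \<Gamma> \<Delta>] z]])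
    finally have eq: "B (\<Delta> (\<Gamma> z)) l = B (h z) l \<oplus> B (\<Delta> (\<Gamma> z)) l" for l by (simp add: fun_eq_iff)
    have c1: "B (h z) l \<in> carrier R" "B (\<Delta> (\<Gamma> z)) l \<in> carrier R" for l
      using mod_homD(1)[OF mod_hom_comp[OF h B] z] mod_homD(1)[OF mod_hom_comp[OF mod_hom_comp[OF \<Gamma> \<Delta>] B] z] by auto
    have "B (h z) l = \<zero>" for l
      using eq[of l] c1[of l] by (metis add.r_cancel_one')
    then show ?thesis by auto
  qed
  define K where "K = {z \<in> carrier (V p). B z = (\<lambda>i. \<zero>)}"
  define G where "G = (\<lambda>j. h (unit_vec j)) ` {..<p} \<union> (\<lambda>l. (\<lambda>i. b' l \<otimes> d l i)) ` {..<m}"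
  interpret Vp: Module.module R "V p" by (rule freemod_module)
  have GK: "G \<subseteq> K"
  proof -
    have "h (unit_vec j) \<in> K" if "j < p" for j
      using claim3[of "unit_vec j"] mod_homD(1)[OF h, of "unit_vec j"] that by (simp add: K_def)
    moreover have "(\<lambda>i. b' l \<otimes> d l i) \<in> K" if l: "l < m" for l
    proof -
      have "B (\<lambda>i. b' l \<otimes> d l i) = (\<lambda>i. b' l \<otimes> \<psi> (spike (b l) l) i)"
        using hom_apply_scaled[OF B b'(1)[OF l] d(1)[OF l]] d(2)[OF l] by simp
      also have "\<dots> = \<psi> (\<lambda>i. b' l \<otimes> spike (b l) l i)"
        by (rule hom_apply_scaled[OF \<psi> b'(1)[OF l] spike[OF b(1)[OF l] l], symmetric])
      also have "(\<lambda>i. b' l \<otimes> spike (b l) l i) = (\<lambda>i. \<zero>)"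
        using b'[OF l] b(1)[OF l] by (auto simp: spike_def unit_vec_def fun_eq_iff m_comm)
      finally have "B (\<lambda>i. b' l \<otimes> d l i) = (\<lambda>i. \<zero>)" using hom_apply_zero[OF \<psi>] by simp
      then show ?thesis using Vp.smult_closed[OF b'(1)[OF l] d(1)[OF l]] by (simp add: K_def)
    qed
    ultimately show ?thesis by (auto simp: G_def)
  qed
  have Gc: "G \<subseteq> carrier (V p)" using GK by (auto simp: K_def)
  define S where "S = e \<otimes> (s \<otimes> t)"
  have S: "S \<in> carrier R - M" unfolding S_def by (intro primeideal_mult_notin[OF PM] s t e)
  have "S \<odot>\<^bsub>V p\<^esub> z \<in> mspan R (V p) G" if zK: "z \<in> K" for z
  proof -
    have z: "z \<in> carrier (V p)" and Bz: "B z = (\<lambda>i. \<zero>)" using zK by (auto simp: K_def)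
    note \<Gamma>z = mod_homD(1)[OF \<Gamma> z]
    \<comment> \<open>For \<open>z\<close> in the kernel of \<open>B\<close>, each coordinate of
      \<open>\<Gamma> z\<close> is killed by \<open>b l\<close>, so it is a multiple of
      \<open>b' l\<close> up to \<open>e\<close>. This is where the second annihilator is
      needed.\<close>
    have "\<exists>\<rho>\<in>carrier R. e \<otimes> \<Gamma> z l = \<rho> \<otimes> b' l" if l: "l < m" for l
    proof -
      have "b l \<otimes> \<Gamma> z l = t \<otimes> \<phi> (B z) l" using fun_cong[OF claim1[OF z], of l] l by (simp add: \<mu>_def)
      also have "\<dots> = \<zero>" using Bz hom_apply_zero[OF \<phi>] tc by simp
      finally have "\<Gamma> z l \<in> annih (b l)" using \<Gamma>z by (simp add: annih_def)
      then show ?thesis using e(2)[OF l] by (auto simp: mem_PIdl)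
    qed
    then obtain \<rho> where \<rho>: "\<And>l. l < m \<Longrightarrow> \<rho> l \<in> carrier R" "\<And>l. l < m \<Longrightarrow> e \<otimes> \<Gamma> z l = \<rho> l \<otimes> b' l" by metis
    have "h z \<in> mspan R (V p) ((\<lambda>j. h (unit_vec j)) ` {..<p})" by (rule hom_in_mspan[OF freemod_module h z])
    then have hz: "h z \<in> mspan R (V p) G" by (rule mspan_mono[rotated]) (auto simp: G_def)
    have "\<Delta> (\<lambda>l. e \<otimes> \<Gamma> z l) \<in> mspan R (V p) G"
      unfolding \<Delta>_def lincomb_def
    proof (rule finsum_mspan[OF freemod_module Gc])
      fix l assume "l \<in> {..<m}"
      then have l: "l < m" by simp
      have "(e \<otimes> \<Gamma> z l) \<odot>\<^bsub>V p\<^esub> d l = \<rho> l \<odot>\<^bsub>V p\<^esub> (\<lambda>i. b' l \<otimes> d l i)"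
        using \<rho>[OF l] b'[OF l] freemod_coord[OF d(1)[OF l]] by (simp add: m_assoc)
      also have "\<dots> \<in> mspan R (V p) G" using l \<rho> by (intro mspan.smult mspan.gen) (auto simp: G_def)
      finally show "(e \<otimes> \<Gamma> z l) \<odot>\<^bsub>V p\<^esub> d l \<in> mspan R (V p) G" .
    qed simp
    then have 2: "e \<odot>\<^bsub>V p\<^esub> \<Delta> (\<Gamma> z) \<in> mspan R (V p) G" using hom_apply_scaled[OF \<Delta> ec \<Gamma>z] by simp
    have "S \<odot>\<^bsub>V p\<^esub> z = e \<odot>\<^bsub>V p\<^esub> (\<lambda>l. s \<otimes> t \<otimes> z l)"
      using freemod_coord[OF z] ec sc tc by (simp add: S_def m_assoc)
    also have "\<dots> = e \<odot>\<^bsub>V p\<^esub> h z \<oplus>\<^bsub>V p\<^esub> e \<odot>\<^bsub>V p\<^esub> \<Delta> (\<Gamma> z)"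
      unfolding split[OF z]
      by (rule Vp.smult_r_distr[OF ec mod_homD(1)[OF h z] mod_homD(1)[OF mod_hom_comp[OF \<Gamma> \<Delta>] z]])
    also have "\<dots> \<in> mspan R (V p) G" by (rule mspan.add[OF mspan.smult[OF ec hz] 2])
    finally show ?thesis .
  qed
  moreover have "finite G" by (simp add: G_def)
  ultimately show ?thesis using S GK unfolding K_def by blast
qed

end

section \<open>Free resolutions and coherence\<close>

context plain_cring
begin

definition resolution ::
  "('a, 'b) module \<Rightarrow> nat \<Rightarrow> (nat \<Rightarrow> nat) \<Rightarrow> ((nat \<Rightarrow> 'a) \<Rightarrow> 'b) \<Rightarrow> (nat \<Rightarrow> (nat \<Rightarrow> 'a) \<Rightarrow> nat \<Rightarrow> 'a) \<Rightarrow> bool" where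
  "resolution E n k d0 d \<longleftrightarrow>
     d0 \<in> mod_hom R (V (k 0)) E
     \<and> d0 ` carrier (V (k 0)) = carrier E
     \<and> (\<forall>i. 1 \<le> i \<and> i \<le> n \<longrightarrow> d i \<in> mod_hom R (V (k i)) (V (k (i - 1))))
     \<and> (1 \<le> n \<longrightarrow> d 1 ` carrier (V (k 1)) = {v \<in> carrier (V (k 0)). d0 v = \<zero>\<^bsub>E\<^esub>})
     \<and> (\<forall>i. 1 \<le> i \<and> i < n \<longrightarrow> d (Suc i) ` carrier (V (k (Suc i)))
            = {v \<in> carrier (V (k i)). d i v = \<zero>\<^bsub>V (k (i - 1))\<^esub>})"

lemma free_res_iff: "free_res R E n \<longleftrightarrow> (\<exists>k d0 d. resolution E n k d0 d)"
  by (simp only: free_res_def resolution_def)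

lemma resolutionD:
  assumes "resolution E n k d0 d"
  shows "d0 \<in> mod_hom R (V (k 0)) E" "d0 ` carrier (V (k 0)) = carrier E"
    "1 \<le> i \<Longrightarrow> i \<le> n \<Longrightarrow> d i \<in> mod_hom R (V (k i)) (V (k (i - 1)))"
    "1 \<le> n \<Longrightarrow> d 1 ` carrier (V (k 1)) = {v \<in> carrier (V (k 0)). d0 v = \<zero>\<^bsub>E\<^esub>}"
    "1 \<le> i \<Longrightarrow> i < n \<Longrightarrow>
      d (Suc i) ` carrier (V (k (Suc i))) = {v \<in> carrier (V (k i)). d i v = \<zero>\<^bsub>V (k (i - 1))\<^esub>}"
  using assms unfolding resolution_def by simp_all

lemma free_res_oneI:
  assumes "d0 \<in> mod_hom R (V p) N" "d0 ` carrier (V p) = carrier N"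
    and "h \<in> mod_hom R (V q) (V p)" "h ` carrier (V q) = {v \<in> carrier (V p). d0 v = \<zero>\<^bsub>N\<^esub>}"
  shows "free_res R N 1"
proof -
  have "resolution N 1 (\<lambda>i. if i = 0 then p else q) d0 (\<lambda>_. h)"
    using assms by (auto simp: resolution_def)
  then show ?thesis unfolding free_res_iff by blast
qed

lemma free_res_le:
  assumes "free_res R E n" "m \<le> n" shows "free_res R E m"
proof -
  obtain k d0 d where "resolution E n k d0 d" using assms(1) unfolding free_res_iff by blast
  then have "resolution E m k d0 d" using assms(2) by (auto simp: resolution_def)
  then show ?thesis unfolding free_res_iff by blast
qed

section \<open>Coherence and annihilators of single elements\<close>

lemma ideal_module_simps [simp]:
  "carrier (ideal_module R I) = I" "\<zero>\<^bsub>ideal_module R I\<^esub> = \<zero>" "x \<oplus>\<^bsub>ideal_module R I\<^esub> y = x \<oplus> y"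
  "a \<odot>\<^bsub>ideal_module R I\<^esub> x = a \<otimes> x"
  by (auto simp: ideal_module_def)

lemma ideal_module_hom_dot:
  assumes I: "ideal I R" and f: "f \<in> mod_hom R (V p) (ideal_module R I)" and z: "z \<in> carrier (V p)"
  shows "f z = dot {..<p} (\<lambda>l. f (unit_vec l)) z"
proof -
  have "(\<lambda>x i. if i = 0 then f x else \<zero>) \<in> mod_hom R (V p) (V 1)"
    using mod_homD[OF f] ideal.Icarr[OF I]
    by (intro mod_homI) (auto simp: freemod_carrier fun_eq_iff)
  from hom_coord[OF this z, of 0] show ?thesis by simp
qed

text \<open>The given presentation of the ideal generated by \<open>a\<close> may use other
  generators \<open>c l \<otimes> a\<close>. Passing to the single generator \<open>a\<close>, as in
  Schanuel's lemma, turns its relations into annihilators \<open>g j\<close> and adds one relation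
  \<open>u\<close>, which expresses \<open>a\<close> through the other generators.\<close>

lemma coherent_annih_finitely_generated:
  assumes "coherent R" and a: "a \<in> carrier R"
  shows "\<exists>X. finite X \<and> X \<subseteq> annih a \<and> annih a \<subseteq> Idl X"
proof -
  define I where "I = Idl {a}"
  have I: "ideal I R" using a by (simp add: I_def genideal_ideal)
  have IP: "I = PIdl a" using a by (simp add: I_def cgenideal_eq_genideal)
  have "fin_presented R (ideal_module R I)"
    using assms I unfolding coherent_def I_def by blast
  then have "free_res R (ideal_module R I) 1" by (simp add: fin_presented_def)
  then obtain k d0 d where res: "resolution (ideal_module R I) 1 k d0 d" unfolding free_res_iff by blast
  have d0: "d0 \<in> mod_hom R (V (k 0)) (ideal_module R I)" "d0 ` carrier (V (k 0)) = I"
    and d: "d 1 \<in> mod_hom R (V (k 1)) (V (k 0))"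
      "d 1 ` carrier (V (k 1)) = {v \<in> carrier (V (k 0)). d0 v = \<zero>}"
    using resolutionD(1,2)[OF res] resolutionD(3)[OF res, of 1] resolutionD(4)[OF res] by simp_all
  define p where "p = k 0"
  define q where "q = k 1"
  define h where "h = d (1::nat)"
  note d0 = d0[folded p_def] and h = d[folded p_def q_def h_def]
  have "d0 (unit_vec l) \<in> PIdl a" if "l < p" for l
    using mod_homD(1)[OF d0(1), of "unit_vec l"] that IP by simp
  then have "\<forall>l\<in>{..<p}. \<exists>c\<in>carrier R. d0 (unit_vec l) = c \<otimes> a" by (simp add: mem_PIdl)
  then obtain c where c: "\<And>l. l < p \<Longrightarrow> c l \<in> carrier R" "\<And>l. l < p \<Longrightarrow> d0 (unit_vec l) = c l \<otimes> a"
    by (metis lessThan_iff)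
  have dc: "dot {..<p} c z \<in> carrier R" if "z \<in> carrier (V p)" for z using c that by auto
  have d0z: "d0 z = a \<otimes> dot {..<p} c z" if z: "z \<in> carrier (V p)" for z
  proof -
    have "d0 z = dot {..<p} (\<lambda>l. d0 (unit_vec l)) z" by (rule ideal_module_hom_dot[OF I d0(1) z])
    also have "\<dots> = dot {..<p} c (\<lambda>l. a \<otimes> z l)"
      using c a freemod_coord[OF z] by (intro dot_cong) (auto simp: m_assoc)
    also have "\<dots> = a \<otimes> dot {..<p} c z" using c a freemod_coord[OF z] by (intro dot_scale) auto
    finally show ?thesis .
  qed
  have "a \<in> I" using IP cgenideal_self[OF a] by simp
  then obtain w where w: "w \<in> carrier (V p)" "d0 w = a" using d0(2) by force
  \<comment> \<open>Writing \<open>a\<close> as \<open>d0 w\<close> gives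
    \<open>a = a \<otimes> dot {..<p} c w\<close>. For \<open>y\<close> killing \<open>a\<close>,
    the summand \<open>y \<otimes> u\<close> is a multiple of \<open>u\<close>, and the rest comes
    from \<open>y\<close> times \<open>w\<close>, a relation among the given generators.\<close>
  define u where "u = \<one> \<ominus> dot {..<p} c w"
  have uc: "u \<in> carrier R" using dc[OF w(1)] by (simp add: u_def)
  have "a \<otimes> u = a \<ominus> a \<otimes> dot {..<p} c w" unfolding u_def using a dc[OF w(1)] by algebra
  also have "\<dots> = \<zero>" using d0z[OF w(1)] w(2) a by (simp add: a_minus_def r_neg)
  finally have u: "u \<in> annih a" using uc by (simp add: annih_def)
  define g where "g j = dot {..<p} c (h (unit_vec j))" for j
  have g: "g j \<in> annih a" if "j < q" for j
  proof -
    have "h (unit_vec j) \<in> {v \<in> carrier (V p). d0 v = \<zero>}" using h(2) that by force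
    then show ?thesis using d0z dc by (auto simp: g_def annih_def)
  qed
  define X where "X = insert u (g ` {..<q})"
  have X: "finite X" "X \<subseteq> annih a" using u g by (auto simp: X_def)
  have Xc: "X \<subseteq> carrier R" using X by (auto simp: annih_def)
  note IX = genideal_ideal[OF Xc]
  have "y \<in> Idl X" if y: "y \<in> annih a" for y
  proof -
    have yc: "y \<in> carrier R" "a \<otimes> y = \<zero>" using y by (auto simp: annih_def)
    have yw: "(\<lambda>l. y \<otimes> w l) \<in> carrier (V p)" using w yc by (auto simp: freemod_carrier)
    have dyw: "dot {..<p} c (\<lambda>l. y \<otimes> w l) = y \<otimes> dot {..<p} c w"
      using c yc freemod_coord[OF w(1)] by (intro dot_scale) auto
    have "d0 (\<lambda>l. y \<otimes> w l) = y \<otimes> d0 w" using mod_homD(3)[OF d0(1) yc(1) w(1)] by simp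
    then have "d0 (\<lambda>l. y \<otimes> w l) = \<zero>" using w yc a by (simp add: m_comm)
    then have "(\<lambda>l. y \<otimes> w l) \<in> h ` carrier (V q)" unfolding h(2) using yw by simp
    then obtain v where v: "v \<in> carrier (V q)" "h v = (\<lambda>l. y \<otimes> w l)" by (metis imageE)
    have "dot {..<p} c (h v) = dot {..<q} g v"
      using hom_coord[OF mod_hom_comp[OF h(1) dot_hom[where c = c, OF c(1)]] v(1), where i = 0] by (simp add: g_def[abs_def])
    moreover have "dot {..<q} g v \<in> Idl X"
      using genideal_self[OF Xc] v(1) by (intro dot_in_ideal[OF IX]) (auto simp: X_def)
    ultimately have "y \<otimes> dot {..<p} c w \<in> Idl X" using v dyw by simp
    moreover have "y \<otimes> u \<in> Idl X"
      using genideal_self[OF Xc] yc by (intro ideal.I_l_closed[OF IX]) (auto simp: X_def)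
    moreover have "y = y \<otimes> u \<oplus> y \<otimes> dot {..<p} c w"
      unfolding u_def using yc(1) dc[OF w(1)] by algebra
    ultimately show ?thesis using ideal_add_closed[OF IX] by metis
  qed
  then show ?thesis using X by blast
qed

text \<open>Multiplication by \<open>b\<close> followed by multiplication by \<open>x\<close>
  presents the ideal with two free modules of rank one.\<close>

lemma coherent_if_principal:
  assumes prin: "\<And>S. \<lbrakk>finite S; S \<subseteq> carrier R\<rbrakk> \<Longrightarrow> \<exists>x\<in>carrier R. Idl S = PIdl x"
    and ann: "\<And>x. x \<in> carrier R \<Longrightarrow> \<exists>b\<in>annih x. annih x \<subseteq> PIdl b"
  shows "coherent R"
  unfolding coherent_def fin_presented_def
proof (intro allI impI)
  fix I assume "ideal I R \<and> (\<exists>S. finite S \<and> S \<subseteq> carrier R \<and> I = Idl S)"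
  then obtain S where "finite S" "S \<subseteq> carrier R" "I = Idl S" by blast
  then obtain x where x: "x \<in> carrier R" "I = PIdl x" using prin by blast
  obtain b where b: "b \<in> annih x" "annih x \<subseteq> PIdl b" using ann[OF x(1)] by auto
  have bc: "b \<in> carrier R" "x \<otimes> b = \<zero>" using b by (auto simp: annih_def)
  define d0 where "d0 = (\<lambda>v::nat \<Rightarrow> 'a. v 0 \<otimes> x)"
  define h where "h = (\<lambda>(v::nat \<Rightarrow> 'a) i::nat. if i = 0 then v 0 \<otimes> b else \<zero>)"
  have single: "(\<lambda>i. if i = 0 then r else \<zero>) \<in> carrier (V 1)" if "r \<in> carrier R" for r
    using that by (auto simp: freemod_carrier)
  show "free_res R (ideal_module R I) 1"
  proof (rule free_res_oneI)
    show "d0 \<in> mod_hom R (V 1) (ideal_module R I)"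
    proof (rule mod_homI)
      fix u v a assume u: "u \<in> carrier (V 1)"
      then show "d0 u \<in> carrier (ideal_module R I)"
        using x PIdl_mult_mem[of x "u 0"] freemod_coord[OF u] by (simp add: d0_def)
      show "d0 (u \<oplus>\<^bsub>V 1\<^esub> v) = d0 u \<oplus>\<^bsub>ideal_module R I\<^esub> d0 v" if "v \<in> carrier (V 1)"
        using x freemod_coord[OF u] freemod_coord[OF that] by (simp add: d0_def l_distr)
      show "d0 (a \<odot>\<^bsub>V 1\<^esub> u) = a \<odot>\<^bsub>ideal_module R I\<^esub> d0 u" if "a \<in> carrier R"
        using x freemod_coord[OF u] that by (simp add: d0_def m_assoc)
    qed
    show "d0 ` carrier (V 1) = carrier (ideal_module R I)"
    proof
      show "d0 ` carrier (V 1) \<subseteq> carrier (ideal_module R I)"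
        using x PIdl_mult_mem[of x] freemod_coord by (auto simp: d0_def)
      show "carrier (ideal_module R I) \<subseteq> d0 ` carrier (V 1)"
      proof
        fix y assume "y \<in> carrier (ideal_module R I)"
        then obtain r where r: "r \<in> carrier R" "y = r \<otimes> x" using x by (auto simp: mem_PIdl)
        show "y \<in> d0 ` carrier (V 1)"
          by (rule image_eqI[OF _ single[OF r(1)]]) (simp add: d0_def r)
      qed
    qed
    show "h \<in> mod_hom R (V 1) (V 1)"
      using bc by (intro mod_homI) (auto simp: h_def freemod_carrier l_distr m_assoc fun_eq_iff)
    show "h ` carrier (V 1) = {v \<in> carrier (V 1). d0 v = \<zero>\<^bsub>ideal_module R I\<^esub>}"
    proof (intro subset_antisym subsetI)
      fix v assume "v \<in> h ` carrier (V 1)"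
      then obtain u where u: "u \<in> carrier (V 1)" "v = h u" by auto
      have "u 0 \<otimes> b \<otimes> x = u 0 \<otimes> (x \<otimes> b)" using freemod_coord[OF u(1), of 0] bc(1) x(1) by algebra
      then have "u 0 \<otimes> b \<otimes> x = \<zero>" using freemod_coord[OF u(1), of 0] bc by simp
      then show "v \<in> {v \<in> carrier (V 1). d0 v = \<zero>\<^bsub>ideal_module R I\<^esub>}"
        using u bc freemod_coord[OF u(1), of 0] by (auto simp: d0_def h_def freemod_carrier)
    next
      fix v assume v: "v \<in> {v \<in> carrier (V 1). d0 v = \<zero>\<^bsub>ideal_module R I\<^esub>}"
      then have vc: "v 0 \<in> carrier R" by (auto simp: freemod_coord)
      then have "v 0 \<in> annih x" using v x by (auto simp: d0_def annih_def m_comm)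
      then have "v 0 \<in> PIdl b" using b by blast
      then obtain r where r: "r \<in> carrier R" "v 0 = r \<otimes> b" by (auto simp: mem_PIdl)
      show "v \<in> h ` carrier (V 1)"
        by (rule image_eqI[OF _ single[OF r(1)]]) (use v r in \<open>auto simp: h_def freemod_carrier fun_eq_iff\<close>)
    qed
  qed
qed

end

section \<open>Extending resolutions, and coherence from local annihilators\<close>

context plain_comparison
begin

text \<open>The kernel of the last map is finitely generated near every maximal ideal, hence
  finitely generated; a free module mapping onto it is the next term.\<close>

lemma free_res_Suc:
  assumes fr: "free_res R E n" and n: "2 \<le> n"
  shows "free_res R E (Suc n)"
proof -
  obtain k d0 d where res: "resolution E n k d0 d" using fr unfolding free_res_iff by blast
  note d0 = resolutionD(1,2)[OF res] and d = resolutionD(3)[OF res] and e1 = resolutionD(4)[OF res]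
    and e = resolutionD(5)[OF res]
  \<comment> \<open>With \<open>n\<close> at least 2, the last two maps \<open>d (Suc j)\<close> and
    \<open>d n\<close> are both between free modules; for \<open>n = 1\<close> the earlier one would
    be the augmentation \<open>d0\<close>, whose target \<open>E\<close> is arbitrary.\<close>
  have "n = Suc (Suc (n - 2))" using n by arith
  then obtain j where j: "n = Suc (Suc j)" by blast
  define K where "K = {z \<in> carrier (V (k n)). d n z = (\<lambda>i. \<zero>)}"
  have jn: "1 \<le> Suc j" "Suc j \<le> n" "Suc j < n" "1 \<le> n" by (simp_all add: j)
  have A: "d (Suc j) \<in> mod_hom R (V (k (Suc j))) (V (k j))" using d[OF jn(1,2)] by simp
  have B: "d n \<in> mod_hom R (V (k n)) (V (k (Suc j)))" using d[OF jn(4) order_refl] by (simp add: j)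
  have ex: "d n ` carrier (V (k n)) = {x \<in> carrier (V (k (Suc j))). d (Suc j) x = (\<lambda>i. \<zero>)}"
    using e[OF jn(1,3)] by (simp add: j)
  have "\<exists>G. finite G \<and> G \<subseteq> K \<and> K \<subseteq> mspan R (V (k n)) G"
  proof (rule finitely_generated_local[OF freemod_module])
    show "\<exists>s\<in>carrier R - M. \<exists>G. finite G \<and> G \<subseteq> K
        \<and> (\<forall>z\<in>K. s \<odot>\<^bsub>V (k n)\<^esub> z \<in> mspan R (V (k n)) G)" if "maximalideal M R" for M
      unfolding K_def by (rule syzygy_finitely_generated_near[OF that A B ex])
  qed (auto simp: K_def)
  then obtain G where G: "finite G" "G \<subseteq> K" "K \<subseteq> mspan R (V (k n)) G" by blast
  have "G \<subseteq> carrier (V (k n))" using G by (auto simp: K_def)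
  then obtain q h where h: "h \<in> mod_hom R (V q) (V (k n))" "h ` carrier (V q) = mspan R (V (k n)) G"
    using mspan_hom_image[OF freemod_module G(1)] by metis
  have "mspan R (V (k n)) G \<subseteq> K"
  proof
    interpret W: Module.module R "V (k n)" by (rule freemod_module)
    have cl: "x \<oplus>\<^bsub>V (k n)\<^esub> y \<in> K" "a \<odot>\<^bsub>V (k n)\<^esub> x \<in> K" if "x \<in> K" "y \<in> K" "a \<in> carrier R" for x y a
    proof -
      have xy: "x \<in> carrier (V (k n))" "y \<in> carrier (V (k n))" "d n x = (\<lambda>i. \<zero>)" "d n y = (\<lambda>i. \<zero>)"
        using that by (auto simp: K_def)
      show "x \<oplus>\<^bsub>V (k n)\<^esub> y \<in> K"
        using mod_homD(2)[OF B xy(1,2)] W.add.m_closed[OF xy(1,2)] xy by (simp add: K_def)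
      show "a \<odot>\<^bsub>V (k n)\<^esub> x \<in> K"
        using mod_homD(3)[OF B that(3) xy(1)] W.smult_closed[OF that(3) xy(1)] xy that(3) by (simp add: K_def)
    qed
    fix x assume "x \<in> mspan R (V (k n)) G"
    then show "x \<in> K"
    proof induct
      case zero
      then show ?case using hom_apply_zero[OF B] W.zero_closed by (simp add: K_def)
    next
      case (gen g)
      then show ?case using G(2) by blast
    next
      case (add x y)
      then show ?case using cl(1)[of x y \<zero>] by blast
    next
      case (smult a x)
      then show ?case using cl(2)[of x x a] by blast
    qed
  qed
  then have hK: "h ` carrier (V q) = K" using h G by blast
  define k' where "k' = k(Suc n := q)"
  define d' where "d' = d(Suc n := h)"
  have "resolution E (Suc n) k' d0 d'"
    unfolding resolution_def
  proof (intro conjI allI impI)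
    fix i assume "1 \<le> i \<and> i \<le> Suc n"
    then show "d' i \<in> mod_hom R (V (k' i)) (V (k' (i - 1)))"
      using d[of i] h by (auto simp: k'_def d'_def le_Suc_eq)
  next
    fix i assume i: "1 \<le> i \<and> i < Suc n"
    then show "d' (Suc i) ` carrier (V (k' (Suc i))) = {v \<in> carrier (V (k' i)). d' i v = \<zero>\<^bsub>V (k' (i - 1))\<^esub>}"
      using e[of i] hK by (cases "i = n") (auto simp: k'_def d'_def K_def)
  qed (use d0 e1 n in \<open>auto simp: k'_def d'_def\<close>)
  then show ?thesis unfolding free_res_iff by blast
qed

lemma free_res_unbounded:
  assumes "free_res R E n" "2 \<le> n" shows "free_res R E m"
proof -
  have "free_res R E (n + i)" for i
  proof (induct i)
    case (Suc i)
    then show ?case using free_res_Suc[of E "n + i"] assms(2) by simp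
  qed (use assms in simp)
  then show ?thesis using free_res_le[of E "n + m" m] by simp
qed

lemma lambda_dim_le_two: "lambda_dim R TYPE('b) \<le> 2"
proof -
  define P where "P = (\<lambda>n::nat. \<forall>E :: ('a, 'b) module. Module.module R E \<longrightarrow>
      ereal (real n) \<le> lambda_mod R E \<longrightarrow> lambda_mod R E = \<infinity>)"
  have "P 2"
    unfolding P_def
  proof (intro allI impI)
    fix E :: "('a, 'b) module" assume le: "ereal (real 2) \<le> lambda_mod R E"
    have fg: "fin_gen R E" using le by (cases "fin_gen R E") (auto simp: lambda_mod_def one_ereal_def)
    let ?S = "{n. free_res R E n}"
    have lam: "lambda_mod R E = (SUP n\<in>?S. ereal (real n))" using fg by (simp add: lambda_mod_def)
    \<comment> \<open>The supremum need not be attained a priori, but if all resolutions had length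
      at most 1, it could not exceed 1.\<close>
    have "\<exists>n\<in>?S. 2 \<le> n"
    proof (rule ccontr)
      assume "\<not> ?thesis"
      then have "(SUP n\<in>?S. ereal (real n)) \<le> ereal 1" by (intro SUP_least) force
      then show False using le lam by (metis ereal_less_eq(3) numeral_le_one_iff of_nat_numeral order_trans semiring_norm(69))
    qed
    then have all: "m \<in> ?S" for m using free_res_unbounded by blast
    have "ereal (real m) \<le> lambda_mod R E" for m unfolding lam using all by (intro SUP_upper)
    then show "lambda_mod R E = \<infinity>"
      by (metis ereal_top less_le_not_le linorder_not_le of_nat_0_le_iff real_arch_simple ereal_less_eq(3) order_trans)
  qed
  then have "(LEAST n. P n) \<le> 2" by (rule Least_le)
  then have "enat (LEAST n. P n) \<le> enat 2" by simp
  then show ?thesis using \<open>P 2\<close> unfolding lambda_dim_def P_def[symmetric] Let_def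
    by (auto simp: numeral_eq_enat)
qed

text \<open>Relations among the generators of an ideal are the kernel of a matrix with a single row.
  Near \<open>M\<close> that kernel is a product of annihilators, each with one generator, and the
  local generators glue.\<close>

lemma coherent_if_annih_principal_near:
  assumes near: "\<And>M a. \<lbrakk>maximalideal M R; a \<in> carrier R\<rbrakk> \<Longrightarrow> \<exists>b. annih_principal_near M a b"
  shows "coherent R"
  unfolding coherent_def fin_presented_def
proof (intro allI impI)
  fix I assume "ideal I R \<and> (\<exists>S. finite S \<and> S \<subseteq> carrier R \<and> I = Idl S)"
  then obtain S where I: "ideal I R" and S: "finite S" "S \<subseteq> carrier R" "I = Idl S" by blast
  obtain rs where rs: "set rs = S" using finite_list[OF S(1)] by blast
  define n where "n = length rs"
  define r where "r = (\<lambda>l. rs ! l)"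
  have rS: "r ` {..<n} = S" using rs by (auto simp: r_def n_def image_iff in_set_conv_nth)
  have rI: "r l \<in> I" "r l \<in> carrier R" if "l < n" for l
    using that rS S genideal_self[OF S(2)] by auto
  define d0 where "d0 = (\<lambda>z. dot {..<n} r z)"
  have d0I: "d0 z \<in> I" if "z \<in> carrier (V n)" for z
    unfolding d0_def using that rI by (intro dot_in_ideal[OF I]) auto
  have d0: "d0 \<in> mod_hom R (V n) (ideal_module R I)"
  proof (rule mod_homI)
    fix x y a assume x: "x \<in> carrier (V n)"
    then show "d0 x \<in> carrier (ideal_module R I)" using d0I by simp
    show "d0 (x \<oplus>\<^bsub>V n\<^esub> y) = d0 x \<oplus>\<^bsub>ideal_module R I\<^esub> d0 y" if "y \<in> carrier (V n)"
      unfolding d0_def using x that rI dot_add[of "{..<n}" r x y] by simp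
    show "d0 (a \<odot>\<^bsub>V n\<^esub> x) = a \<odot>\<^bsub>ideal_module R I\<^esub> d0 x" if "a \<in> carrier R"
      unfolding d0_def using x that rI dot_scale[of "{..<n}" a r x] by simp
  qed
  have d0e: "d0 (unit_vec l) = r l" if "l < n" for l
  proof -
    have "d0 (unit_vec l) = finsum R (\<lambda>j. if l = j then r j else \<zero>) {..<n}"
      unfolding d0_def dot_def using rI by (intro finsum_cong') (auto simp: unit_vec_def)
    then show ?thesis using finsum_singleton[of l "{..<n}" r] rI that by (simp add: Pi_def)
  qed
  interpret W: Module.module R "V n" by (rule freemod_module)
  have onto: "d0 ` carrier (V n) = I"
  proof
    show "d0 ` carrier (V n) \<subseteq> I" using d0I by auto
    have "ideal (d0 ` carrier (V n)) R"
    proof (rule ideal_cringI)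
      show "d0 ` carrier (V n) \<subseteq> carrier R" using d0I ideal.Icarr[OF I] by auto
      have "d0 (\<lambda>i. \<zero>) = \<zero>" using mod_homD(3)[OF d0, of \<zero> "\<lambda>i. \<zero>"] W.zero_closed d0I[of "\<lambda>i. \<zero>"] ideal.Icarr[OF I] by simp
      then show "\<zero> \<in> d0 ` carrier (V n)" using W.zero_closed by (force simp: image_iff)
    next
      fix x y assume "x \<in> d0 ` carrier (V n)" "y \<in> d0 ` carrier (V n)"
      then obtain u v where "u \<in> carrier (V n)" "v \<in> carrier (V n)" "x = d0 u" "y = d0 v" by auto
      then show "x \<oplus> y \<in> d0 ` carrier (V n)"
        using mod_homD(2)[OF d0, of u v] W.add.m_closed[of u v] by (metis ideal_module_simps(3) image_eqI)
    next
      fix a x assume "a \<in> carrier R" "x \<in> d0 ` carrier (V n)"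
      then obtain u where "u \<in> carrier (V n)" "x = d0 u" "a \<in> carrier R" by auto
      then show "a \<otimes> x \<in> d0 ` carrier (V n)"
        using mod_homD(3)[OF d0, of a u] W.smult_closed[of a u] by (metis ideal_module_simps(4) image_eqI)
    qed
    moreover have "S \<subseteq> d0 ` carrier (V n)"
    proof
      fix y assume "y \<in> S"
      then obtain l where "l < n" "y = d0 (unit_vec l)" using rS d0e by auto
      then show "y \<in> d0 ` carrier (V n)" by simp
    qed
    ultimately show "I \<subseteq> d0 ` carrier (V n)" unfolding S(3) by (rule genideal_minimal)
  qed
  define K where "K = {v \<in> carrier (V n). d0 v = \<zero>}"
  have "\<exists>G. finite G \<and> G \<subseteq> K \<and> K \<subseteq> mspan R (V n) G"
  proof (rule finitely_generated_local[OF freemod_module])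
    fix M assume M: "maximalideal M R"
    note PM = primeideal_maximal[OF M]
    obtain s \<phi> \<psi> a where s: "s \<in> carrier R - M" and kd: "kernel_diag n {0} {..<n} (\<lambda>_. r) s \<phi> \<psi> a"
      using near_diagonal[OF PM, of "{0}" "{..<n}" n "\<lambda>_. r"] rI by blast
    note kd = kernel_diagD[OF kd]
    have "\<forall>l. \<exists>b. annih_principal_near M (a l) b" using near[OF M kd(3)] by blast
    then obtain b where b: "\<And>l. annih_principal_near M (a l) (b l)" by metis
    have bc: "b l \<in> carrier R" "a l \<otimes> b l = \<zero>" for l
      using b[of l] by (auto simp: annih_principal_near_def annih_def)
    obtain e where e: "e \<in> carrier R - M" "\<And>l x. l < n \<Longrightarrow> x \<in> annih (a l) \<Longrightarrow> e \<otimes> x \<in> PIdl (b l)"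
      using annih_common_multiplier[of M n a b, OF M kd(3) b] by blast
    have ec: "e \<in> carrier R" using e by simp
    \<comment> \<open>The diagonal matrix of the \<open>b l\<close> parametrises the product of
      annihilators up to a multiplier, and \<open>\<psi>\<close> returns to the original
      coordinates.\<close>
    define \<Psi> where "\<Psi> = (\<lambda>y. \<psi> (\<lambda>l. if l < n then b l \<otimes> y l else \<zero>))"
    have \<Psi>: "\<Psi> \<in> mod_hom R (V n) (V n)"
      unfolding \<Psi>_def by (rule mod_hom_comp[OF diag_hom kd(2)]) (rule bc)
    define G where "G = (\<lambda>l. \<Psi> (unit_vec l)) ` {..<n}"
    have GK: "\<Psi> y \<in> K" if y: "y \<in> carrier (V n)" for y
    proof -
      have "(\<lambda>l. if l < n then b l \<otimes> y l else \<zero>) \<in> carrier (V n)"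
        using bc y by (auto simp: freemod_carrier)
      moreover have "a l \<otimes> (b l \<otimes> y l) = \<zero>" for l
        using bc[of l] kd(3)[of l] freemod_coord[OF y, of l] by (simp add: m_assoc[symmetric])
      ultimately have "dot {..<n} r (\<Psi> y) = \<zero>" unfolding \<Psi>_def by (intro kd(9)[where i = 0]) auto
      then show ?thesis using mod_homD(1)[OF \<Psi> y] by (simp add: K_def d0_def)
    qed
    have "(e \<otimes> s) \<odot>\<^bsub>V n\<^esub> z \<in> mspan R (V n) G" if zK: "z \<in> K" for z
    proof -
      have z: "z \<in> carrier (V n)" "\<forall>i\<in>{0::nat}. dot {..<n} r z = \<zero>" using zK by (auto simp: K_def d0_def)
      note \<phi>z = mod_homD(1)[OF kd(1) z(1)]
      have "\<exists>\<rho>\<in>carrier R. e \<otimes> \<phi> z l = \<rho> \<otimes> b l" if "l < n" for l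
      proof -
        have "\<phi> z l \<in> annih (a l)" using kd(8)[OF z, of l] that \<phi>z by (simp add: annih_def)
        then show ?thesis using e(2)[OF that] by (auto simp: mem_PIdl)
      qed
      then obtain \<rho> where \<rho>: "\<And>l. l < n \<Longrightarrow> \<rho> l \<in> carrier R" "\<And>l. l < n \<Longrightarrow> e \<otimes> \<phi> z l = \<rho> l \<otimes> b l"
        by metis
      define y where "y = (\<lambda>l. if l < n then \<rho> l else \<zero>)"
      have y: "y \<in> carrier (V n)" using \<rho> by (auto simp: y_def freemod_carrier)
      have "(\<lambda>l. if l < n then b l \<otimes> y l else \<zero>) = (\<lambda>l. e \<otimes> \<phi> z l)"
      proof
        fix l
        show "(if l < n then b l \<otimes> y l else \<zero>) = e \<otimes> \<phi> z l"
          using \<rho>[of l] bc[of l] \<phi>z ec by (auto simp: y_def m_comm freemod_carrier)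
      qed
      then have "\<Psi> y = (\<lambda>l. e \<otimes> \<psi> (\<phi> z) l)"
        unfolding \<Psi>_def using hom_apply_scaled[OF kd(2) ec \<phi>z] by simp
      also have "\<dots> = (e \<otimes> s) \<odot>\<^bsub>V n\<^esub> z"
        using kd(5)[OF z(1)] ec s freemod_coord[OF z(1)] by (simp add: m_assoc)
      finally show ?thesis unfolding G_def using hom_in_mspan[OF freemod_module \<Psi> y] by simp
    qed
    moreover have "finite G" "G \<subseteq> K" using GK by (auto simp: G_def)
    moreover have "e \<otimes> s \<in> carrier R - M" by (rule primeideal_mult_notin[OF PM e(1) s])
    ultimately show "\<exists>s\<in>carrier R - M. \<exists>G. finite G \<and> G \<subseteq> K \<and> (\<forall>z\<in>K. s \<odot>\<^bsub>V n\<^esub> z \<in> mspan R (V n) G)"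
      by blast
  qed (auto simp: K_def)
  then obtain G where G: "finite G" "G \<subseteq> K" "K \<subseteq> mspan R (V n) G" by blast
  have "G \<subseteq> carrier (V n)" using G by (auto simp: K_def)
  then obtain q h where h: "h \<in> mod_hom R (V q) (V n)" "h ` carrier (V q) = mspan R (V n) G"
    using mspan_hom_image[OF freemod_module G(1)] by metis
  have "mspan R (V n) G \<subseteq> K"
  proof
    fix x assume "x \<in> mspan R (V n) G"
    then have "x \<in> carrier (V n) \<and> d0 x = \<zero>"
    proof induct
      case zero
      then show ?case using W.zero_closed mod_homD(3)[OF d0, of \<zero> "\<lambda>i. \<zero>"] d0I[of "\<lambda>i. \<zero>"] ideal.Icarr[OF I] by simp
    next
      case (gen g)
      then show ?case using G(2) by (auto simp: K_def)
    next
      case (add x y)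
      then show ?case using W.add.m_closed[of x y] mod_homD(2)[OF d0, of x y] by simp
    next
      case (smult a x)
      then show ?case using W.smult_closed[of a x] mod_homD(3)[OF d0, of a x] by simp
    qed
    then show "x \<in> K" by (simp add: K_def)
  qed
  then have "h ` carrier (V q) = K" using h G by blast
  then show "free_res R (ideal_module R I) 1"
    using d0 onto h(1) by (intro free_res_oneI[of d0 n _ h q]) (auto simp: K_def)
qed

end

section \<open>Canonical forms yield the comparison of ideals\<close>

context cring
begin

definition colon :: "'a set \<Rightarrow> 'a set \<Rightarrow> 'a set" where
  "colon I J = {c \<in> carrier R. \<forall>x\<in>J. c \<otimes> x \<in> I}"

lemma colon_ideal:
  assumes "ideal I R" "ideal J R" shows "ideal (colon I J) R"
proof (rule ideal_cringI, goal_cases)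
  case (4 a x)
  then show ?case using assms ideal.I_l_closed[OF assms(1)] ideal.Icarr[OF assms(2)]
    by (auto simp: colon_def m_assoc)
qed (use assms ideal.Icarr[OF assms(2)] in \<open>auto simp: colon_def l_distr ideal_zero_mem ideal_add_closed\<close>)

lemma ideal_subset_colon: "\<lbrakk>ideal I R; ideal J R\<rbrakk> \<Longrightarrow> I \<subseteq> colon I J"
  by (auto simp: colon_def ideal.Icarr ideal.I_r_closed)

lemma det_two:
  assumes c: "x1 \<in> carrier R" "y1 \<in> carrier R" "x2 \<in> carrier R" "y2 \<in> carrier R"
    "p1 \<in> carrier R" "p2 \<in> carrier R" "q1 \<in> carrier R" "q2 \<in> carrier R"
    and e: "x1 \<otimes> p1 \<oplus> y1 \<otimes> q1 = \<one>" "x1 \<otimes> p2 \<oplus> y1 \<otimes> q2 = \<zero>"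
      "x2 \<otimes> p1 \<oplus> y2 \<otimes> q1 = \<zero>" "x2 \<otimes> p2 \<oplus> y2 \<otimes> q2 = \<one>"
  shows "(x1 \<otimes> y2 \<ominus> x2 \<otimes> y1) \<otimes> (p1 \<otimes> q2 \<ominus> p2 \<otimes> q1) = \<one>"
proof -
  have "(x1 \<otimes> y2 \<ominus> x2 \<otimes> y1) \<otimes> (p1 \<otimes> q2 \<ominus> p2 \<otimes> q1)
      = (x1 \<otimes> p1 \<oplus> y1 \<otimes> q1) \<otimes> (x2 \<otimes> p2 \<oplus> y2 \<otimes> q2) \<ominus> (x1 \<otimes> p2 \<oplus> y1 \<otimes> q2) \<otimes> (x2 \<otimes> p1 \<oplus> y2 \<otimes> q1)"
    using c by algebra
  then show ?thesis by (simp add: e a_minus_def)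
qed

text \<open>The first two rows and columns form mutually inverse matrices, so \<open>D'\<close> is a
  unit. By Cramer's rule the pair \<open>x3\<close>, \<open>y3\<close>, orthogonal to both columns,
  is killed by \<open>D'\<close>; yet it pairs to one with the third column.\<close>

lemma rank_three_from_two:
  assumes c: "x1 \<in> carrier R" "y1 \<in> carrier R" "x2 \<in> carrier R" "y2 \<in> carrier R" "x3 \<in> carrier R" "y3 \<in> carrier R"
    "p1 \<in> carrier R" "p2 \<in> carrier R" "q1 \<in> carrier R" "q2 \<in> carrier R" "p3 \<in> carrier R" "q3 \<in> carrier R"
    and e: "x1 \<otimes> p1 \<oplus> y1 \<otimes> q1 = \<one>" "x1 \<otimes> p2 \<oplus> y1 \<otimes> q2 = \<zero>"
      "x2 \<otimes> p1 \<oplus> y2 \<otimes> q1 = \<zero>" "x2 \<otimes> p2 \<oplus> y2 \<otimes> q2 = \<one>"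
      "x3 \<otimes> p1 \<oplus> y3 \<otimes> q1 = \<zero>" "x3 \<otimes> p2 \<oplus> y3 \<otimes> q2 = \<zero>" "x3 \<otimes> p3 \<oplus> y3 \<otimes> q3 = \<one>"
  shows "\<one> = \<zero>"
proof -
  define D where "D = x1 \<otimes> y2 \<ominus> x2 \<otimes> y1"
  define D' where "D' = p1 \<otimes> q2 \<ominus> p2 \<otimes> q1"
  have Dc: "D \<in> carrier R" "D' \<in> carrier R" using c by (auto simp: D_def D'_def)
  have DD: "D \<otimes> D' = \<one>" unfolding D_def D'_def by (rule det_two[OF c(1-4) c(7-10) e(1-4)])
  have "x3 \<otimes> D' = q2 \<otimes> (x3 \<otimes> p1 \<oplus> y3 \<otimes> q1) \<ominus> q1 \<otimes> (x3 \<otimes> p2 \<oplus> y3 \<otimes> q2)"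
    unfolding D'_def using c by algebra
  then have x: "x3 \<otimes> D' = \<zero>" using c by (simp add: e a_minus_def)
  have "y3 \<otimes> D' = p1 \<otimes> (x3 \<otimes> p2 \<oplus> y3 \<otimes> q2) \<ominus> p2 \<otimes> (x3 \<otimes> p1 \<oplus> y3 \<otimes> q1)"
    unfolding D'_def using c by algebra
  then have y: "y3 \<otimes> D' = \<zero>" using c by (simp add: e a_minus_def)
  have "D \<otimes> D' = D \<otimes> D' \<otimes> (x3 \<otimes> p3 \<oplus> y3 \<otimes> q3)" using Dc by (simp add: e)
  also have "\<dots> = D \<otimes> (x3 \<otimes> D') \<otimes> p3 \<oplus> D \<otimes> (y3 \<otimes> D') \<otimes> q3" using c Dc by algebra
  also have "\<dots> = \<zero>" using x y c Dc by simp
  finally show ?thesis using DD by simp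
qed

text \<open>Modulo \<open>D\<close> the element \<open>y\<close> is a unit and
  \<open>p \<otimes> y\<close> is zero, so \<open>p \<otimes> x\<close> lies in \<open>D\<close>,
  while its difference from one lies in \<open>C\<close>.\<close>

lemma comparison_from_pair:
  assumes C: "ideal C R" and D: "ideal D R" and c: "x \<in> carrier R" "y \<in> carrier R" "p \<in> carrier R" "q \<in> carrier R"
    and m: "\<one> \<ominus> p \<otimes> x \<in> C" "p \<otimes> y \<in> D" "\<one> \<ominus> q \<otimes> y \<in> D"
  shows "\<exists>c\<in>C. \<exists>d\<in>D. c \<oplus> d = \<one>"
proof -
  have "p \<otimes> x = x \<otimes> p \<otimes> (\<one> \<ominus> q \<otimes> y) \<oplus> x \<otimes> q \<otimes> (p \<otimes> y)" using c by algebra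
  also have "\<dots> \<in> D"
    using c ideal_add_closed[OF D ideal.I_l_closed[OF D m(3), of "x \<otimes> p"] ideal.I_l_closed[OF D m(2), of "x \<otimes> q"]]
    by simp
  finally have "p \<otimes> x \<in> D" .
  moreover have "(\<one> \<ominus> p \<otimes> x) \<oplus> p \<otimes> x = \<one>" using c by algebra
  ultimately show ?thesis using m by blast
qed

end

section \<open>Reading off the comparison from the coordinates of a canonical form\<close>

context plain_cring
begin

lemma quot_coset_eq_zero:
  assumes L: "ideal L R" and x: "x \<in> carrier R"
  shows "L +> x = \<zero>\<^bsub>R Quot L\<^esub> \<longleftrightarrow> x \<in> L"
  using a_rcos_zero[OF L] ideal.rcos_const_imp_mem[OF L x] by (auto simp: FactRing_def)

lemma quot_coset_hom:
  assumes L: "ideal L R"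
  shows "cring (R Quot L)" "(+>) L \<in> ring_hom R (R Quot L)"
  using ideal.quotient_is_cring[OF L is_cring] ideal.rcos_ring_hom[OF L] by auto

text \<open>A pair \<open>p, q\<close> of images of the two generators of \<open>R/I \<oplus> R/J\<close> in \<open>\<Oplus> R/K\<^sub>j\<close>.\<close>
lemma comparison_from_generators:
  assumes I: "ideal I R" and J: "ideal J R" and K: "\<And>k. k < n \<Longrightarrow> ideal (K k) R"
    and chain: "\<And>k. Suc k < n \<Longrightarrow> K k \<subseteq> K (Suc k)" and proper: "0 < n \<Longrightarrow> K (n - 1) \<noteq> carrier R"
    and p: "\<And>j. p j \<in> carrier R" and q: "\<And>j. q j \<in> carrier R"
    and gen: "\<And>w. w \<in> carrier (V n) \<Longrightarrow>
      \<exists>x\<in>carrier R. \<exists>y\<in>carrier R. \<forall>j<n. (x \<otimes> p j \<oplus> y \<otimes> q j) \<ominus> w j \<in> K j"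
    and rel: "\<And>x y. \<lbrakk>x \<in> carrier R; y \<in> carrier R\<rbrakk> \<Longrightarrow>
      (\<forall>j<n. x \<otimes> p j \<oplus> y \<otimes> q j \<in> K j) \<longleftrightarrow> x \<in> I \<and> y \<in> J"
  shows "\<exists>c\<in>colon I J. \<exists>d\<in>colon J I. c \<oplus> d = \<one>"
proof -
  note CI = colon_ideal[OF I J] and DI = colon_ideal[OF J I]
  define G where "G i x y \<longleftrightarrow> x \<in> carrier R \<and> y \<in> carrier R
      \<and> (\<forall>j<n. (x \<otimes> p j \<oplus> y \<otimes> q j) \<ominus> unit_vec i j \<in> K j)" for i x y
  have "\<exists>x y. G i x y" if "i < n" for i using gen[OF unit_vec_carrier[OF that]] unfolding G_def by blast
  then obtain X Y where "\<And>i. i < n \<Longrightarrow> G i (X i) (Y i)" by metis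
  then have XY: "\<And>i. i < n \<Longrightarrow> X i \<in> carrier R" "\<And>i. i < n \<Longrightarrow> Y i \<in> carrier R"
    "\<And>i j. i < n \<Longrightarrow> j < n \<Longrightarrow> (X i \<otimes> p j \<oplus> Y i \<otimes> q j) \<ominus> unit_vec i j \<in> K j"
    unfolding G_def by simp_all
  have last: "K j \<subseteq> K (n - 1)" if "j < n" for j
  proof -
    have "j + i < n \<Longrightarrow> K j \<subseteq> K (j + i)" for i
    proof (induct i)
      case (Suc i)
      then show ?case using chain[of "j + i"] by auto
    qed simp
    from this[of "n - 1 - j"] that show ?thesis by simp
  qed
  consider "n = 0" | "n = 1" | "n = 2" | "3 \<le> n" by linarith
  then show ?thesis
  proof cases
    case 1
    then have "\<one> \<in> I" "\<one> \<in> J" using rel[of \<one> \<one>] by auto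
    then have "\<one> \<in> colon I J" "\<zero> \<in> colon J I"
      using ideal_subset_colon[OF I J] ideal_zero_mem[OF DI] by auto
    then show ?thesis by (intro bexI[of _ \<one>] bexI[of _ \<zero>]) auto
  next
    \<comment> \<open>With one summand, subtracting from each of the two standard generators its
      image times the preimage \<open>x\<close>, \<open>y\<close> of one yields a relation, that is,
      a pair in \<open>I\<close> and \<open>J\<close>.\<close>
    case 2
    define x y P Q where "x = X 0" and "y = Y 0" and "P = p 0" and "Q = q 0"
    have c: "x \<in> carrier R" "y \<in> carrier R" "P \<in> carrier R" "Q \<in> carrier R"
      using XY 2 p q by (auto simp: x_def y_def P_def Q_def)
    have K0: "ideal (K 0) R" using K 2 by simp
    have u: "(x \<otimes> P \<oplus> y \<otimes> Q) \<ominus> \<one> \<in> K 0"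
      using XY(3)[of 0 0] 2 by (simp add: x_def y_def P_def Q_def unit_vec_def)
    have "(\<one> \<ominus> P \<otimes> x) \<otimes> P \<oplus> (\<ominus> (P \<otimes> y)) \<otimes> Q = \<ominus> P \<otimes> ((x \<otimes> P \<oplus> y \<otimes> Q) \<ominus> \<one>)"
      using c by algebra
    also have "\<dots> \<in> K 0" using u c ideal.I_l_closed[OF K0] by simp
    finally have 1: "\<one> \<ominus> P \<otimes> x \<in> I" "\<ominus> (P \<otimes> y) \<in> J"
      using rel[of "\<one> \<ominus> P \<otimes> x" "\<ominus> (P \<otimes> y)"] c 2 by (auto simp: P_def Q_def)
    have "(\<ominus> (Q \<otimes> x)) \<otimes> P \<oplus> (\<one> \<ominus> Q \<otimes> y) \<otimes> Q = \<ominus> Q \<otimes> ((x \<otimes> P \<oplus> y \<otimes> Q) \<ominus> \<one>)"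
      using c by algebra
    also have "\<dots> \<in> K 0" using u c ideal.I_l_closed[OF K0] by simp
    finally have 3: "\<one> \<ominus> Q \<otimes> y \<in> J"
      using rel[of "\<ominus> (Q \<otimes> x)" "\<one> \<ominus> Q \<otimes> y"] c 2 by (auto simp: P_def Q_def)
    have "P \<otimes> y \<in> J" using ideal_minus_closed[OF J ideal_zero_mem[OF J] 1(2)] c by (simp add: a_minus_def)
    then show ?thesis
      using comparison_from_pair[OF CI DI c] 1 3 ideal_subset_colon[OF I J] ideal_subset_colon[OF J I] by blast
  next
    \<comment> \<open>With two summands the plan is to show that the preimage \<open>x1\<close>,
      \<open>y1\<close> of the second generator lies in the two colon ideals; modulo these the
      situation is that of one summand.\<close>
    case 3
    define L where "L = K 1"
    have L: "ideal L R" and K0: "ideal (K 0) R" and K0L: "K 0 \<subseteq> L" using K chain[of 0] 3 by (auto simp: L_def)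
    define x0 y0 x1 y1 p0 q0 p1 q1 where "x0 = X 0" and "y0 = Y 0" and "x1 = X 1" and "y1 = Y 1"
      and "p0 = p 0" and "q0 = q 0" and "p1 = p 1" and "q1 = q 1"
    note defs = x0_def y0_def x1_def y1_def p0_def q0_def p1_def q1_def
    have c: "x0 \<in> carrier R" "y0 \<in> carrier R" "x1 \<in> carrier R" "y1 \<in> carrier R"
      "p0 \<in> carrier R" "p1 \<in> carrier R" "q0 \<in> carrier R" "q1 \<in> carrier R"
      using XY 3 p q by (auto simp: defs)
    have all2: "(\<forall>j<n. Pr j) \<longleftrightarrow> Pr 0 \<and> Pr 1" for Pr :: "nat \<Rightarrow> bool"
      using 3 by (auto simp: less_2_cases_iff)
    have rel2: "(x \<otimes> p0 \<oplus> y \<otimes> q0 \<in> K 0 \<and> x \<otimes> p1 \<oplus> y \<otimes> q1 \<in> L) \<longleftrightarrow> x \<in> I \<and> y \<in> J"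
      if "x \<in> carrier R" "y \<in> carrier R" for x y
      using rel[OF that] unfolding all2 by (simp add: defs L_def)
    have u: "(x0 \<otimes> p0 \<oplus> y0 \<otimes> q0) \<ominus> \<one> \<in> K 0" "(x0 \<otimes> p1 \<oplus> y0 \<otimes> q1) \<in> L"
      "(x1 \<otimes> p0 \<oplus> y1 \<otimes> q0) \<in> K 0" "(x1 \<otimes> p1 \<oplus> y1 \<otimes> q1) \<ominus> \<one> \<in> L"
      using XY(3)[of 0 0] XY(3)[of 0 1] XY(3)[of 1 0] XY(3)[of 1 1] c 3
      by (auto simp: defs L_def unit_vec_def a_minus_def)
    define D where "D = x0 \<otimes> y1 \<ominus> x1 \<otimes> y0"
    define D' where "D' = p0 \<otimes> q1 \<ominus> p1 \<otimes> q0"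
    have Dc: "D \<in> carrier R" "D' \<in> carrier R" using c by (auto simp: D_def D'_def)
    have "D \<otimes> D' \<ominus> \<one> = ((x0 \<otimes> p0 \<oplus> y0 \<otimes> q0) \<ominus> \<one>) \<otimes> (x1 \<otimes> p1 \<oplus> y1 \<otimes> q1)
        \<oplus> ((x1 \<otimes> p1 \<oplus> y1 \<otimes> q1) \<ominus> \<one>) \<ominus> (x0 \<otimes> p1 \<oplus> y0 \<otimes> q1) \<otimes> (x1 \<otimes> p0 \<oplus> y1 \<otimes> q0)"
      unfolding D_def D'_def using c by algebra
    also have "\<dots> \<in> L"
      using c u K0L ideal.I_r_closed[OF L, of "(x0 \<otimes> p0 \<oplus> y0 \<otimes> q0) \<ominus> \<one>" "x1 \<otimes> p1 \<oplus> y1 \<otimes> q1"]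
      by (intro ideal_minus_closed[OF L ideal_add_closed[OF L _ u(4)] ideal.I_r_closed[OF L u(2)]]) auto
    finally have DL: "D \<otimes> D' \<ominus> \<one> \<in> L" .
    have inL: "a \<in> L" if a: "a \<in> carrier R" "a \<otimes> D' \<in> L" for a
    proof -
      have "a = D \<otimes> (a \<otimes> D') \<ominus> a \<otimes> (D \<otimes> D' \<ominus> \<one>)" using a(1) Dc by algebra
      also have "\<dots> \<in> L"
        by (rule ideal_minus_closed[OF L ideal.I_l_closed[OF L a(2) Dc(1)] ideal.I_l_closed[OF L DL a(1)]])
      finally show ?thesis .
    qed
    \<comment> \<open>An element of \<open>I\<close> kills the first generator, hence
      \<open>p0\<close> and \<open>p1\<close> modulo \<open>L\<close>, hence the determinant
      \<open>D'\<close>, which is a unit modulo \<open>L\<close>. For \<open>J\<close> the second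
      generator is used.\<close>
    have IL: "I \<subseteq> L"
    proof
      fix a assume aI: "a \<in> I"
      then have a: "a \<in> carrier R" using ideal.Icarr[OF I] by blast
      then have "a \<otimes> p0 \<in> L" "a \<otimes> p1 \<in> L" using rel2[of a \<zero>] aI ideal_zero_mem[OF J] c K0L by auto
      moreover have "a \<otimes> D' = q1 \<otimes> (a \<otimes> p0) \<ominus> q0 \<otimes> (a \<otimes> p1)" unfolding D'_def using a c by algebra
      ultimately show "a \<in> L" using inL[OF a] ideal_minus_closed[OF L] ideal.I_l_closed[OF L] c by metis
    qed
    have JL: "J \<subseteq> L"
    proof
      fix a assume aJ: "a \<in> J"
      then have a: "a \<in> carrier R" using ideal.Icarr[OF J] by blast
      then have "a \<otimes> q0 \<in> L" "a \<otimes> q1 \<in> L" using rel2[of \<zero> a] aJ ideal_zero_mem[OF I] c K0L by auto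
      moreover have "a \<otimes> D' = p0 \<otimes> (a \<otimes> q1) \<ominus> p1 \<otimes> (a \<otimes> q0)" unfolding D'_def using a c by algebra
      ultimately show "a \<in> L" using inL[OF a] ideal_minus_closed[OF L] ideal.I_l_closed[OF L] c by metis
    qed
    \<comment> \<open>The pair \<open>x1\<close>, \<open>y1\<close> maps to the generator of the
      second summand, which \<open>L\<close> kills. As \<open>L\<close> contains \<open>I\<close>
      and \<open>J\<close>, membership in the colon ideals follows.\<close>
    have "x1 \<otimes> l \<in> I \<and> y1 \<otimes> l \<in> J" if lL: "l \<in> L" for l
    proof -
      have l: "l \<in> carrier R" using ideal.Icarr[OF L lL] .
      have "x1 \<otimes> l \<otimes> p0 \<oplus> y1 \<otimes> l \<otimes> q0 = l \<otimes> (x1 \<otimes> p0 \<oplus> y1 \<otimes> q0)" using l c by algebra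
      also have "\<dots> \<in> K 0" using u l by (intro ideal.I_l_closed[OF K0])
      finally have 1: "x1 \<otimes> l \<otimes> p0 \<oplus> y1 \<otimes> l \<otimes> q0 \<in> K 0" .
      have "x1 \<otimes> l \<otimes> p1 \<oplus> y1 \<otimes> l \<otimes> q1 = l \<otimes> (x1 \<otimes> p1 \<oplus> y1 \<otimes> q1)" using l c by algebra
      also have "\<dots> \<in> L" using lL c by (intro ideal.I_r_closed[OF L]) auto
      finally have "x1 \<otimes> l \<otimes> p1 \<oplus> y1 \<otimes> l \<otimes> q1 \<in> L" .
      then show ?thesis using rel2[of "x1 \<otimes> l" "y1 \<otimes> l"] 1 l c by auto
    qed
    then have x1: "x1 \<in> colon I J" and y1: "y1 \<in> colon J I" using IL JL c by (auto simp: colon_def)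
    \<comment> \<open>The pair \<open>s\<close>, \<open>t\<close> minus the combination of the
      chosen preimages with the same image maps to zero.\<close>
    have key: "s \<ominus> (p' \<otimes> x0 \<oplus> p'' \<otimes> x1) \<in> I \<and> t \<ominus> (p' \<otimes> y0 \<oplus> p'' \<otimes> y1) \<in> J"
      if st: "s \<in> carrier R" "t \<in> carrier R" and p': "p' = s \<otimes> p0 \<oplus> t \<otimes> q0" and p'': "p'' = s \<otimes> p1 \<oplus> t \<otimes> q1" for s t p' p''
    proof -
      have pc: "p' \<in> carrier R" "p'' \<in> carrier R" using st c p' p'' by auto
      have "(s \<ominus> (p' \<otimes> x0 \<oplus> p'' \<otimes> x1)) \<otimes> p0 \<oplus> (t \<ominus> (p' \<otimes> y0 \<oplus> p'' \<otimes> y1)) \<otimes> q0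
          = ((s \<otimes> p0 \<oplus> t \<otimes> q0) \<ominus> p') \<ominus> p' \<otimes> ((x0 \<otimes> p0 \<oplus> y0 \<otimes> q0) \<ominus> \<one>) \<ominus> p'' \<otimes> (x1 \<otimes> p0 \<oplus> y1 \<otimes> q0)"
        using st pc c by algebra
      also have "\<dots> \<in> K 0"
      proof -
        have "(s \<otimes> p0 \<oplus> t \<otimes> q0) \<ominus> p' \<in> K 0"
          using ideal_zero_mem[OF K0] pc(1) by (simp add: p'[symmetric] a_minus_def r_neg)
        from ideal_minus_closed[OF K0 ideal_minus_closed[OF K0 this
            ideal.I_l_closed[OF K0 u(1) pc(1)]] ideal.I_l_closed[OF K0 u(3) pc(2)]]
        show ?thesis .
      qed
      finally have 1: "(s \<ominus> (p' \<otimes> x0 \<oplus> p'' \<otimes> x1)) \<otimes> p0 \<oplus> (t \<ominus> (p' \<otimes> y0 \<oplus> p'' \<otimes> y1)) \<otimes> q0 \<in> K 0" .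
      have "(s \<ominus> (p' \<otimes> x0 \<oplus> p'' \<otimes> x1)) \<otimes> p1 \<oplus> (t \<ominus> (p' \<otimes> y0 \<oplus> p'' \<otimes> y1)) \<otimes> q1
          = ((s \<otimes> p1 \<oplus> t \<otimes> q1) \<ominus> p'') \<ominus> p'' \<otimes> ((x1 \<otimes> p1 \<oplus> y1 \<otimes> q1) \<ominus> \<one>) \<ominus> p' \<otimes> (x0 \<otimes> p1 \<oplus> y0 \<otimes> q1)"
        using st pc c by algebra
      also have "\<dots> \<in> L"
      proof -
        have "(s \<otimes> p1 \<oplus> t \<otimes> q1) \<ominus> p'' \<in> L"
          using ideal_zero_mem[OF L] pc(2) by (simp add: p''[symmetric] a_minus_def r_neg)
        from ideal_minus_closed[OF L ideal_minus_closed[OF L this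
            ideal.I_l_closed[OF L u(4) pc(2)]] ideal.I_l_closed[OF L u(2) pc(1)]]
        show ?thesis .
      qed
      finally show ?thesis
        using 1 rel2[of "s \<ominus> (p' \<otimes> x0 \<oplus> p'' \<otimes> x1)" "t \<ominus> (p' \<otimes> y0 \<oplus> p'' \<otimes> y1)"] st pc c by auto
    qed
    have k1: "\<one> \<ominus> (p0 \<otimes> x0 \<oplus> p1 \<otimes> x1) \<in> I" "\<zero> \<ominus> (p0 \<otimes> y0 \<oplus> p1 \<otimes> y1) \<in> J"
      using key[of \<one> \<zero> p0 p1] c by auto
    have k2: "\<one> \<ominus> (q0 \<otimes> y0 \<oplus> q1 \<otimes> y1) \<in> J"
      using key[of \<zero> \<one> q0 q1] c by auto
    have "\<one> \<ominus> p0 \<otimes> x0 = (\<one> \<ominus> (p0 \<otimes> x0 \<oplus> p1 \<otimes> x1)) \<oplus> p1 \<otimes> x1" using c by algebra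
    also have "\<dots> \<in> colon I J"
      using c by (intro ideal_add_closed[OF CI subsetD[OF ideal_subset_colon[OF I J] k1(1)]
            ideal.I_l_closed[OF CI x1]]) auto
    finally have m1: "\<one> \<ominus> p0 \<otimes> x0 \<in> colon I J" .
    have "p0 \<otimes> y0 = \<ominus> \<one> \<otimes> (\<zero> \<ominus> (p0 \<otimes> y0 \<oplus> p1 \<otimes> y1)) \<ominus> p1 \<otimes> y1" using c by algebra
    also have "\<dots> \<in> colon J I"
      using c by (intro ideal_minus_closed[OF DI ideal.I_l_closed[OF DI
            subsetD[OF ideal_subset_colon[OF J I] k1(2)]] ideal.I_l_closed[OF DI y1]]) auto
    finally have m2: "p0 \<otimes> y0 \<in> colon J I" .
    have "\<one> \<ominus> q0 \<otimes> y0 = (\<one> \<ominus> (q0 \<otimes> y0 \<oplus> q1 \<otimes> y1)) \<oplus> q1 \<otimes> y1" using c by algebra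
    also have "\<dots> \<in> colon J I"
      using c by (intro ideal_add_closed[OF DI subsetD[OF ideal_subset_colon[OF J I] k2]
            ideal.I_l_closed[OF DI y1]]) auto
    finally have m3: "\<one> \<ominus> q0 \<otimes> y0 \<in> colon J I" .
    show ?thesis by (rule comparison_from_pair[OF CI DI c(1,2,5,7) m1 m2 m3])
  next
    \<comment> \<open>All \<open>K j\<close> lie in the proper ideal \<open>K (n - 1)\<close>. Over
      that quotient ring two generators would map onto a free module of rank at least three.\<close>
    case 4
    define L where "L = K (n - 1)"
    have L: "ideal L R" using K 4 by (simp add: L_def)
    interpret T: cring "R Quot L" by (rule quot_coset_hom[OF L])
    define \<pi> where "\<pi> = (+>) L"
    have \<pi>: "\<pi> \<in> ring_hom R (R Quot L)" unfolding \<pi>_def by (rule quot_coset_hom[OF L])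
    have \<pi>c: "\<pi> a \<in> carrier (R Quot L)" if "a \<in> carrier R" for a using ring_hom_closed[OF \<pi> that] .
    have \<pi>0: "\<pi> \<zero> = \<zero>\<^bsub>R Quot L\<^esub>"
      unfolding \<pi>_def using quot_coset_eq_zero[OF L zero_closed] ideal_zero_mem[OF L] by simp
    note hs = ring_hom_add[OF \<pi>] ring_hom_mult[OF \<pi>] ring_hom_one[OF \<pi>]
    have e: "\<pi> (X i) \<otimes>\<^bsub>R Quot L\<^esub> \<pi> (p j) \<oplus>\<^bsub>R Quot L\<^esub> \<pi> (Y i) \<otimes>\<^bsub>R Quot L\<^esub> \<pi> (q j)
        = (if j = i then \<one>\<^bsub>R Quot L\<^esub> else \<zero>\<^bsub>R Quot L\<^esub>)" if "i < n" "j < n" for i j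
    proof -
      have "(X i \<otimes> p j \<oplus> Y i \<otimes> q j) \<ominus> unit_vec i j \<in> L" using XY(3)[OF that] last[OF that(2)] by (auto simp: L_def)
      then have "\<pi> (X i \<otimes> p j \<oplus> Y i \<otimes> q j) = \<pi> (unit_vec i j)"
        using quotient_eq_iff_same_a_r_cos[OF L, of "X i \<otimes> p j \<oplus> Y i \<otimes> q j" "unit_vec i j"] XY(1,2)[OF that(1)] p q
        by (simp add: \<pi>_def unit_vec_def)
      then show ?thesis using XY(1,2)[OF that(1)] p q \<pi>0 hs(3) by (simp add: hs(1,2) unit_vec_def split: if_splits)
    qed
    define a b c where "a = n - 3" and "b = n - 2" and "c = n - 1"
    have abc: "a < n" "b < n" "c < n" "a \<noteq> b" "a \<noteq> c" "b \<noteq> c" using 4 by (auto simp: a_def b_def c_def)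
    have "\<one>\<^bsub>R Quot L\<^esub> = \<zero>\<^bsub>R Quot L\<^esub>"
      using T.rank_three_from_two[of "\<pi> (X a)" "\<pi> (Y a)" "\<pi> (X b)" "\<pi> (Y b)" "\<pi> (X c)" "\<pi> (Y c)"
        "\<pi> (p a)" "\<pi> (p b)" "\<pi> (q a)" "\<pi> (q b)" "\<pi> (p c)" "\<pi> (q c)"] \<pi>c XY(1,2) p q abc e by simp
    then have "\<one> \<in> L" using hs(3) quot_coset_eq_zero[OF L one_closed] by (simp add: \<pi>_def)
    then have "L = carrier R" using ideal.one_imp_carrier[OF L] by simp
    then show ?thesis using proper 4 by (simp add: L_def)
  qed
qed

section \<open>Arithmetic of cosets in direct sums of cyclic modules\<close>

lemma cyc_cls_self:
  assumes K: "\<forall>k<m. ideal (K k) R" and u: "u \<in> carrier (V m)"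
  shows "u \<in> cyc_cls R K m u"
  using u ideal_zero_mem[OF K[rule_format]] freemod_coord[OF u] by (auto simp: cyc_cls_def a_minus_def r_neg)

lemma cyc_cls_eq_iff:
  assumes K: "\<forall>k<m. ideal (K k) R" and u: "u \<in> carrier (V m)" and v: "v \<in> carrier (V m)"
  shows "cyc_cls R K m u = cyc_cls R K m v \<longleftrightarrow> (\<forall>i<m. u i \<ominus> v i \<in> K i)"
proof
  assume "cyc_cls R K m u = cyc_cls R K m v"
  then show "\<forall>i<m. u i \<ominus> v i \<in> K i" using cyc_cls_self[OF K u] by (auto simp: cyc_cls_def)
next
  have sub: "cyc_cls R K m a \<subseteq> cyc_cls R K m b"
    if ab: "a \<in> carrier (V m)" "b \<in> carrier (V m)" "\<forall>i<m. a i \<ominus> b i \<in> K i" for a b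
  proof
    fix w assume w: "w \<in> cyc_cls R K m a"
    then have wc: "w \<in> carrier (V m)" by (simp add: cyc_cls_def)
    have "w i \<ominus> b i \<in> K i" if i: "i < m" for i
    proof -
      have "w i \<ominus> b i = (w i \<ominus> a i) \<oplus> (a i \<ominus> b i)"
        using freemod_coord[OF wc, of i] freemod_coord[OF ab(1), of i] freemod_coord[OF ab(2), of i] by algebra
      then show ?thesis using ideal_add_closed[OF K[rule_format, OF i]] w ab(3) i by (simp add: cyc_cls_def)
    qed
    then show "w \<in> cyc_cls R K m b" using wc by (simp add: cyc_cls_def)
  qed
  assume e: "\<forall>i<m. u i \<ominus> v i \<in> K i"
  have "v i \<ominus> u i \<in> K i" if i: "i < m" for i
  proof -
    have "v i \<ominus> u i = \<ominus> \<one> \<otimes> (u i \<ominus> v i)"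
      using freemod_coord[OF u, of i] freemod_coord[OF v, of i] by algebra
    then show ?thesis using ideal.I_l_closed[OF K[rule_format, OF i], of "u i \<ominus> v i" "\<ominus> \<one>"] e i by simp
  qed
  then show "cyc_cls R K m u = cyc_cls R K m v" using sub[OF u v] sub[OF v u] e by auto
qed

text \<open>The sum of two cosets is a union over all representatives; independence of the
  representatives makes it the union of a single class.\<close>

lemma cyc_sum_add:
  assumes K: "\<forall>k<m. ideal (K k) R" and u: "u \<in> carrier (V m)" and v: "v \<in> carrier (V m)"
  shows "cyc_cls R K m u \<oplus>\<^bsub>cyc_sum R K m\<^esub> cyc_cls R K m v = cyc_cls R K m (\<lambda>i. u i \<oplus> v i)"
proof -
  have uv: "(\<lambda>i. u i \<oplus> v i) \<in> carrier (V m)" using u v by (auto simp: freemod_carrier)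
  have eq: "cyc_cls R K m (\<lambda>i. u' i \<oplus> v' i) = cyc_cls R K m (\<lambda>i. u i \<oplus> v i)"
    if u'v': "u' \<in> cyc_cls R K m u" "v' \<in> cyc_cls R K m v" for u' v'
  proof -
    have c: "u' \<in> carrier (V m)" "v' \<in> carrier (V m)" using u'v' by (auto simp: cyc_cls_def)
    have uv': "(\<lambda>i. u' i \<oplus> v' i) \<in> carrier (V m)" using c by (auto simp: freemod_carrier)
    have "(u' i \<oplus> v' i) \<ominus> (u i \<oplus> v i) \<in> K i" if i: "i < m" for i
    proof -
      have "(u' i \<oplus> v' i) \<ominus> (u i \<oplus> v i) = (u' i \<ominus> u i) \<oplus> (v' i \<ominus> v i)"
        using freemod_coord[OF c(1), of i] freemod_coord[OF c(2), of i] freemod_coord[OF u, of i]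
          freemod_coord[OF v, of i] by algebra
      then show ?thesis
        using ideal_add_closed[OF K[rule_format, OF i]] i u'v' by (simp add: cyc_cls_def)
    qed
    then show ?thesis using cyc_cls_eq_iff[OF K uv' uv] by simp
  qed
  have "{cyc_cls R K m (\<lambda>i. u' i \<oplus> v' i) | u' v'. u' \<in> cyc_cls R K m u \<and> v' \<in> cyc_cls R K m v}
      = {cyc_cls R K m (\<lambda>i. u i \<oplus> v i)}" (is "?S = {?c}")
  proof (intro equalityI subsetI)
    fix x assume "x \<in> ?S"
    then obtain u' v' where "u' \<in> cyc_cls R K m u" "v' \<in> cyc_cls R K m v"
      "x = cyc_cls R K m (\<lambda>i. u' i \<oplus> v' i)" by blast
    then show "x \<in> {?c}" using eq[of u' v'] by simp
  next
    fix x assume "x \<in> {?c}"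
    then show "x \<in> ?S" using cyc_cls_self[OF K u] cyc_cls_self[OF K v] by blast
  qed
  then show ?thesis by (simp add: cyc_sum_def)
qed

lemma cyc_sum_smult:
  assumes K: "\<forall>k<m. ideal (K k) R" and a: "a \<in> carrier R" and u: "u \<in> carrier (V m)"
  shows "a \<odot>\<^bsub>cyc_sum R K m\<^esub> cyc_cls R K m u = cyc_cls R K m (\<lambda>i. a \<otimes> u i)"
proof -
  have au: "(\<lambda>i. a \<otimes> u i) \<in> carrier (V m)" using a u by (auto simp: freemod_carrier)
  have eq: "cyc_cls R K m (\<lambda>i. a \<otimes> u' i) = cyc_cls R K m (\<lambda>i. a \<otimes> u i)" if u': "u' \<in> cyc_cls R K m u" for u'
  proof -
    have c: "u' \<in> carrier (V m)" using u' by (auto simp: cyc_cls_def)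
    have au': "(\<lambda>i. a \<otimes> u' i) \<in> carrier (V m)" using c a by (auto simp: freemod_carrier)
    have "a \<otimes> u' i \<ominus> a \<otimes> u i \<in> K i" if i: "i < m" for i
    proof -
      have "a \<otimes> u' i \<ominus> a \<otimes> u i = a \<otimes> (u' i \<ominus> u i)"
        using freemod_coord[OF c, of i] freemod_coord[OF u, of i] a by algebra
      then show ?thesis using ideal.I_l_closed[OF K[rule_format, OF i]] a i u' by (simp add: cyc_cls_def)
    qed
    then show ?thesis using cyc_cls_eq_iff[OF K au' au] by simp
  qed
  have "{cyc_cls R K m (\<lambda>i. a \<otimes> u' i) | u'. u' \<in> cyc_cls R K m u} = {cyc_cls R K m (\<lambda>i. a \<otimes> u i)}"
    (is "?S = {?c}")
  proof (intro equalityI subsetI)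
    fix x assume "x \<in> ?S"
    then obtain u' where "u' \<in> cyc_cls R K m u" "x = cyc_cls R K m (\<lambda>i. a \<otimes> u' i)" by blast
    then show "x \<in> {?c}" using eq[of u'] by simp
  next
    fix x assume "x \<in> {?c}"
    then show "x \<in> ?S" using cyc_cls_self[OF K u] by blast
  qed
  then show ?thesis by (simp add: cyc_sum_def)
qed

text \<open>The isomorphism is determined by representatives \<open>p\<close>, \<open>q\<close> of
  the images of the two generators of \<open>R/I \<oplus> R/J\<close>. Its surjectivity becomes the
  generation hypothesis of \<open>comparison_from_generators\<close>, its injectivity the
  description of the relations.\<close>

lemma CF_ring_colon:
  assumes CF: "CF_ring R" and I: "ideal I R" and J: "ideal J R"
  shows "\<exists>c\<in>colon I J. \<exists>d\<in>colon J I. c \<oplus> d = \<one>"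
proof -
  define H where "H = (\<lambda>i::nat. if i = 0 then I else J)"
  have H: "\<forall>i<2. ideal (H i) R" using I J by (simp add: H_def)
  have "has_canonical_form R (cyc_sum R H 2)" using CF H unfolding CF_ring_def by blast
  then obtain n K where K: "\<forall>k<n. ideal (K k) R"
    and chain: "\<forall>k. Suc k < n \<longrightarrow> K k \<subseteq> K (Suc k)" and proper: "0 < n \<longrightarrow> K (n - 1) \<noteq> carrier R"
    and ne: "mod_iso R (cyc_sum R H 2) (cyc_sum R K n) \<noteq> {}"
    unfolding has_canonical_form_def by blast
  obtain f where f: "f \<in> mod_hom R (cyc_sum R H 2) (cyc_sum R K n)"
    and bij: "bij_betw f (carrier (cyc_sum R H 2)) (carrier (cyc_sum R K n))"
    using ne unfolding mod_iso_def by blast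
  let ?cH = "cyc_cls R H 2" and ?cK = "cyc_cls R K n"
  have carH: "carrier (cyc_sum R H 2) = ?cH ` carrier (V 2)"
    and carK: "carrier (cyc_sum R K n) = ?cK ` carrier (V n)" by (simp_all add: cyc_sum_def)
  have uc: "unit_vec 0 \<in> carrier (V 2)" "unit_vec 1 \<in> carrier (V 2)" by simp_all
  have im: "f (?cH u) \<in> ?cK ` carrier (V n)" if "u \<in> carrier (V 2)" for u
    using mod_homD(1)[OF f, of "?cH u"] that carH carK by auto
  obtain p where p: "p \<in> carrier (V n)" "f (?cH (unit_vec 0)) = ?cK p" using im[OF uc(1)] by blast
  obtain q where q: "q \<in> carrier (V n)" "f (?cH (unit_vec 1)) = ?cK q" using im[OF uc(2)] by blast
  define pair where "pair x y = (\<lambda>i. x \<otimes> unit_vec 0 i \<oplus> y \<otimes> unit_vec 1 i)" for x y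
  have pair: "pair x y \<in> carrier (V 2)" if "x \<in> carrier R" "y \<in> carrier R" for x y
    using that by (auto simp: pair_def freemod_carrier unit_vec_def)
  have comb: "(\<lambda>i. x \<otimes> p i \<oplus> y \<otimes> q i) \<in> carrier (V n)" if "x \<in> carrier R" "y \<in> carrier R" for x y
    using that p q by (auto simp: freemod_carrier)
  have fpair: "f (?cH (pair x y)) = ?cK (\<lambda>i. x \<otimes> p i \<oplus> y \<otimes> q i)"
    if xy: "x \<in> carrier R" "y \<in> carrier R" for x y
  proof -
    have xu: "(\<lambda>i. x \<otimes> unit_vec 0 i) \<in> carrier (V 2)" "(\<lambda>i. y \<otimes> unit_vec 1 i) \<in> carrier (V 2)"
      and xp: "(\<lambda>i. x \<otimes> p i) \<in> carrier (V n)" "(\<lambda>i. y \<otimes> q i) \<in> carrier (V n)"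
      using xy p q uc by (auto simp: freemod_carrier unit_vec_def)
    have s: "?cH (\<lambda>i. x \<otimes> unit_vec 0 i) = x \<odot>\<^bsub>cyc_sum R H 2\<^esub> ?cH (unit_vec 0)"
      "?cH (\<lambda>i. y \<otimes> unit_vec 1 i) = y \<odot>\<^bsub>cyc_sum R H 2\<^esub> ?cH (unit_vec 1)"
      using cyc_sum_smult[OF H xy(1) uc(1)] cyc_sum_smult[OF H xy(2) uc(2)] by simp_all
    have cc: "?cH u \<in> carrier (cyc_sum R H 2)" if "u \<in> carrier (V 2)" for u using that carH by auto
    have "f (?cH (pair x y)) = f (?cH (\<lambda>i. x \<otimes> unit_vec 0 i) \<oplus>\<^bsub>cyc_sum R H 2\<^esub> ?cH (\<lambda>i. y \<otimes> unit_vec 1 i))"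
      unfolding pair_def using cyc_sum_add[OF H xu] by simp
    also have "\<dots> = f (?cH (\<lambda>i. x \<otimes> unit_vec 0 i)) \<oplus>\<^bsub>cyc_sum R K n\<^esub> f (?cH (\<lambda>i. y \<otimes> unit_vec 1 i))"
      by (rule mod_homD(2)[OF f cc[OF xu(1)] cc[OF xu(2)]])
    also have "f (?cH (\<lambda>i. x \<otimes> unit_vec 0 i)) = ?cK (\<lambda>i. x \<otimes> p i)"
      unfolding s mod_homD(3)[OF f xy(1) cc[OF uc(1)]] p(2) by (rule cyc_sum_smult[OF K xy(1) p(1)])
    also have "f (?cH (\<lambda>i. y \<otimes> unit_vec 1 i)) = ?cK (\<lambda>i. y \<otimes> q i)"
      unfolding s mod_homD(3)[OF f xy(2) cc[OF uc(2)]] q(2) by (rule cyc_sum_smult[OF K xy(2) q(1)])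
    also have "?cK (\<lambda>i. x \<otimes> p i) \<oplus>\<^bsub>cyc_sum R K n\<^esub> ?cK (\<lambda>i. y \<otimes> q i) = ?cK (\<lambda>i. x \<otimes> p i \<oplus> y \<otimes> q i)"
      by (rule cyc_sum_add[OF K xp])
    finally show ?thesis .
  qed
  show ?thesis
  proof (rule comparison_from_generators[OF I J K[rule_format] _ _ freemod_coord[OF p(1)] freemod_coord[OF q(1)]])
    fix w assume w: "w \<in> carrier (V n)"
    have "?cK w \<in> f ` ?cH ` carrier (V 2)" using bij w carH carK by (simp add: bij_betw_def)
    then obtain v where v: "v \<in> carrier (V 2)" "f (?cH v) = ?cK w" by auto
    define x y where "x = v 0" and "y = v 1"
    have xy: "x \<in> carrier R" "y \<in> carrier R" using freemod_coord[OF v(1)] by (simp_all add: x_def y_def)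
    have "v = pair x y"
    proof
      fix i :: nat
      consider "i = 0" | "i = 1" | "i \<ge> 2" by linarith
      then show "v i = pair x y i"
        using v(1) xy by cases (auto simp: pair_def unit_vec_def x_def y_def freemod_carrier)
    qed
    then have "?cK (\<lambda>i. x \<otimes> p i \<oplus> y \<otimes> q i) = ?cK w" using v fpair[OF xy] by simp
    then have "\<forall>j<n. (x \<otimes> p j \<oplus> y \<otimes> q j) \<ominus> w j \<in> K j" using cyc_cls_eq_iff[OF K comb[OF xy] w] by simp
    then show "\<exists>x\<in>carrier R. \<exists>y\<in>carrier R. \<forall>j<n. (x \<otimes> p j \<oplus> y \<otimes> q j) \<ominus> w j \<in> K j" using xy by blast
  next
    fix x y assume xy: "x \<in> carrier R" "y \<in> carrier R"
    have z2: "pair \<zero> \<zero> \<in> carrier (V 2)" by (rule pair) simp_all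
    have zn: "(\<lambda>i. \<zero> \<otimes> p i \<oplus> \<zero> \<otimes> q i) \<in> carrier (V n)" by (rule comb) simp_all
    have Kc: "x \<otimes> p j \<oplus> y \<otimes> q j \<in> carrier R" for j using freemod_coord[OF comb[OF xy], of j] .
    have "(\<forall>j<n. x \<otimes> p j \<oplus> y \<otimes> q j \<in> K j)
        \<longleftrightarrow> ?cK (\<lambda>i. x \<otimes> p i \<oplus> y \<otimes> q i) = ?cK (\<lambda>i. \<zero> \<otimes> p i \<oplus> \<zero> \<otimes> q i)"
      unfolding cyc_cls_eq_iff[OF K comb[OF xy] zn]
      using Kc freemod_coord[OF p(1)] freemod_coord[OF q(1)] by (simp add: a_minus_def)
    also have "\<dots> \<longleftrightarrow> f (?cH (pair x y)) = f (?cH (pair \<zero> \<zero>))" using fpair[OF xy] fpair[of \<zero> \<zero>] by simp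
    also have "\<dots> \<longleftrightarrow> ?cH (pair x y) = ?cH (pair \<zero> \<zero>)"
      using bij pair[OF xy] z2 carH by (metis bij_betw_def image_eqI inj_on_eq_iff)
    also have "\<dots> \<longleftrightarrow> (\<forall>i<2. pair x y i \<ominus> pair \<zero> \<zero> i \<in> H i)" by (rule cyc_cls_eq_iff[OF H pair[OF xy] z2])
    also have "\<dots> \<longleftrightarrow> x \<in> I \<and> y \<in> J"
      using xy by (auto simp: less_2_cases_iff pair_def unit_vec_def H_def a_minus_def)
    finally show "(\<forall>j<n. x \<otimes> p j \<oplus> y \<otimes> q j \<in> K j) \<longleftrightarrow> x \<in> I \<and> y \<in> J" .
  qed (use chain proper in auto)
qed

lemma CF_ring_comparison: "CF_ring R \<Longrightarrow> plain_comparison R"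
proof unfold_locales
  fix I J assume CF: "CF_ring R" and IJ: "ideal I R" "ideal J R"
  show "\<exists>c\<in>carrier R. \<exists>d\<in>carrier R. c \<oplus> d = \<one> \<and> (\<forall>x\<in>J. c \<otimes> x \<in> I) \<and> (\<forall>x\<in>I. d \<otimes> x \<in> J)"
    using CF_ring_colon[OF CF IJ] by (auto simp: colon_def)
qed

end

section \<open>Localisation at a prime ideal\<close>

locale prime_localization = plain_cring R for R :: "'a ring" (structure) +
  fixes P
  assumes prime: "primeideal P R"
begin

abbreviation "D \<equiv> carrier R - P"
abbreviation "lfrac \<equiv> loc_cls R P"
abbreviation "S \<equiv> localization R P"

definition frac_rel :: "'a \<Rightarrow> 'a \<Rightarrow> 'a \<Rightarrow> 'a \<Rightarrow> bool" where
  "frac_rel r s r' s' \<longleftrightarrow> (\<exists>t\<in>D. t \<otimes> (r \<otimes> s' \<ominus> r' \<otimes> s) = \<zero>)"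

lemma D_carrier: "s \<in> D \<Longrightarrow> s \<in> carrier R"
  by simp

lemma D_one: "\<one> \<in> D"
  using primeideal_one_notin[OF prime] by simp

lemma D_mult: "s \<in> D \<Longrightarrow> t \<in> D \<Longrightarrow> s \<otimes> t \<in> D"
  by (rule primeideal_mult_notin[OF prime])

lemma mem_frac: "(r', s') \<in> lfrac r s \<longleftrightarrow> r' \<in> carrier R \<and> s' \<in> D \<and> frac_rel r s r' s'"
  by (auto simp: loc_cls_def frac_rel_def)

lemma frac_relI:
  assumes "r \<otimes> s' = r' \<otimes> s" "r \<in> carrier R" "r' \<in> carrier R" "s \<in> D" "s' \<in> D"
  shows "frac_rel r s r' s'"
  using assms D_one by (auto simp: frac_rel_def a_minus_def r_neg intro!: bexI[of _ \<one>])

lemma frac_rel_sym: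
  assumes "frac_rel r s r' s'" "r \<in> carrier R" "r' \<in> carrier R" "s \<in> D" "s' \<in> D"
  shows "frac_rel r' s' r s"
proof -
  obtain t where t: "t \<in> D" "t \<otimes> (r \<otimes> s' \<ominus> r' \<otimes> s) = \<zero>" using assms by (auto simp: frac_rel_def)
  have "t \<otimes> (r' \<otimes> s \<ominus> r \<otimes> s') = \<ominus> (t \<otimes> (r \<otimes> s' \<ominus> r' \<otimes> s))"
    using assms(2,3) D_carrier[OF assms(4)] D_carrier[OF assms(5)] D_carrier[OF t(1)] by algebra
  then show ?thesis using t by (auto simp: frac_rel_def)
qed

text \<open>The multiplier needs the middle denominator \<open>s'\<close> besides \<open>t\<close>
  and \<open>t'\<close>: combining the two relations yields the third only after multiplication by
  \<open>s'\<close>.\<close>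

lemma frac_rel_trans:
  assumes "frac_rel r s r' s'" "frac_rel r' s' r'' s''"
    and c: "r \<in> carrier R" "r' \<in> carrier R" "r'' \<in> carrier R" "s \<in> D" "s' \<in> D" "s'' \<in> D"
  shows "frac_rel r s r'' s''"
proof -
  obtain t t' where t: "t \<in> D" "t \<otimes> (r \<otimes> s' \<ominus> r' \<otimes> s) = \<zero>"
    and t': "t' \<in> D" "t' \<otimes> (r' \<otimes> s'' \<ominus> r'' \<otimes> s') = \<zero>"
    using assms(1,2) by (auto simp: frac_rel_def)
  note cc = c(1-3) c(4-6)[THEN D_carrier] t(1)[THEN D_carrier] t'(1)[THEN D_carrier]
  have "t \<otimes> t' \<otimes> s' \<otimes> (r \<otimes> s'' \<ominus> r'' \<otimes> s)
      = t' \<otimes> s'' \<otimes> (t \<otimes> (r \<otimes> s' \<ominus> r' \<otimes> s)) \<oplus> t \<otimes> s \<otimes> (t' \<otimes> (r' \<otimes> s'' \<ominus> r'' \<otimes> s'))"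
    using cc by algebra
  also have "\<dots> = \<zero>" using t(2) t'(2) cc by simp
  finally show ?thesis using D_mult[OF D_mult[OF t(1) t'(1)] c(5)] unfolding frac_rel_def by blast
qed

lemma frac_eq_iff:
  assumes c: "r \<in> carrier R" "r' \<in> carrier R" "s \<in> D" "s' \<in> D"
  shows "lfrac r s = lfrac r' s' \<longleftrightarrow> frac_rel r s r' s'"
proof
  assume "lfrac r s = lfrac r' s'"
  moreover have "(r', s') \<in> lfrac r' s'" using c by (simp add: mem_frac frac_relI)
  ultimately show "frac_rel r s r' s'" using mem_frac by blast
next
  have sub: "lfrac x y \<subseteq> lfrac x' y'"
    if "frac_rel x y x' y'" "x \<in> carrier R" "x' \<in> carrier R" "y \<in> D" "y' \<in> D" for x y x' y'
  proof
    fix z assume z: "z \<in> lfrac x y"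
    obtain u v where uv: "z = (u, v)" by (cases z)
    have m: "u \<in> carrier R" "v \<in> D" "frac_rel x y u v" using z by (simp_all add: uv mem_frac)
    then have "frac_rel x' y' u v"
      using frac_rel_trans[OF frac_rel_sym[OF that] m(3)] that by blast
    then show "z \<in> lfrac x' y'" using m by (simp add: uv mem_frac)
  qed
  assume "frac_rel r s r' s'"
  then show "lfrac r s = lfrac r' s'" using sub frac_rel_sym c by (metis subset_antisym)
qed

lemma frac_self: "\<lbrakk>r \<in> carrier R; s \<in> D\<rbrakk> \<Longrightarrow> (r, s) \<in> lfrac r s"
  by (simp add: mem_frac frac_relI)

lemma frac_mult:
  assumes c: "a \<in> carrier R" "b \<in> D" "c \<in> carrier R" "d \<in> D"
  shows "lfrac a b \<otimes>\<^bsub>S\<^esub> lfrac c d = lfrac (a \<otimes> c) (b \<otimes> d)"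
proof -
  have eq: "lfrac (a' \<otimes> c') (b' \<otimes> d') = lfrac (a \<otimes> c) (b \<otimes> d)"
    if mem: "(a', b') \<in> lfrac a b" "(c', d') \<in> lfrac c d" for a' b' c' d'
  proof -
    have m: "a' \<in> carrier R" "b' \<in> D" "c' \<in> carrier R" "d' \<in> D" using mem by (simp_all add: mem_frac)
    obtain t where t: "t \<in> D" "t \<otimes> (a \<otimes> b' \<ominus> a' \<otimes> b) = \<zero>"
      using mem(1) unfolding mem_frac frac_rel_def by auto
    obtain u where u: "u \<in> D" "u \<otimes> (c \<otimes> d' \<ominus> c' \<otimes> d) = \<zero>"
      using mem(2) unfolding mem_frac frac_rel_def by auto
    note cc = c(1,3) m(1,3) c(2,4)[THEN D_carrier] m(2,4)[THEN D_carrier] t(1)[THEN D_carrier] u(1)[THEN D_carrier]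
    have "t \<otimes> u \<otimes> (a \<otimes> c \<otimes> (b' \<otimes> d') \<ominus> a' \<otimes> c' \<otimes> (b \<otimes> d))
        = u \<otimes> c \<otimes> d' \<otimes> (t \<otimes> (a \<otimes> b' \<ominus> a' \<otimes> b)) \<oplus> t \<otimes> a' \<otimes> b \<otimes> (u \<otimes> (c \<otimes> d' \<ominus> c' \<otimes> d))"
      using cc by algebra
    also have "\<dots> = \<zero>" using t u cc by simp
    finally have "frac_rel (a \<otimes> c) (b \<otimes> d) (a' \<otimes> c') (b' \<otimes> d')"
      unfolding frac_rel_def using D_mult[OF t(1) u(1)] by blast
    then show ?thesis
      using frac_eq_iff[of "a \<otimes> c" "a' \<otimes> c'" "b \<otimes> d" "b' \<otimes> d'"] c m D_mult[OF c(2,4)] D_mult[OF m(2,4)] by simp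
  qed
  have "{lfrac (a' \<otimes> c') (b' \<otimes> d') | a' b' c' d'. (a', b') \<in> lfrac a b \<and> (c', d') \<in> lfrac c d}
      = {lfrac (a \<otimes> c) (b \<otimes> d)}" (is "?T = {?x}")
  proof (intro equalityI subsetI)
    fix x assume "x \<in> ?T"
    then obtain a' b' c' d' where "(a', b') \<in> lfrac a b" "(c', d') \<in> lfrac c d" "x = lfrac (a' \<otimes> c') (b' \<otimes> d')"
      by blast
    then show "x \<in> {?x}" using eq[of a' b' c' d'] by simp
  next
    fix x assume "x \<in> {?x}"
    then show "x \<in> ?T" using frac_self[OF c(1,2)] frac_self[OF c(3,4)] by blast
  qed
  then show ?thesis by (simp add: localization_def)
qed

lemma frac_add:
  assumes c: "a \<in> carrier R" "b \<in> D" "c \<in> carrier R" "d \<in> D"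
  shows "lfrac a b \<oplus>\<^bsub>S\<^esub> lfrac c d = lfrac (a \<otimes> d \<oplus> c \<otimes> b) (b \<otimes> d)"
proof -
  have eq: "lfrac (a' \<otimes> d' \<oplus> c' \<otimes> b') (b' \<otimes> d') = lfrac (a \<otimes> d \<oplus> c \<otimes> b) (b \<otimes> d)"
    if mem: "(a', b') \<in> lfrac a b" "(c', d') \<in> lfrac c d" for a' b' c' d'
  proof -
    have m: "a' \<in> carrier R" "b' \<in> D" "c' \<in> carrier R" "d' \<in> D" using mem by (simp_all add: mem_frac)
    obtain t where t: "t \<in> D" "t \<otimes> (a \<otimes> b' \<ominus> a' \<otimes> b) = \<zero>"
      using mem(1) unfolding mem_frac frac_rel_def by auto
    obtain u where u: "u \<in> D" "u \<otimes> (c \<otimes> d' \<ominus> c' \<otimes> d) = \<zero>"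
      using mem(2) unfolding mem_frac frac_rel_def by auto
    note cc = c(1,3) m(1,3) c(2,4)[THEN D_carrier] m(2,4)[THEN D_carrier] t(1)[THEN D_carrier] u(1)[THEN D_carrier]
    have "t \<otimes> u \<otimes> ((a \<otimes> d \<oplus> c \<otimes> b) \<otimes> (b' \<otimes> d') \<ominus> (a' \<otimes> d' \<oplus> c' \<otimes> b') \<otimes> (b \<otimes> d))
        = u \<otimes> d \<otimes> d' \<otimes> (t \<otimes> (a \<otimes> b' \<ominus> a' \<otimes> b)) \<oplus> t \<otimes> b \<otimes> b' \<otimes> (u \<otimes> (c \<otimes> d' \<ominus> c' \<otimes> d))"
      using cc by algebra
    also have "\<dots> = \<zero>" using t u cc by simp
    finally have "frac_rel (a \<otimes> d \<oplus> c \<otimes> b) (b \<otimes> d) (a' \<otimes> d' \<oplus> c' \<otimes> b') (b' \<otimes> d')"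
      unfolding frac_rel_def using D_mult[OF t(1) u(1)] by blast
    then show ?thesis
      using frac_eq_iff[of "a \<otimes> d \<oplus> c \<otimes> b" "a' \<otimes> d' \<oplus> c' \<otimes> b'" "b \<otimes> d" "b' \<otimes> d'"]
        cc D_mult[OF c(2,4)] D_mult[OF m(2,4)] by simp
  qed
  have "{lfrac (a' \<otimes> d' \<oplus> c' \<otimes> b') (b' \<otimes> d') | a' b' c' d'. (a', b') \<in> lfrac a b \<and> (c', d') \<in> lfrac c d}
      = {lfrac (a \<otimes> d \<oplus> c \<otimes> b) (b \<otimes> d)}" (is "?T = {?x}")
  proof (intro equalityI subsetI)
    fix x assume "x \<in> ?T"
    then obtain a' b' c' d' where "(a', b') \<in> lfrac a b" "(c', d') \<in> lfrac c d"
      "x = lfrac (a' \<otimes> d' \<oplus> c' \<otimes> b') (b' \<otimes> d')" by blast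
    then show "x \<in> {?x}" using eq[of a' b' c' d'] by simp
  next
    fix x assume "x \<in> {?x}"
    then show "x \<in> ?T" using frac_self[OF c(1,2)] frac_self[OF c(3,4)] by blast
  qed
  then show ?thesis by (simp add: localization_def)
qed

lemma loc_carrier: "x \<in> carrier S \<longleftrightarrow> (\<exists>r\<in>carrier R. \<exists>s\<in>D. x = lfrac r s)"
  by (auto simp: localization_def)

lemma loc_one_zero: "\<one>\<^bsub>S\<^esub> = lfrac \<one> \<one>" "\<zero>\<^bsub>S\<^esub> = lfrac \<zero> \<one>"
  by (simp_all add: localization_def)

lemma frac_carrier: "\<lbrakk>r \<in> carrier R; s \<in> D\<rbrakk> \<Longrightarrow> lfrac r s \<in> carrier S"
  using loc_carrier by blast

lemma loc_cring: "cring S"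
proof (rule cringI)
  show "abelian_group S"
  proof (rule abelian_groupI)
    fix x y assume "x \<in> carrier S" "y \<in> carrier S"
    then obtain a b c d where e: "a \<in> carrier R" "b \<in> D" "c \<in> carrier R" "d \<in> D" "x = lfrac a b" "y = lfrac c d"
      by (auto simp: loc_carrier)
    note cc = e(1,3) e(2,4)[THEN D_carrier]
    show "x \<oplus>\<^bsub>S\<^esub> y \<in> carrier S"
      unfolding e(5,6) frac_add[OF e(1-4)] using cc by (intro frac_carrier D_mult e(2,4)) auto
    show "x \<oplus>\<^bsub>S\<^esub> y = y \<oplus>\<^bsub>S\<^esub> x"
      unfolding e(5,6) frac_add[OF e(1-4)] frac_add[OF e(3,4,1,2)] using cc by (simp add: a_comm m_comm)
    fix z assume "z \<in> carrier S"
    then obtain f g where h: "f \<in> carrier R" "g \<in> D" "z = lfrac f g" by (auto simp: loc_carrier)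
    have "(a \<otimes> d \<oplus> c \<otimes> b) \<otimes> g \<oplus> f \<otimes> (b \<otimes> d) = a \<otimes> (d \<otimes> g) \<oplus> (c \<otimes> g \<oplus> f \<otimes> d) \<otimes> b"
      using cc h(1) D_carrier[OF h(2)] by algebra
    moreover have s: "a \<otimes> d \<oplus> c \<otimes> b \<in> carrier R" "c \<otimes> g \<oplus> f \<otimes> d \<in> carrier R" using cc h by auto
    ultimately show "x \<oplus>\<^bsub>S\<^esub> y \<oplus>\<^bsub>S\<^esub> z = x \<oplus>\<^bsub>S\<^esub> (y \<oplus>\<^bsub>S\<^esub> z)"
      unfolding e(5,6) h(3) frac_add[OF e(1-4)] frac_add[OF e(3,4) h(1,2)]
        frac_add[OF s(1) D_mult[OF e(2,4)] h(1,2)] frac_add[OF e(1,2) s(2) D_mult[OF e(4) h(2)]]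
      using cc h by (simp add: m_assoc)
  next
    show "\<zero>\<^bsub>S\<^esub> \<in> carrier S" unfolding loc_one_zero using D_one by (intro frac_carrier) auto
  next
    fix x assume "x \<in> carrier S"
    then obtain a b where e: "a \<in> carrier R" "b \<in> D" "x = lfrac a b" by (auto simp: loc_carrier)
    note cc = e(1) D_carrier[OF e(2)]
    show "\<zero>\<^bsub>S\<^esub> \<oplus>\<^bsub>S\<^esub> x = x"
      unfolding loc_one_zero e(3) frac_add[OF zero_closed D_one e(1,2)] using cc by simp
    have "lfrac (\<ominus> a) b \<oplus>\<^bsub>S\<^esub> x = lfrac (\<ominus> a \<otimes> b \<oplus> a \<otimes> b) (b \<otimes> b)"
      unfolding e(3) by (rule frac_add[OF a_inv_closed[OF e(1)] e(2) e(1,2)])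
    also have "\<ominus> a \<otimes> b \<oplus> a \<otimes> b = \<zero>" using cc by algebra
    also have "lfrac \<zero> (b \<otimes> b) = \<zero>\<^bsub>S\<^esub>"
      unfolding loc_one_zero using D_mult[OF e(2,2)] D_one cc
      by (subst frac_eq_iff) (auto intro!: frac_relI)
    finally show "\<exists>y\<in>carrier S. y \<oplus>\<^bsub>S\<^esub> x = \<zero>\<^bsub>S\<^esub>"
      using frac_carrier[OF a_inv_closed[OF e(1)] e(2)] by blast
  qed
  show "comm_monoid S"
  proof (rule comm_monoidI)
    fix x y assume "x \<in> carrier S" "y \<in> carrier S"
    then obtain a b c d where e: "a \<in> carrier R" "b \<in> D" "c \<in> carrier R" "d \<in> D" "x = lfrac a b" "y = lfrac c d"
      by (auto simp: loc_carrier)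
    note cc = e(1,3) e(2,4)[THEN D_carrier]
    show "x \<otimes>\<^bsub>S\<^esub> y \<in> carrier S"
      unfolding e(5,6) frac_mult[OF e(1-4)] using cc by (intro frac_carrier D_mult e(2,4)) auto
    show "x \<otimes>\<^bsub>S\<^esub> y = y \<otimes>\<^bsub>S\<^esub> x"
      unfolding e(5,6) frac_mult[OF e(1-4)] frac_mult[OF e(3,4,1,2)] using cc by (simp add: m_comm)
    fix z assume "z \<in> carrier S"
    then obtain f g where h: "f \<in> carrier R" "g \<in> D" "z = lfrac f g" by (auto simp: loc_carrier)
    show "x \<otimes>\<^bsub>S\<^esub> y \<otimes>\<^bsub>S\<^esub> z = x \<otimes>\<^bsub>S\<^esub> (y \<otimes>\<^bsub>S\<^esub> z)"
      unfolding e(5,6) h(3) frac_mult[OF e(1-4)] frac_mult[OF e(3,4) h(1,2)]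
        frac_mult[OF m_closed[OF e(1,3)] D_mult[OF e(2,4)] h(1,2)]
        frac_mult[OF e(1,2) m_closed[OF e(3) h(1)] D_mult[OF e(4) h(2)]]
      using cc h by (simp add: m_assoc)
  next
    show "\<one>\<^bsub>S\<^esub> \<in> carrier S" unfolding loc_one_zero using D_one by (intro frac_carrier) auto
    fix x assume "x \<in> carrier S"
    then obtain a b where e: "a \<in> carrier R" "b \<in> D" "x = lfrac a b" by (auto simp: loc_carrier)
    show "\<one>\<^bsub>S\<^esub> \<otimes>\<^bsub>S\<^esub> x = x"
      unfolding loc_one_zero e(3) frac_mult[OF one_closed D_one e(1,2)] using e by simp
  qed
  fix x y z assume "x \<in> carrier S" "y \<in> carrier S" "z \<in> carrier S"
  then obtain a b c d f g where e: "a \<in> carrier R" "b \<in> D" "c \<in> carrier R" "d \<in> D" "f \<in> carrier R" "g \<in> D"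
    "x = lfrac a b" "y = lfrac c d" "z = lfrac f g" by (auto simp: loc_carrier)
  note cc = e(1,3,5) e(2,4,6)[THEN D_carrier]
  have s: "a \<otimes> d \<oplus> c \<otimes> b \<in> carrier R" using cc by simp
  \<comment> \<open>The two sides of distributivity are represented with different denominators, one
    of them with an additional factor \<open>g\<close>, so equality holds between classes and not
    between representatives.\<close>
  have "(a \<otimes> d \<oplus> c \<otimes> b) \<otimes> f \<otimes> (b \<otimes> g \<otimes> (d \<otimes> g))
      = (a \<otimes> f \<otimes> (d \<otimes> g) \<oplus> c \<otimes> f \<otimes> (b \<otimes> g)) \<otimes> (b \<otimes> d \<otimes> g)"
    using cc by algebra
  then have rel: "frac_rel ((a \<otimes> d \<oplus> c \<otimes> b) \<otimes> f) (b \<otimes> d \<otimes> g)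
      (a \<otimes> f \<otimes> (d \<otimes> g) \<oplus> c \<otimes> f \<otimes> (b \<otimes> g)) (b \<otimes> g \<otimes> (d \<otimes> g))"
    using cc e by (intro frac_relI D_mult) simp_all
  have "lfrac ((a \<otimes> d \<oplus> c \<otimes> b) \<otimes> f) (b \<otimes> d \<otimes> g)
      = lfrac (a \<otimes> f \<otimes> (d \<otimes> g) \<oplus> c \<otimes> f \<otimes> (b \<otimes> g)) (b \<otimes> g \<otimes> (d \<otimes> g))"
  proof (rule iffD2[OF frac_eq_iff rel])
    show "b \<otimes> d \<otimes> g \<in> D" "b \<otimes> g \<otimes> (d \<otimes> g) \<in> D" by (intro D_mult e(2,4,6))+
  qed (use cc in auto)
  then show "(x \<oplus>\<^bsub>S\<^esub> y) \<otimes>\<^bsub>S\<^esub> z = x \<otimes>\<^bsub>S\<^esub> z \<oplus>\<^bsub>S\<^esub> y \<otimes>\<^bsub>S\<^esub> z"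
    unfolding e(7-9) frac_add[OF e(1-4)] frac_mult[OF e(1,2,5,6)] frac_mult[OF e(3,4,5,6)]
      frac_mult[OF s D_mult[OF e(2,4)] e(5,6)]
      frac_add[OF m_closed[OF e(1,5)] D_mult[OF e(2,6)] m_closed[OF e(3,5)] D_mult[OF e(4,6)]] .
qed

end

sublocale prime_localization \<subseteq> S: plain_cring "localization R P"
  by (rule plain_cring.intro[OF loc_cring])

section \<open>Annihilators and principal ideals of fractions\<close>

context prime_localization
begin

lemma frac_mem_annih:
  assumes c: "a \<in> carrier R" "s \<in> D" "r \<in> carrier R" "t \<in> D"
  shows "lfrac r t \<in> S.annih (lfrac a s) \<longleftrightarrow> (\<exists>u\<in>D. u \<otimes> (a \<otimes> r) = \<zero>)"
proof -
  have "lfrac r t \<in> S.annih (lfrac a s) \<longleftrightarrow> lfrac (a \<otimes> r) (s \<otimes> t) = lfrac \<zero> \<one>"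
    using frac_carrier[OF c(3,4)] by (simp add: S.annih_def frac_mult[OF c] loc_one_zero)
  also have "\<dots> \<longleftrightarrow> frac_rel (a \<otimes> r) (s \<otimes> t) \<zero> \<one>"
    using c by (intro frac_eq_iff D_mult D_one) auto
  also have "\<dots> \<longleftrightarrow> (\<exists>u\<in>D. u \<otimes> (a \<otimes> r) = \<zero>)"
    unfolding frac_rel_def using c D_mult[OF c(2,4)] by (simp add: a_minus_def)
  finally show ?thesis .
qed

text \<open>Denominators are units in the localisation, so \<open>s\<close> and \<open>t\<close> do
  not matter. Together with \<open>frac_mem_annih\<close> this identifies the condition with
  multipliers outside \<open>P\<close>, used in \<open>R\<close> so far, with statements about the
  ring \<open>S\<close>.\<close>

lemma frac_mem_PIdl:
  assumes c: "b \<in> carrier R" "s \<in> D" "r \<in> carrier R" "t \<in> D"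
  shows "lfrac r t \<in> PIdl\<^bsub>S\<^esub> (lfrac b s) \<longleftrightarrow> (\<exists>u\<in>D. u \<otimes> r \<in> PIdl b)"
proof
  note cc = c(1,3) c(2,4)[THEN D_carrier]
  assume "lfrac r t \<in> PIdl\<^bsub>S\<^esub> (lfrac b s)"
  then obtain z where z: "z \<in> carrier S" "lfrac r t = z \<otimes>\<^bsub>S\<^esub> lfrac b s"
    by (auto simp: S.mem_PIdl)
  then obtain x y where xy: "x \<in> carrier R" "y \<in> D" "lfrac r t = lfrac x y \<otimes>\<^bsub>S\<^esub> lfrac b s"
    by (auto simp: loc_carrier)
  have "lfrac r t = lfrac (x \<otimes> b) (y \<otimes> s)" using xy frac_mult[OF xy(1,2) c(1,2)] by simp
  then have "frac_rel r t (x \<otimes> b) (y \<otimes> s)"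
    using frac_eq_iff[OF c(3) m_closed[OF xy(1) c(1)] c(4) D_mult[OF xy(2) c(2)]] by simp
  then obtain v where v: "v \<in> D" "v \<otimes> (r \<otimes> (y \<otimes> s) \<ominus> x \<otimes> b \<otimes> t) = \<zero>" by (auto simp: frac_rel_def)
  note cc = cc xy(1) D_carrier[OF xy(2)] D_carrier[OF v(1)]
  have "v \<otimes> (y \<otimes> s) \<otimes> r = v \<otimes> (r \<otimes> (y \<otimes> s) \<ominus> x \<otimes> b \<otimes> t) \<oplus> v \<otimes> x \<otimes> t \<otimes> b"
    using cc by algebra
  also have "\<dots> = v \<otimes> x \<otimes> t \<otimes> b" using v cc by simp
  also have "\<dots> \<in> PIdl b" using cc by (intro PIdl_mult_mem) auto
  finally show "\<exists>u\<in>D. u \<otimes> r \<in> PIdl b" using D_mult[OF v(1) D_mult[OF xy(2) c(2)]] by blast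
next
  note cc = c(1,3) c(2,4)[THEN D_carrier]
  assume "\<exists>u\<in>D. u \<otimes> r \<in> PIdl b"
  then obtain u x where u: "u \<in> D" "x \<in> carrier R" "u \<otimes> r = x \<otimes> b" by (auto simp: mem_PIdl)
  have xs: "x \<otimes> s \<in> carrier R" "u \<otimes> t \<in> D" "x \<otimes> s \<otimes> b \<in> carrier R" "u \<otimes> t \<otimes> s \<in> D"
    using D_mult[OF u(1) c(4)] D_mult[OF D_mult[OF u(1) c(4)] c(2)] u(2) cc by simp_all
  have "lfrac (x \<otimes> s) (u \<otimes> t) \<otimes>\<^bsub>S\<^esub> lfrac b s = lfrac (x \<otimes> s \<otimes> b) (u \<otimes> t \<otimes> s)"
    by (rule frac_mult[OF xs(1,2) c(1,2)])
  also have "\<dots> = lfrac r t"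
  proof (rule iffD2[OF frac_eq_iff[OF xs(3) c(3) xs(4) c(4)]], rule frac_relI)
    have "x \<otimes> s \<otimes> b \<otimes> t = s \<otimes> t \<otimes> (x \<otimes> b)" using cc u(2) by algebra
    also have "\<dots> = s \<otimes> t \<otimes> (u \<otimes> r)" by (simp only: u(3))
    also have "\<dots> = r \<otimes> (u \<otimes> t \<otimes> s)" using cc D_carrier[OF u(1)] by algebra
    finally show "x \<otimes> s \<otimes> b \<otimes> t = r \<otimes> (u \<otimes> t \<otimes> s)" .
  qed (use xs c in auto)
  finally show "lfrac r t \<in> PIdl\<^bsub>S\<^esub> (lfrac b s)"
    using S.PIdl_mult_mem[OF frac_carrier[OF c(1,2)] frac_carrier[OF xs(1,2)]] by (simp only:)
qed

end

section \<open>Transfer of coherence between the ring and its localisations\<close>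

context plain_comparison
begin

text \<open>The localisation is a valuation ring: of the generator found so far and the next element
  one divides the other, and the divisor generates both.\<close>

lemma localization_finitely_generated_principal:
  assumes P: "primeideal P R" and X: "finite X" "X \<subseteq> carrier (localization R P)"
  shows "\<exists>x\<in>carrier (localization R P). Idl\<^bsub>localization R P\<^esub> X = PIdl\<^bsub>localization R P\<^esub> x"
proof -
  interpret prime_localization R P by (intro prime_localization.intro plain_cring_axioms prime_localization_axioms.intro P)
  show ?thesis using X
  proof (induct X)
    case empty
    have "Idl\<^bsub>S\<^esub> {} = {\<zero>\<^bsub>S\<^esub>}"
      using S.genideal_minimal[OF S.zeroideal, of "{}"] S.ideal_zero_mem[OF S.genideal_ideal[of "{}"]]
      by auto
    moreover have "PIdl\<^bsub>S\<^esub> \<zero>\<^bsub>S\<^esub> = {\<zero>\<^bsub>S\<^esub>}"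
      using S.cgenideal_eq_genideal[OF S.zero_closed] S.genideal_zero by simp
    ultimately show ?case using S.zero_closed by (intro bexI[of _ "\<zero>\<^bsub>S\<^esub>"]) auto
  next
    case (insert y X)
    then obtain x where x: "x \<in> carrier S" "Idl\<^bsub>S\<^esub> X = PIdl\<^bsub>S\<^esub> x" by auto
    have y: "y \<in> carrier S" and XS: "X \<subseteq> carrier S" using insert by auto
    have sub: "X \<subseteq> PIdl\<^bsub>S\<^esub> x" using S.genideal_self[OF XS] x by simp
    have big: "ideal (Idl\<^bsub>S\<^esub> (insert y X)) S" "y \<in> Idl\<^bsub>S\<^esub> (insert y X)" "X \<subseteq> Idl\<^bsub>S\<^esub> (insert y X)"
      using S.genideal_ideal[of "insert y X"] S.genideal_self[of "insert y X"] y XS by auto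
    have xb: "x \<in> Idl\<^bsub>S\<^esub> (insert y X)"
      using S.genideal_minimal[OF big(1,3)] x S.cgenideal_self[OF x(1)] by auto
    obtain a s b t where ab: "a \<in> carrier R" "s \<in> D" "x = lfrac a s" "b \<in> carrier R" "t \<in> D" "y = lfrac b t"
      using x y by (auto simp: loc_carrier)
    obtain u r where u: "u \<in> D" "r \<in> carrier R" "u \<otimes> b = r \<otimes> a \<or> u \<otimes> a = r \<otimes> b"
      using prime_divisibility[OF P ab(1,4)] by metis
    from u(3) show ?case
    proof
      assume "u \<otimes> b = r \<otimes> a"
      then have "u \<otimes> b \<in> PIdl a" using PIdl_mult_mem[OF ab(1) u(2)] by simp
      then have "y \<in> PIdl\<^bsub>S\<^esub> x"
        unfolding ab frac_mem_PIdl[OF ab(1,2,4,5)] using u(1) by blast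
      then have "Idl\<^bsub>S\<^esub> (insert y X) \<subseteq> PIdl\<^bsub>S\<^esub> x"
        using sub by (intro S.genideal_minimal S.cgenideal_ideal x) auto
      then show ?thesis using S.PIdl_subset[OF big(1) xb] x by blast
    next
      assume "u \<otimes> a = r \<otimes> b"
      then have "u \<otimes> a \<in> PIdl b" using PIdl_mult_mem[OF ab(4) u(2)] by simp
      then have "x \<in> PIdl\<^bsub>S\<^esub> y"
        unfolding ab frac_mem_PIdl[OF ab(4,5,1,2)] using u(1) by blast
      then have "PIdl\<^bsub>S\<^esub> x \<subseteq> PIdl\<^bsub>S\<^esub> y" by (rule S.PIdl_subset[OF S.cgenideal_ideal[OF y]])
      then have "Idl\<^bsub>S\<^esub> (insert y X) \<subseteq> PIdl\<^bsub>S\<^esub> y"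
        using sub S.cgenideal_self[OF y] by (intro S.genideal_minimal S.cgenideal_ideal y) auto
      then show ?thesis using S.PIdl_subset[OF big(1,2)] y by blast
    qed
  qed
qed

text \<open>Finitely generated ideals of the localisation are principal, so only annihilators of
  single fractions remain. They come from annihilators in \<open>R\<close>, which coherence makes
  finitely generated and hence principal near \<open>M\<close>.\<close>

lemma coherent_localization:
  assumes coh: "coherent R" and M: "maximalideal M R"
  shows "coherent (localization R M)"
proof -
  note PM = primeideal_maximal[OF M]
  interpret prime_localization R M by (intro prime_localization.intro plain_cring_axioms prime_localization_axioms.intro PM)
  show ?thesis
  proof (rule S.coherent_if_principal)
    fix x assume "x \<in> carrier S"
    then obtain a s where as: "a \<in> carrier R" "s \<in> D" "x = lfrac a s" by (auto simp: loc_carrier)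
    obtain X where X: "finite X" "X \<subseteq> annih a" "annih a \<subseteq> Idl X"
      using coherent_annih_finitely_generated[OF coh as(1)] by blast
    have "\<exists>s\<in>D. s \<otimes> y \<in> Idl X" if "y \<in> annih a" for y
      using X(3) that D_one by (intro bexI[of _ \<one>]) (auto simp: annih_def)
    then obtain b where "annih_principal_near M a b"
      using annih_principal_near_gens[OF M as(1) X(1,2)] by blast
    then obtain e where b: "b \<in> annih a" and e: "e \<in> D" "\<And>y. y \<in> annih a \<Longrightarrow> e \<otimes> y \<in> PIdl b"
      by (auto simp: annih_principal_near_def)
    have bc: "b \<in> carrier R" "a \<otimes> b = \<zero>" using b by (auto simp: annih_def)
    have "lfrac b \<one> \<in> S.annih x"
      unfolding as(3) frac_mem_annih[OF as(1,2) bc(1) D_one] using bc D_one by (intro bexI[of _ \<one>]) auto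
    moreover have "S.annih x \<subseteq> PIdl\<^bsub>S\<^esub> (lfrac b \<one>)"
    proof
      fix y assume y: "y \<in> S.annih x"
      then have "y \<in> carrier S" by (simp add: S.annih_def)
      then obtain r t where rt: "r \<in> carrier R" "t \<in> D" "y = lfrac r t" by (auto simp: loc_carrier)
      obtain u where u: "u \<in> D" "u \<otimes> (a \<otimes> r) = \<zero>"
        using y unfolding as(3) rt(3) frac_mem_annih[OF as(1,2) rt(1,2)] by blast
      have "u \<otimes> r \<in> annih a" using u rt as by (simp add: annih_def m_lcomm)
      then have "e \<otimes> (u \<otimes> r) \<in> PIdl b" by (rule e(2))
      then have "e \<otimes> u \<otimes> r \<in> PIdl b" using e u rt by (simp add: m_assoc)
      then show "y \<in> PIdl\<^bsub>S\<^esub> (lfrac b \<one>)"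
        unfolding rt(3) frac_mem_PIdl[OF bc(1) D_one rt(1,2)] using D_mult[OF e(1) u(1)] by blast
    qed
    ultimately show "\<exists>b\<in>S.annih x. S.annih x \<subseteq> PIdl\<^bsub>S\<^esub> b" by blast
  qed (rule localization_finitely_generated_principal[OF PM])
qed

text \<open>Coherence of the localisation gives a generator of the annihilator at the point
  \<open>M\<close> only; spreading is what turns this into a statement on a neighbourhood.\<close>

lemma annih_principal_near_if_localization_coherent:
  assumes M: "maximalideal M R" and coh: "coherent (localization R M)" and a: "a \<in> carrier R"
  shows "\<exists>b. annih_principal_near M a b"
proof -
  note PM = primeideal_maximal[OF M]
  interpret prime_localization R M by (intro prime_localization.intro plain_cring_axioms prime_localization_axioms.intro PM)
  have fa: "lfrac a \<one> \<in> carrier S" by (rule frac_carrier[OF a D_one])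
  obtain X where X: "finite X" "X \<subseteq> S.annih (lfrac a \<one>)" "S.annih (lfrac a \<one>) \<subseteq> Idl\<^bsub>S\<^esub> X"
    using S.coherent_annih_finitely_generated[OF coh fa] by blast
  have "X \<subseteq> carrier S" using X by (auto simp: S.annih_def)
  then obtain x where x: "x \<in> carrier S" "Idl\<^bsub>S\<^esub> X = PIdl\<^bsub>S\<^esub> x"
    using localization_finitely_generated_principal[OF PM X(1)] by blast
  have "x \<in> S.annih (lfrac a \<one>)"
    using S.genideal_minimal[OF S.annih_ideal[OF fa] X(2)] x S.cgenideal_self[OF x(1)] by auto
  moreover obtain r t where rt: "r \<in> carrier R" "t \<in> D" "x = lfrac r t" using x by (auto simp: loc_carrier)
  ultimately obtain u where u: "u \<in> D" "u \<otimes> (a \<otimes> r) = \<zero>"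
    using frac_mem_annih[OF a D_one rt(1,2)] by auto
  \<comment> \<open>The numerator \<open>r\<close> annihilates \<open>a\<close> only at
    \<open>M\<close>; the factor \<open>u\<close>, a unit there, makes it an annihilator in
    \<open>R\<close> without changing the local ideal.\<close>
  have b: "u \<otimes> r \<in> annih a" using u rt a by (simp add: annih_def m_lcomm)
  show ?thesis
  proof (rule annih_principal_spread[OF M a b])
    fix y assume y: "y \<in> annih a"
    then have yc: "y \<in> carrier R" "a \<otimes> y = \<zero>" by (auto simp: annih_def)
    have "lfrac y \<one> \<in> S.annih (lfrac a \<one>)"
      unfolding frac_mem_annih[OF a D_one yc(1) D_one] using yc D_one by (intro bexI[of _ \<one>]) auto
    then have "lfrac y \<one> \<in> PIdl\<^bsub>S\<^esub> (lfrac r t)" using X(3) x rt by auto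
    then obtain v where v: "v \<in> D" "v \<otimes> y \<in> PIdl r"
      unfolding frac_mem_PIdl[OF rt(1,2) yc(1) D_one] by blast
    then obtain c where c: "c \<in> carrier R" "v \<otimes> y = c \<otimes> r" by (auto simp: mem_PIdl)
    have "u \<otimes> v \<otimes> y = u \<otimes> (v \<otimes> y)" using u v yc by (simp add: m_assoc)
    also have "\<dots> = c \<otimes> (u \<otimes> r)" unfolding c(2) using c(1) D_carrier[OF u(1)] rt(1) by algebra
    also have "\<dots> \<in> PIdl (u \<otimes> r)" using c u rt by (intro PIdl_mult_mem) auto
    finally show "\<exists>t\<in>D. t \<otimes> y \<in> PIdl (u \<otimes> r)" using D_mult[OF u(1) v(1)] by blast
  qed
qed

end

theorem theorem2p17:
  fixes R :: "'a ring"
  assumes "cring R" and "CF_ring R"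
  shows "lambda_dim R TYPE('b) \<le> 2
         \<and> (coherent R \<longleftrightarrow> (\<forall>M. maximalideal M R \<longrightarrow> coherent (localization R M)))"
proof -
  interpret plain_cring R by (rule plain_cring.intro) fact
  interpret plain_comparison R by (rule CF_ring_comparison) fact
  show ?thesis
    using lambda_dim_le_two coherent_localization
      coherent_if_annih_principal_near annih_principal_near_if_localization_coherent by blast
qed

end
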